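(* Let $s,k,l$ be integers with $s>1$ and $l>k\ge 3$. Then the Stiefel manifold $SO(sk+l)/SO(l)$ admits at least four (pairwise non-proportional) $SO(sk+l)\times (SO(k))^s$-invariant Einstein metrics, two of which are Jensen's metrics.
   Context: Put $n=sk+l$, $G=SO(n)$. Let $SO(sk)\times SO(l)\subset G$ be the standard block-diagonal subgroup, $H=SO(l)$ its second factor, and $L=(SO(k))^s\subset SO(sk)$ the block-diagonal subgroup with $s$ blocks of size $k$. The group $G\times L$ acts on $G/H$ by $(a,b)\cdot gH=agb^{-1}H$; this is well defined because $L$ commutes with $H$. A Riemannian metric on $G/H$ is called $SO(n)\times (SO(k))^s$-invariant if it is invariant under this action. A Riemannian metric $\rho$ is Einstein if $\mathrm{Ric}(\rho)=c\cdot\rho$ for some real constant $c$. Einstein metrics are counted up to scaling by a positive constant. Jensen's metrics on $SO(k_1+k_2)/SO(k_2)$ (here $k_1=sk>2$, $k_2=l$): let $B$ be the Killing form of $so(n)$, $n=k_1+k_2$, let $\langle\cdot,\cdot\rangle=-B$, and let $\mathfrak p=so(k_1)\oplus\mathfrak p_{12}$ be the $B$-orthogonal complement of $so(k_2)$ in $so(n)$, where $\mathfrak p_{12}$ is the $B$-orthogonal complement of $so(k_1)\oplus so(k_2)$ in $so(n)$. Identify $\mathfrak p$ with the tangent space of $SO(n)/SO(k_2)$ at the base point; $SO(n)$-invariant metrics correspond to $\mathrm{Ad}(SO(k_2))$-invariant inner products on $\mathfrak p$. Jensen's metrics are the two (up to scale) $SO(n)$-invariant metrics corresponding to the inner products $x_1\langle\cdot,\cdot\rangle|_{so(k_1)}+x_{12}\langle\cdot,\cdot\rangle|_{\mathfrak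 p_{12}}$ with $x_1,x_{12}>0$ and $$(k_1-2)x_{12}^2-2(k_1+k_2-2)x_1x_{12}+(k_1+k_2-1)x_1^2=0.$$ *)

theory Defs
  imports "HOL-Analysis.Analysis"
begin

section \<open>Riemannian geometry of embedded submanifolds of a Euclidean space\<close>

text \<open>
  The manifold is a subset \<open>M\<close> of a Euclidean space. Functions, vector fields and tensors on
  \<open>M\<close> are total functions on the ambient space whose values off \<open>M\<close> do not matter.
\<close>

primrec Ck_on :: "nat \<Rightarrow> 'a::euclidean_space set \<Rightarrow> ('a \<Rightarrow> 'b::real_normed_vector) \<Rightarrow> bool" where
  "Ck_on 0 U f \<longleftrightarrow> continuous_on U f"
| "Ck_on (Suc m) U f \<longleftrightarrow>
     f differentiable_on U \<and> (\<forall>v. Ck_on m U (\<lambda>x. frechet_derivative f (at x) v))"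

definition smooth_map :: "'a::euclidean_space set \<Rightarrow> ('a \<Rightarrow> 'b::real_normed_vector) \<Rightarrow> bool" where
  "smooth_map M f \<longleftrightarrow>
     (\<forall>p\<in>M. \<exists>U F. open U \<and> p \<in> U \<and> (\<forall>m. Ck_on m U F) \<and> (\<forall>x\<in>M \<inter> U. F x = f x))"

definition tangent :: "'a::euclidean_space set \<Rightarrow> 'a \<Rightarrow> 'a set" where
  "tangent M p = {v. \<exists>\<gamma>. (\<forall>t. \<gamma> t \<in> M) \<and> \<gamma> 0 = p \<and> (\<gamma> has_vector_derivative v) (at (0::real))}"

text \<open>
  The Frechet derivative within \<open>M\<close> is not unique as a linear map on the ambient space, but
  its values on the tangent space of \<open>M\<close> at \<open>p\<close> are, and \<open>diff M f p v\<close> is only used for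
  tangent vectors \<open>v\<close>.
\<close>

definition diff :: "'a::euclidean_space set \<Rightarrow> ('a \<Rightarrow> 'b::real_normed_vector) \<Rightarrow> 'a \<Rightarrow> 'a \<Rightarrow> 'b" where
  "diff M f p = frechet_derivative f (at p within M)"

definition vector_field :: "'a::euclidean_space set \<Rightarrow> ('a \<Rightarrow> 'a) \<Rightarrow> bool" where
  "vector_field M X \<longleftrightarrow> smooth_map M X \<and> (\<forall>p\<in>M. X p \<in> tangent M p)"

definition field_bracket :: "'a::euclidean_space set \<Rightarrow> ('a \<Rightarrow> 'a) \<Rightarrow> ('a \<Rightarrow> 'a) \<Rightarrow> 'a \<Rightarrow> 'a" where
  "field_bracket M X Y p = diff M Y p (X p) - diff M X p (Y p)"

type_synonym 'a tensor2 = "'a \<Rightarrow> 'a \<Rightarrow> 'a \<Rightarrow> real"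

definition riemannian_metric :: "'a::euclidean_space set \<Rightarrow> 'a tensor2 \<Rightarrow> bool" where
  "riemannian_metric M g \<longleftrightarrow>
     (\<forall>p\<in>M. \<forall>u\<in>tangent M p. \<forall>v\<in>tangent M p. \<forall>w\<in>tangent M p. \<forall>a.
        g p u v = g p v u \<and>
        g p (u + v) w = g p u w + g p v w \<and>
        g p (a *\<^sub>R u) w = a * g p u w) \<and>
     (\<forall>p\<in>M. \<forall>u\<in>tangent M p. u \<noteq> 0 \<longrightarrow> g p u u > 0) \<and>
     (\<forall>X Y. vector_field M X \<and> vector_field M Y \<longrightarrow> smooth_map M (\<lambda>p. g p (X p) (Y p)))"

definition proportional :: "'a::euclidean_space set \<Rightarrow> 'a tensor2 \<Rightarrow> 'a tensor2 \<Rightarrow> bool" where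
  "proportional M g h \<longleftrightarrow>
     (\<exists>c>0. \<forall>p\<in>M. \<forall>u\<in>tangent M p. \<forall>v\<in>tangent M p. h p u v = c * g p u v)"

type_synonym 'a connection = "('a \<Rightarrow> 'a) \<Rightarrow> ('a \<Rightarrow> 'a) \<Rightarrow> 'a \<Rightarrow> 'a"

definition affine_connection :: "'a::euclidean_space set \<Rightarrow> 'a connection \<Rightarrow> bool" where
  "affine_connection M D \<longleftrightarrow>
     (\<forall>X Y. vector_field M X \<and> vector_field M Y \<longrightarrow> vector_field M (D X Y)) \<and>
     (\<forall>X X' Y. vector_field M X \<and> vector_field M X' \<and> vector_field M Y \<longrightarrow>
        (\<forall>p\<in>M. D (\<lambda>q. X q + X' q) Y p = D X Y p + D X' Y p)) \<and>
     (\<forall>X Y Y'. vector_field M X \<and> vector_field M Y \<and> vector_field M Y' \<longrightarrow>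
        (\<forall>p\<in>M. D X (\<lambda>q. Y q + Y' q) p = D X Y p + D X Y' p)) \<and>
     (\<forall>f X Y. smooth_map M f \<and> vector_field M X \<and> vector_field M Y \<longrightarrow>
        (\<forall>p\<in>M. D (\<lambda>q. f q *\<^sub>R X q) Y p = f p *\<^sub>R D X Y p \<and>
                D X (\<lambda>q. f q *\<^sub>R Y q) p = f p *\<^sub>R D X Y p + diff M f p (X p) *\<^sub>R Y p))"

definition levi_civita :: "'a::euclidean_space set \<Rightarrow> 'a tensor2 \<Rightarrow> 'a connection \<Rightarrow> bool" where
  "levi_civita M g D \<longleftrightarrow> affine_connection M D \<and>
     (\<forall>X Y. vector_field M X \<and> vector_field M Y \<longrightarrow>
        (\<forall>p\<in>M. D X Y p - D Y X p = field_bracket M X Y p)) \<and>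
     (\<forall>X Y Z. vector_field M X \<and> vector_field M Y \<and> vector_field M Z \<longrightarrow>
        (\<forall>p\<in>M. diff M (\<lambda>q. g q (Y q) (Z q)) p (X p) = g p (D X Y p) (Z p) + g p (Y p) (D X Z p)))"

definition curvature ::
  "'a::euclidean_space set \<Rightarrow> 'a connection \<Rightarrow> ('a \<Rightarrow> 'a) \<Rightarrow> ('a \<Rightarrow> 'a) \<Rightarrow> ('a \<Rightarrow> 'a) \<Rightarrow> 'a \<Rightarrow> 'a" where
  "curvature M D X Y Z p = D X (D Y Z) p - D Y (D X Z) p - D (field_bracket M X Y) Z p"

definition trace_on :: "'a::euclidean_space set \<Rightarrow> ('a \<Rightarrow> 'a) \<Rightarrow> real" where
  "trace_on S f = (let B = (SOME B. independent B \<and> span B = S) in \<Sum>b\<in>B. representation B (f b) b)"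

text \<open>
  \<open>Ric(Y,Z)\<close> is the trace of \<open>x \<mapsto> R(x,Y)Z\<close>. Since \<open>R\<close> is tensorial, it does not matter
  which vector field extending the tangent vector \<open>x\<close> is chosen.
\<close>

definition extension :: "'a::euclidean_space set \<Rightarrow> 'a \<Rightarrow> 'a \<Rightarrow> 'a \<Rightarrow> 'a" where
  "extension M p x = (SOME X. vector_field M X \<and> X p = x)"

definition ricci ::
  "'a::euclidean_space set \<Rightarrow> 'a connection \<Rightarrow> ('a \<Rightarrow> 'a) \<Rightarrow> ('a \<Rightarrow> 'a) \<Rightarrow> 'a \<Rightarrow> real" where
  "ricci M D Y Z p = trace_on (tangent M p) (\<lambda>x. curvature M D (extension M p x) Y Z p)"

definition einstein :: "'a::euclidean_space set \<Rightarrow> 'a tensor2 \<Rightarrow> bool" where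
  "einstein M g \<longleftrightarrow> riemannian_metric M g \<and>
     (\<exists>D c. levi_civita M g D \<and>
        (\<forall>Y Z. vector_field M Y \<and> vector_field M Z \<longrightarrow>
           (\<forall>p\<in>M. ricci M D Y Z p = c * g p (Y p) (Z p))))"

definition invariant_under :: "'a::euclidean_space set \<Rightarrow> ('a \<Rightarrow> 'a) set \<Rightarrow> 'a tensor2 \<Rightarrow> bool" where
  "invariant_under M \<Phi> g \<longleftrightarrow>
     (\<forall>\<phi>\<in>\<Phi>. \<forall>p\<in>M. \<forall>u\<in>tangent M p. \<forall>v\<in>tangent M p.
        g (\<phi> p) (diff M \<phi> p u) (diff M \<phi> p v) = g p u v)"


section \<open>Stiefel manifolds\<close>

text \<open>
  Sizes of matrices are cardinalities of finite index types. Rows and columns of elements of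
  \<open>SO(k1 + k2)\<close> are indexed by a sum type \<open>'m + 'l\<close> with \<open>k1 = CARD('m)\<close> and \<open>k2 = CARD('l)\<close>,
  so that \<open>SO(k2)\<close> is the lower diagonal block. The quotient \<open>SO(k1 + k2)/SO(k2)\<close> is realised
  as the orbit of the frame consisting of the first \<open>k1\<close> unit vectors, the coset \<open>gH\<close>
  corresponding to the first \<open>k1\<close> columns of \<open>g\<close>.
\<close>

definition SO :: "(real^'n^'n) set" where
  "SO = {A. rotation_matrix A}"

definition base_frame :: "real^'m^('m + 'l::finite)" where
  "base_frame = (\<chi> i j. if i = Inl j then 1 else 0)"

definition stiefel :: "(real^'m^('m + 'l::finite)) set" where
  "stiefel = (\<lambda>g. g ** base_frame) ` SO"

definition block_diag :: "real^'m^'m \<Rightarrow> real^'l^'l \<Rightarrow> real^('m + 'l)^('m + 'l::finite)" where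
  "block_diag b c = (\<chi> i j. case (i, j) of
      (Inl a, Inl a') \<Rightarrow> b $ a $ a'
    | (Inr a, Inr a') \<Rightarrow> c $ a $ a'
    | _ \<Rightarrow> 0)"

definition act :: "real^('m + 'l)^('m + 'l) \<Rightarrow> real^'m^'m \<Rightarrow> real^'m^('m + 'l) \<Rightarrow> real^'m^('m + 'l::finite)" where
  "act a b X = a ** X ** transpose b"

lemma sum_UNIV_Plus:
  fixes f :: "'m::finite + 'l::finite \<Rightarrow> 'b::comm_monoid_add"
  shows "sum f UNIV = (\<Sum>i\<in>UNIV. f (Inl i)) + (\<Sum>i\<in>UNIV. f (Inr i))"
  unfolding UNIV_Plus_UNIV[symmetric] by (subst sum.Plus) simp_all

lemma mult_base_frame:
  fixes g :: "real^('m::finite + 'l::finite)^('m + 'l)"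
  shows "(g ** base_frame) $ i $ j = g $ i $ Inl j"
  by (simp add: matrix_matrix_mult_def base_frame_def if_distrib[of "\<lambda>x. _ * x"] cong: if_cong)

lemma SO_mult: "A \<in> SO \<Longrightarrow> B \<in> SO \<Longrightarrow> A ** B \<in> SO"
  by (simp add: SO_def rotation_matrix_def orthogonal_matrix_mul det_mul)

lemma SO_transpose: "A \<in> SO \<Longrightarrow> transpose A \<in> SO"
  by (simp add: SO_def rotation_matrix_def)

text \<open>The fibres of the projection to the orbit are the cosets of \<open>SO(k2)\<close>.\<close>

lemma stiefel_fibres:
  fixes g g' :: "real^('m::finite + 'l::finite)^('m + 'l)"
  assumes "g \<in> SO" "g' \<in> SO"
  shows "g ** base_frame = g' ** base_frame \<longleftrightarrow>
    (\<exists>h\<in>SO. (\<exists>c. h = block_diag (mat 1) c) \<and> g' = g ** h)"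
proof
  assume "\<exists>h\<in>SO. (\<exists>c. h = block_diag (mat 1) c) \<and> g' = g ** h"
  then obtain c :: "real^'l^'l" where c: "g' = g ** block_diag (mat 1) c" by blast
  have "block_diag (mat 1) c ** base_frame = (base_frame :: real^'m^('m + 'l))"
    by (simp only: vec_eq_iff mult_base_frame)
       (auto simp: block_diag_def base_frame_def mat_def split: sum.splits)
  then show "g ** base_frame = g' ** base_frame"
    by (simp add: c flip: matrix_mul_assoc)
next
  assume eq: "g ** base_frame = g' ** base_frame"
  define h where "h = transpose g ** g'"
  have h: "h \<in> SO" unfolding h_def by (intro SO_mult SO_transpose assms)
  have gg: "g ** transpose g = mat 1" "transpose g ** g = mat 1"
    using assms by (auto simp: SO_def rotation_matrix_def orthogonal_matrix_def)
  have hb: "h ** base_frame = (base_frame :: real^'m^('m + 'l))"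
    by (metis h_def eq gg(2) matrix_mul_assoc matrix_mul_lid)
  have col: "h $ i $ Inl j = (if i = Inl j then 1 else 0)" for i j
    unfolding mult_base_frame[symmetric] hb by (simp add: base_frame_def)
  have "h ** transpose h = mat 1"
    using h by (auto simp: SO_def rotation_matrix_def orthogonal_matrix_def)
  then have "(h ** transpose h) $ Inl i $ Inl i = (1::real)" for i
    by (simp add: mat_def)
  then have "(\<Sum>j\<in>UNIV. (h $ Inl i $ Inr j)\<^sup>2) = 0" for i
    by (simp add: matrix_matrix_mult_def transpose_def sum_UNIV_Plus col power2_eq_square
        if_distrib[of "\<lambda>x. x * _"] cong: if_cong)
  then have row: "h $ Inl i $ Inr j = 0" for i j
    by (simp add: sum_nonneg_eq_0_iff)
  define c :: "real^'l^'l" where "c = (\<chi> i j. h $ Inr i $ Inr j)"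
  have "block_diag (mat 1) c = h"
    by (auto simp: vec_eq_iff block_diag_def mat_def col row c_def split: sum.splits)
  moreover have "g' = g ** h" by (simp add: h_def matrix_mul_assoc gg)
  ultimately show "\<exists>h\<in>SO. (\<exists>c. h = block_diag (mat 1) c) \<and> g' = g ** h"
    using h by metis
qed

text \<open>Under this identification \<open>act a b\<close> is the map \<open>gH \<mapsto> a g b\<inverse> H\<close>.\<close>

lemma act_frame:
  fixes g :: "real^('m::finite + 'l::finite)^('m + 'l)"
  assumes "b \<in> SO"
  shows "block_diag b (mat 1) ** block_diag (transpose b) (mat 1) = (mat 1 :: real^('m + 'l)^('m + 'l))"
    and "act a b (g ** base_frame) = (a ** g ** block_diag (transpose b) (mat 1)) ** base_frame"
proof -
  have b: "b ** transpose b = mat 1"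
    using assms by (auto simp: SO_def rotation_matrix_def orthogonal_matrix_def)
  have "(b ** transpose b) $ i $ j = (if i = j then 1 else 0)" for i j
    by (simp add: b mat_def)
  then have bb: "(\<Sum>k\<in>UNIV. b $ i $ k * b $ j $ k) = (if i = j then 1 else 0)" for i j
    by (simp add: matrix_matrix_mult_def transpose_def)
  have "(block_diag b (mat 1) ** block_diag (transpose b) (mat 1)) $ i $ j =
      (mat 1 :: real^('m + 'l)^('m + 'l)) $ i $ j" for i j
    by (cases i; cases j)
       (simp_all add: matrix_matrix_mult_def sum_UNIV_Plus block_diag_def transpose_def mat_def bb
          if_distrib[of "\<lambda>x. x * _"] cong: if_cong)
  then show "block_diag b (mat 1) ** block_diag (transpose b) (mat 1) = (mat 1 :: real^('m + 'l)^('m + 'l))"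
    by (simp add: vec_eq_iff)
  have "(base_frame ** transpose b :: real^'m^('m + 'l)) $ i $ j =
      (block_diag (transpose b) (mat 1) ** base_frame) $ i $ j" for i j
    unfolding mult_base_frame
    by (cases i)
       (simp_all add: base_frame_def matrix_matrix_mult_def transpose_def block_diag_def
          if_distrib[of "\<lambda>x. x * _"] cong: if_cong)
  then have "base_frame ** transpose b = block_diag (transpose b) (mat 1) ** (base_frame :: real^'m^('m + 'l))"
    by (simp add: vec_eq_iff)
  then show "act a b (g ** base_frame) = (a ** g ** block_diag (transpose b) (mat 1)) ** base_frame"
    by (simp add: act_def flip: matrix_mul_assoc)
qed

definition SO_blocks :: "(real^('s::finite \<times> 'k::finite)^('s \<times> 'k)) set" where
  "SO_blocks = {b. \<exists>c :: 's::finite \<Rightarrow> real^'k::finite^'k. (\<forall>i. c i \<in> SO) \<and>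
     b = (\<chi> p q. if fst p = fst q then c (fst p) $ snd p $ snd q else 0)}"


section \<open>Jensen's metrics\<close>

definition so :: "(real^'n^'n) set" where
  "so = {A. transpose A = - A}"

definition commutator :: "real^'n^'n \<Rightarrow> real^'n^'n \<Rightarrow> real^'n^'n" where
  "commutator A B = A ** B - B ** A"

definition killing :: "real^'n^'n \<Rightarrow> real^'n^'n \<Rightarrow> real" where
  "killing A B = trace_on so (\<lambda>C. commutator A (commutator B C))"

definition so_upper :: "(real^('m::finite + 'l)^('m + 'l::finite)) set" where
  "so_upper = (\<lambda>A. block_diag A 0) ` so"

definition so_lower :: "(real^('m::finite + 'l)^('m + 'l::finite)) set" where
  "so_lower = (\<lambda>A. block_diag 0 A) ` so"

definition p12 :: "(real^('m::finite + 'l)^('m + 'l::finite)) set" where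
  "p12 = {C \<in> so. \<forall>A\<in>so_upper. \<forall>A'\<in>so_lower. killing C (A + A') = 0}"

text \<open>
  An element \<open>A\<close> of the complement of \<open>so(k2)\<close> is identified with the tangent vector
  \<open>A ** base_frame\<close>, the velocity at \<open>t = 0\<close> of \<open>exp(tA)\<close> acting on the base point.
\<close>

definition jensen :: "(real^'m^('m + 'l::finite)) tensor2 \<Rightarrow> bool" where
  "jensen g \<longleftrightarrow>
     riemannian_metric stiefel g \<and>
     invariant_under stiefel {act a (mat 1) |a. a \<in> SO} g \<and>
     (\<exists>x1 x12. x1 > 0 \<and> x12 > 0 \<and>
        (real CARD('m) - 2) * x12\<^sup>2 - 2 * (real CARD('m) + real CARD('l) - 2) * x1 * x12
          + (real CARD('m) + real CARD('l) - 1) * x1\<^sup>2 = 0 \<and>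
        (\<forall>A\<in>so_upper. \<forall>A'\<in>so_upper. \<forall>C\<in>p12. \<forall>C'\<in>p12.
           g base_frame ((A + C) ** base_frame) ((A' + C') ** base_frame)
             = x1 * (- killing A A') + x12 * (- killing C C')))"

end

(*
The Stiefel manifold is the orbit of SO(n) acting linearly on matrices, so the fields X |-> A X
with A skew are linear, and an invariant metric and its Christoffel tensor are polynomial in the
base point. Differentiating along A p and using invariance, the curvature at p becomes
R(A p, B p) = [L_A, L_B] - L_[A,B] with L_A v = A v + Gamma_p(A p, v).

A tangent vector at p is p W + h with W skew and p^T h = 0. For the metric
<W, c o W> + <h, h>, where c is a symmetric matrix of positive weights acting entrywise, tracing
the curvature gives a Ricci form that is again diagonal; it is computed at an
arbitrary p by tracing over Parseval frames. With weight a on the k x k diagonal blocks of W and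
weight b elsewhere, the Einstein condition is a system of two equations for (a, b). Jensen's metrics
are its solutions with a = b, the roots of a quadratic; eliminating a from the remaining factor
leaves one equation for b with a sign change on either side of b = 1/2.
*)

theory Submission
  imports Defs
begin

section \<open>Smooth maps\<close>

text \<open>\<open>einstein\<close> asks for some Levi-Civita connection, so one is exhibited and
  uniqueness is never discussed. Its Christoffel tensor is the negative of the second fundamental
  form of the Stiefel manifold in Euclidean space, plus corrections caused by the weights that
  differ from 1. The obstacle is that curvature is defined through arbitrary vector fields on a
  subset of Euclidean space and their second derivatives. Local ambient extensions and the symmetry
  of second derivatives remove these, and algebra on pairs (W, h) remains. The weight of the h part
  is fixed to 1. This uses up the scaling, so proportional metrics of the family coincide. The point
  1/2 is the weight of the metric induced by the Killing form: an element of \<open>p12\<close> has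
  twice the squared norm of its h. The hypothesis l > k is decisive there: after elimination, four
  times the remaining function is below k - l at b = 1/2.\<close>

definition smooth_on :: "'a::euclidean_space set \<Rightarrow> ('a \<Rightarrow> 'b::real_normed_vector) \<Rightarrow> bool" where
  "smooth_on U f \<longleftrightarrow> (\<forall>m. Ck_on m U f)"

section \<open>Calculus of smooth maps on open sets\<close>

lemma Ck_on_cong:
  assumes "open U" "\<And>x. x \<in> U \<Longrightarrow> f x = g x" "Ck_on m U f"
  shows "Ck_on m U g"
  using assms(2,3)
proof (induction m arbitrary: f g)
  case 0
  then show ?case by (simp cong: continuous_on_cong)
next
  case (Suc m)
  have d: "f differentiable (at x)" if "x \<in> U" for x
    using Suc.prems(2) that assms(1) by (auto simp: differentiable_on_eq_differentiable_at)
  have eq: "frechet_derivative f (at x) = frechet_derivative g (at x)" if "x \<in> U" for x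
    by (rule frechet_derivative_transform_within_open[OF d assms(1)]) (use that Suc.prems in auto)
  have "g differentiable_on U"
    using Suc.prems by (auto simp: differentiable_on_def intro: differentiable_transform_within[OF _ zero_less_one])
  moreover have "Ck_on m U (\<lambda>x. frechet_derivative g (at x) v)" for v
    by (rule Suc.IH[of "\<lambda>x. frechet_derivative f (at x) v"]) (use Suc.prems eq in auto)
  ultimately show ?case by simp
qed

lemma Ck_on_Suc_imp: "Ck_on (Suc m) U f \<Longrightarrow> Ck_on m U f"
  by (induction m arbitrary: f) (simp add: differentiable_imp_continuous_on, metis Ck_on.simps(2))

lemma Ck_on_open_subset:
  "open U \<Longrightarrow> open V \<Longrightarrow> V \<subseteq> U \<Longrightarrow> Ck_on m U f \<Longrightarrow> Ck_on m V f"
  by (induction m arbitrary: f) (auto intro: continuous_on_subset differentiable_on_subset)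

lemma Ck_on_has_derivative:
  assumes "open U" "Ck_on (Suc m) U f" "x \<in> U"
  shows "(f has_derivative frechet_derivative f (at x)) (at x)"
  using assms by (auto simp: differentiable_on_eq_differentiable_at frechet_derivative_works)

lemma Ck_on_const: "Ck_on m U (\<lambda>x. c)"
  by (induction m arbitrary: c) auto

lemma Ck_on_id: "Ck_on m U (\<lambda>x. x)"
  by (cases m) (simp_all add: Ck_on_const differentiable_on_def frechet_derivative_ident)

text \<open>Trades the choice-defined \<open>frechet_derivative\<close> for an explicit derivative,
  so that the closure rules below become inductions on the order.\<close>

lemma Ck_on_SucI:
  assumes "open U" "\<And>x. x \<in> U \<Longrightarrow> (f has_derivative f' x) (at x)" "\<And>v. Ck_on m U (\<lambda>x. f' x v)"
  shows "Ck_on (Suc m) U f"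
proof -
  have "frechet_derivative f (at x) = f' x" if "x \<in> U" for x
    using assms(2)[OF that] by (rule frechet_derivative_at[symmetric])
  then have "Ck_on m U (\<lambda>x. frechet_derivative f (at x) v)" for v
    by (intro Ck_on_cong[OF assms(1) _ assms(3)]) simp
  moreover have "f differentiable_on U"
    using assms(2) unfolding differentiable_on_def by (meson differentiableI has_derivative_at_withinI)
  ultimately show ?thesis by simp
qed

lemma Ck_on_linear:
  assumes h: "bounded_linear h" and "open U" "Ck_on m U f"
  shows "Ck_on m U (\<lambda>x. h (f x))"
  using assms(3)
proof (induction m arbitrary: f)
  case 0
  then show ?case by (simp add: bounded_linear.continuous_on[OF h])
next
  case (Suc m)
  show ?case
    by (rule Ck_on_SucI[OF assms(2), where f' = "\<lambda>x v. h (frechet_derivative f (at x) v)"])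
       (use Suc in \<open>auto intro!: bounded_linear.has_derivative[OF h] Ck_on_has_derivative[OF assms(2)]\<close>)
qed

lemma Ck_on_add:
  assumes "open U" "Ck_on m U f" "Ck_on m U g"
  shows "Ck_on m U (\<lambda>x. f x + g x)"
  using assms(2,3)
proof (induction m arbitrary: f g)
  case (Suc m)
  show ?case
    by (rule Ck_on_SucI[OF assms(1), where f' = "\<lambda>x v. frechet_derivative f (at x) v + frechet_derivative g (at x) v"])
       (use Suc in \<open>auto intro!: has_derivative_add Ck_on_has_derivative[OF assms(1)]\<close>)
qed (auto intro: continuous_on_add)

text \<open>By the product rule the derivative is a sum of two terms of the same shape, so the
  induction closes once \<open>f\<close> and \<open>g\<close> are arbitrary. Matrix products,
  scalings and inner products are all instances.\<close>

lemma Ck_on_bilinear: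
  assumes h: "bounded_bilinear h" and "open U" "Ck_on m U f" "Ck_on m U g"
  shows "Ck_on m U (\<lambda>x. h (f x) (g x))"
  using assms(3,4)
proof (induction m arbitrary: f g)
  case 0
  then show ?case by (auto intro: bounded_bilinear.continuous_on[OF h])
next
  case (Suc m)
  show ?case
  proof (rule Ck_on_SucI[OF assms(2)])
    fix x assume "x \<in> U"
    then show "((\<lambda>x. h (f x) (g x)) has_derivative (\<lambda>v. h (f x) (frechet_derivative g (at x) v)
          + h (frechet_derivative f (at x) v) (g x))) (at x)"
      by (intro bounded_bilinear.FDERIV[OF h] Ck_on_has_derivative[OF assms(2)]) (use Suc.prems in auto)
  next
    fix v
    show "Ck_on m U (\<lambda>x. h (f x) (frechet_derivative g (at x) v) + h (frechet_derivative f (at x) v) (g x))"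
      using Suc.prems by (intro Ck_on_add[OF assms(2)] Suc.IH Ck_on_Suc_imp[OF Suc.prems(1)]
          Ck_on_Suc_imp[OF Suc.prems(2)]) simp_all
  qed
qed

lemma smooth_on_linear: "bounded_linear h \<Longrightarrow> open U \<Longrightarrow> smooth_on U f \<Longrightarrow> smooth_on U (\<lambda>x. h (f x))"
  by (simp add: smooth_on_def Ck_on_linear)

lemma smooth_on_add: "open U \<Longrightarrow> smooth_on U f \<Longrightarrow> smooth_on U g \<Longrightarrow> smooth_on U (\<lambda>x. f x + g x)"
  by (simp add: smooth_on_def Ck_on_add)

lemma smooth_on_bilinear:
  "bounded_bilinear h \<Longrightarrow> open U \<Longrightarrow> smooth_on U f \<Longrightarrow> smooth_on U g \<Longrightarrow> smooth_on U (\<lambda>x. h (f x) (g x))"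
  by (simp add: smooth_on_def Ck_on_bilinear)

lemma smooth_on_const: "smooth_on U (\<lambda>x. c)"
  by (simp add: smooth_on_def Ck_on_const)

lemma smooth_on_cong: "open U \<Longrightarrow> (\<And>x. x \<in> U \<Longrightarrow> f x = g x) \<Longrightarrow> smooth_on U f \<Longrightarrow> smooth_on U g"
  unfolding smooth_on_def by (auto intro: Ck_on_cong[of U f g])

lemma smooth_on_open_subset: "open U \<Longrightarrow> open V \<Longrightarrow> V \<subseteq> U \<Longrightarrow> smooth_on U f \<Longrightarrow> smooth_on V f"
  unfolding smooth_on_def by (auto intro: Ck_on_open_subset[of U V])

lemma smooth_on_sum:
  "finite I \<Longrightarrow> open U \<Longrightarrow> (\<And>i. i \<in> I \<Longrightarrow> smooth_on U (f i)) \<Longrightarrow> smooth_on U (\<lambda>x. \<Sum>i\<in>I. f i x)"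
  by (induction I rule: finite_induct) (auto intro: smooth_on_const smooth_on_add)

lemma smooth_on_has_derivative:
  "open U \<Longrightarrow> smooth_on U f \<Longrightarrow> x \<in> U \<Longrightarrow> (f has_derivative frechet_derivative f (at x)) (at x)"
  unfolding smooth_on_def by (rule Ck_on_has_derivative[of U 0]) auto

lemma smooth_on_directional_derivative:
  "smooth_on U f \<Longrightarrow> smooth_on U (\<lambda>x. frechet_derivative f (at x) v)"
  unfolding smooth_on_def by (blast dest: Ck_on.simps(2)[THEN iffD1])

lemma smooth_on_derivative_along:
  fixes f :: "'a::euclidean_space \<Rightarrow> 'b::real_normed_vector"
  assumes "open U" "smooth_on U f" "smooth_on U X"
  shows "smooth_on U (\<lambda>x. frechet_derivative f (at x) (X x))"
proof (rule smooth_on_cong[OF assms(1)])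
  fix x assume "x \<in> U"
  then have "linear (frechet_derivative f (at x))"
    using smooth_on_has_derivative[OF assms(1,2)] has_derivative_linear by blast
  then have "frechet_derivative f (at x) (\<Sum>b\<in>Basis. (X x \<bullet> b) *\<^sub>R b)
      = (\<Sum>b\<in>Basis. (X x \<bullet> b) *\<^sub>R frechet_derivative f (at x) b)"
    \<comment> \<open>Expanding the moving direction \<open>X x\<close> in the basis leaves
      derivatives in fixed directions, which are smooth by definition.\<close>
    by (simp add: linear_sum linear_cmul)
  then show "(\<Sum>b\<in>Basis. (X x \<bullet> b) *\<^sub>R frechet_derivative f (at x) b) = frechet_derivative f (at x) (X x)"
    by (simp add: euclidean_representation)
next
  show "smooth_on U (\<lambda>x. \<Sum>b\<in>Basis. (X x \<bullet> b) *\<^sub>R frechet_derivative f (at x) b)"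
    by (intro smooth_on_sum smooth_on_bilinear[OF bounded_bilinear_scaleR] assms
        smooth_on_linear[OF bounded_linear_inner_left] smooth_on_directional_derivative finite_Basis)
qed

section \<open>Symmetry of second derivatives\<close>

lemma has_real_derivative_along_line:
  fixes f :: "'a::real_normed_vector \<Rightarrow> real"
  assumes "(f has_derivative f') (at (a + t *\<^sub>R v))"
  shows "((\<lambda>t. f (a + t *\<^sub>R v)) has_real_derivative f' v) (at t)"
proof -
  have "((\<lambda>t. f (a + t *\<^sub>R v)) has_derivative (\<lambda>t. f' (t *\<^sub>R v))) (at t)"
    by (rule has_derivative_compose[of "\<lambda>t. a + t *\<^sub>R v" _ t UNIV f f'])
       (use assms in \<open>auto intro!: derivative_eq_intros\<close>)
  moreover have "(\<lambda>t. f' (t *\<^sub>R v)) = (*) (f' v)"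
    using linear_cmul[OF has_derivative_linear[OF assms]] by (simp add: fun_eq_iff mult.commute)
  ultimately show ?thesis
    by (simp add: has_field_derivative_def)
qed

text \<open>The second difference is the increment of \<open>g\<close> over [0, h]. The derivative
  of \<open>g\<close> at an intermediate point is itself an increment, of the
  \<open>v\<close>-derivative along \<open>w\<close>, so two applications of the mean value theorem
  suffice.\<close>

lemma second_difference_mean_value:
  fixes f :: "'a::real_normed_vector \<Rightarrow> real"
  assumes df: "\<And>x. x \<in> ball p e \<Longrightarrow> (f has_derivative f' x) (at x)"
    and ddf: "\<And>x. x \<in> ball p e \<Longrightarrow> ((\<lambda>y. f' y v) has_derivative f'' x) (at x)"
    and h: "0 < h" "h * (norm v + norm w) < e"
  obtains x where "dist p x \<le> h * (norm v + norm w)"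
    and "f (p + h *\<^sub>R v + h *\<^sub>R w) - f (p + h *\<^sub>R v) - f (p + h *\<^sub>R w) + f p = h * h * f'' x w"
proof -
  have in_ball: "p + r *\<^sub>R v + t *\<^sub>R w \<in> ball p e" "dist p (p + r *\<^sub>R v + t *\<^sub>R w) \<le> h * (norm v + norm w)"
    if "0 \<le> r" "r \<le> h" "0 \<le> t" "t \<le> h" for r t
  proof -
    have "norm (r *\<^sub>R v + t *\<^sub>R w) \<le> r * norm v + t * norm w"
      using that by (intro norm_triangle_le) auto
    also have "\<dots> \<le> h * (norm v + norm w)"
      using that by (auto simp: distrib_left intro!: add_mono mult_right_mono)
    finally show "dist p (p + r *\<^sub>R v + t *\<^sub>R w) \<le> h * (norm v + norm w)"
      unfolding dist_commute[of p] by (simp add: dist_norm add.assoc)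
    then show "p + r *\<^sub>R v + t *\<^sub>R w \<in> ball p e" using h by simp
  qed
  define g where "g r = f (p + r *\<^sub>R v + h *\<^sub>R w) - f (p + r *\<^sub>R v)" for r
  have "(g has_real_derivative f' (p + r *\<^sub>R v + h *\<^sub>R w) v - f' (p + r *\<^sub>R v) v) (at r)"
    if "0 \<le> r" "r \<le> h" for r
  proof -
    have "((\<lambda>r. f ((p + h *\<^sub>R w) + r *\<^sub>R v)) has_real_derivative f' (p + r *\<^sub>R v + h *\<^sub>R w) v) (at r)"
      by (rule has_real_derivative_along_line)
         (use df[OF in_ball(1)[of r h]] that h in \<open>simp add: ac_simps\<close>)
    moreover have "((\<lambda>r. f (p + r *\<^sub>R v)) has_real_derivative f' (p + r *\<^sub>R v) v) (at r)"
      by (rule has_real_derivative_along_line) (use df[OF in_ball(1)[of r 0]] that h in simp)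
    ultimately show ?thesis
      unfolding g_def by (simp add: ac_simps DERIV_diff)
  qed
  from MVT2[OF h(1), of g, OF this] obtain r where r: "0 < r" "r < h"
    "g h - g 0 = (h - 0) * (f' (p + r *\<^sub>R v + h *\<^sub>R w) v - f' (p + r *\<^sub>R v) v)" by blast
  have "((\<lambda>t. f' (p + r *\<^sub>R v + t *\<^sub>R w) v) has_real_derivative f'' (p + r *\<^sub>R v + t *\<^sub>R w) w) (at t)"
    if "0 \<le> t" "t \<le> h" for t
    by (rule has_real_derivative_along_line) (use ddf[OF in_ball(1)[of r t]] that r in simp)
  from MVT2[OF h(1), OF this] obtain t where t: "0 < t" "t < h"
    "f' (p + r *\<^sub>R v + h *\<^sub>R w) v - f' (p + r *\<^sub>R v) v = h * f'' (p + r *\<^sub>R v + t *\<^sub>R w) w"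
    by auto
  show ?thesis
    by (rule that[of "p + r *\<^sub>R v + t *\<^sub>R w"]) (use in_ball(2)[of r t] r t in \<open>auto simp: g_def\<close>)
qed

lemma second_difference_limit:
  fixes f :: "'a::real_normed_vector \<Rightarrow> real"
  assumes "open U" "p \<in> U"
    and df: "\<And>x. x \<in> U \<Longrightarrow> (f has_derivative f' x) (at x)"
    and ddf: "\<And>x. x \<in> U \<Longrightarrow> ((\<lambda>y. f' y v) has_derivative f'' x) (at x)"
    and cont: "continuous_on U (\<lambda>x. f'' x w)"
  shows "((\<lambda>h. (f (p + h *\<^sub>R v + h *\<^sub>R w) - f (p + h *\<^sub>R v) - f (p + h *\<^sub>R w) + f p) / (h * h))
    \<longlongrightarrow> f'' p w) (at_right 0)"
proof (rule tendstoI)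
  fix e :: real assume "0 < e"
  obtain d where d: "d > 0" "ball p d \<subseteq> U"
    using assms(1,2) open_contains_ball by blast
  have "isCont (\<lambda>x. f'' x w) p"
    using cont assms(1,2) by (simp add: continuous_on_eq_continuous_at)
  then obtain d' where d': "d' > 0" "\<And>x. dist x p < d' \<Longrightarrow> dist (f'' x w) (f'' p w) < e"
    using \<open>0 < e\<close> unfolding continuous_at_eps_delta by (metis dist_norm)
  \<comment> \<open>The summand 1 keeps the denominator positive when \<open>v\<close> and
    \<open>w\<close> both vanish.\<close>
  define b where "b = min d d' / (norm v + norm w + 1)"
  have pos: "norm v + norm w + 1 > 0" by (simp add: add_nonneg_pos)
  have "b > 0" using d d' pos by (simp add: b_def)
  show "\<forall>\<^sub>F h in at_right 0. dist ((f (p + h *\<^sub>R v + h *\<^sub>R w) - f (p + h *\<^sub>R v) - f (p + h *\<^sub>R w) + f p) / (h * h)) (f'' p w) < e"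
    unfolding eventually_at_right_field
  proof (intro exI[of _ b] conjI allI impI \<open>b > 0\<close>)
    fix h assume h: "0 < h" "h < b"
    have "h * (norm v + norm w) \<le> h * (norm v + norm w + 1)" using h by simp
    also have "\<dots> < min d d'" using h pos by (simp add: b_def pos_less_divide_eq)
    finally have hd: "h * (norm v + norm w) < d" "h * (norm v + norm w) < d'" by auto
    obtain x where x: "dist p x \<le> h * (norm v + norm w)"
      "f (p + h *\<^sub>R v + h *\<^sub>R w) - f (p + h *\<^sub>R v) - f (p + h *\<^sub>R w) + f p = h * h * f'' x w"
      by (rule second_difference_mean_value[OF _ _ h(1) hd(1), where f = f and f' = f' and f'' = f''])
         (use df ddf d in auto)
    show "dist ((f (p + h *\<^sub>R v + h *\<^sub>R w) - f (p + h *\<^sub>R v) - f (p + h *\<^sub>R w) + f p) / (h * h)) (f'' p w) < e"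
      unfolding x(2) using d'(2)[of x] x(1) hd(2) h by (simp add: dist_commute)
  qed
qed

text \<open>The second difference is symmetric in \<open>v\<close> and \<open>w\<close>, so both
  mixed derivatives are limits of one quotient. Coordinates are taken first because the mean value
  theorem is about real functions.\<close>

lemma symmetric_second_derivative:
  fixes f :: "'a::euclidean_space \<Rightarrow> 'b::euclidean_space"
  assumes "open U" "smooth_on U f" "p \<in> U"
  shows "frechet_derivative (\<lambda>x. frechet_derivative f (at x) v) (at p) w
    = frechet_derivative (\<lambda>x. frechet_derivative f (at x) w) (at p) v"
proof (rule euclidean_eqI)
  fix b :: 'b assume "b \<in> Basis"
  define f2 where "f2 v x = frechet_derivative (\<lambda>x. frechet_derivative f (at x) v) (at x)" for v x
  have d1: "((\<lambda>x. f x \<bullet> b) has_derivative (\<lambda>u. frechet_derivative f (at x) u \<bullet> b)) (at x)" if "x \<in> U" for x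
    by (rule has_derivative_inner_left[OF smooth_on_has_derivative[OF assms(1,2) that]])
  have d2: "((\<lambda>x. frechet_derivative f (at x) v \<bullet> b) has_derivative (\<lambda>u. f2 v x u \<bullet> b)) (at x)" if "x \<in> U" for x v
    unfolding f2_def
    by (rule has_derivative_inner_left[OF smooth_on_has_derivative[OF assms(1) smooth_on_directional_derivative[OF assms(2)] that]])
  have c: "continuous_on U (\<lambda>x. f2 v x w \<bullet> b)" for v w
  proof -
    have "smooth_on U (\<lambda>x. f2 v x w)"
      unfolding f2_def
      by (rule smooth_on_directional_derivative[OF smooth_on_directional_derivative[OF assms(2)]])
    then have "Ck_on 0 U (\<lambda>x. f2 v x w)" unfolding smooth_on_def by (rule spec)
    then show ?thesis by (simp add: continuous_on_inner)
  qed
  let ?q = "\<lambda>v w h. (f (p + h *\<^sub>R v + h *\<^sub>R w) \<bullet> b - f (p + h *\<^sub>R v) \<bullet> b - f (p + h *\<^sub>R w) \<bullet> b + f p \<bullet> b) / (h * h)"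
  have lim: "(?q v w \<longlongrightarrow> f2 v p w \<bullet> b) (at_right 0)" for v w
    by (rule second_difference_limit[OF assms(1,3) d1 d2 c])
  have "?q w v h = ?q v w h" for h
  proof -
    have eq: "p + h *\<^sub>R w + h *\<^sub>R v = p + h *\<^sub>R v + h *\<^sub>R w" by (simp add: ac_simps)
    show ?thesis by (subst eq) simp
  qed
  then have "(?q v w \<longlongrightarrow> f2 w p v \<bullet> b) (at_right 0)" using lim[of w v] by presburger
  then have "f2 v p w \<bullet> b = f2 w p v \<bullet> b"
    by (rule tendsto_unique[OF trivial_limit_at_right_real lim])
  then show "frechet_derivative (\<lambda>x. frechet_derivative f (at x) v) (at p) w \<bullet> b
    = frechet_derivative (\<lambda>x. frechet_derivative f (at x) w) (at p) v \<bullet> b"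
    by (simp add: f2_def)
qed

section \<open>Differentials on subsets of Euclidean space\<close>

text \<open>Composed with a curve in \<open>M\<close> of velocity \<open>v\<close>, any two
  derivatives within \<open>M\<close> become derivatives at a point of the line, where uniqueness
  holds. So whichever derivative is at hand evaluates \<open>diff\<close> on tangent
  vectors.\<close>

lemma diff_eqI:
  assumes "v \<in> tangent M p" "(f has_derivative f') (at p within M)"
  shows "diff M f p v = f' v"
proof -
  obtain \<gamma> where \<gamma>: "\<And>t. \<gamma> t \<in> M" "\<gamma> 0 = p" "(\<gamma> has_derivative (\<lambda>t. t *\<^sub>R v)) (at 0)"
    using assms(1) by (auto simp: tangent_def has_vector_derivative_def)
  have along: "((\<lambda>t. f (\<gamma> t)) has_derivative (\<lambda>t. d (t *\<^sub>R v))) (at 0)"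
    if "(f has_derivative d) (at p within M)" for d
    by (rule has_derivative_in_compose[OF \<gamma>(3)])
       (use that \<gamma>(1,2) in \<open>auto intro: has_derivative_subset\<close>)
  have "(f has_derivative diff M f p) (at p within M)"
    using assms(2) unfolding diff_def by (metis differentiableI frechet_derivative_works)
  from fun_cong[OF has_derivative_unique[OF along[OF this] along[OF assms(2)]], of 1]
  show ?thesis by simp
qed

lemma smooth_mapE:
  assumes "smooth_map M f" "p \<in> M"
  obtains U F where "open U" "p \<in> U" "smooth_on U F" "\<forall>x\<in>M \<inter> U. F x = f x"
proof -
  from assms obtain U F where "open U" "p \<in> U" "\<forall>m. Ck_on m U F" "\<forall>x\<in>M \<inter> U. F x = f x"
    unfolding smooth_map_def by metis
  then show ?thesis by (intro that[of U F]) (auto simp: smooth_on_def)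
qed

lemma smooth_mapI:
  assumes "\<And>p. p \<in> M \<Longrightarrow> \<exists>U F. open U \<and> p \<in> U \<and> smooth_on U F \<and> (\<forall>x\<in>M \<inter> U. F x = f x)"
  shows "smooth_map M f"
  using assms unfolding smooth_map_def smooth_on_def by blast

lemma extension_has_derivative:
  assumes "open U" "p \<in> U" "p \<in> M" "smooth_on U F" "\<forall>x\<in>M \<inter> U. F x = f x"
  shows "(f has_derivative frechet_derivative F (at p)) (at p within M)"
proof -
  obtain e where e: "e > 0" "ball p e \<subseteq> U" using assms(1,2) open_contains_ball by blast
  show ?thesis
    by (rule has_derivative_transform_within[OF has_derivative_at_withinI[OF
            smooth_on_has_derivative[OF assms(1,4,2)]] e(1) assms(3)])
       (use e assms(5) in \<open>auto simp: dist_commute subset_iff\<close>)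
qed

lemma smooth_map_has_derivative:
  assumes "smooth_map M f" "p \<in> M"
  shows "(f has_derivative diff M f p) (at p within M)"
proof -
  obtain U F where F: "open U" "p \<in> U" "smooth_on U F" "\<forall>x\<in>M \<inter> U. F x = f x"
    using smooth_mapE[OF assms] by blast
  have "f differentiable (at p within M)"
    by (rule differentiableI[OF extension_has_derivative[OF F(1,2) assms(2) F(3,4)]])
  then show ?thesis unfolding diff_def by (simp add: frechet_derivative_works[symmetric])
qed

lemma smooth_map_id: "smooth_map M (\<lambda>x. x)"
  by (rule smooth_mapI) (metis open_UNIV UNIV_I smooth_on_def Ck_on_id)

lemma smooth_map_linear:
  assumes "bounded_linear h" "smooth_map M f"
  shows "smooth_map M (\<lambda>x. h (f x))"
proof (rule smooth_mapI)
  fix p assume "p \<in> M"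
  then obtain U F where "open U" "p \<in> U" "smooth_on U F" "\<forall>x\<in>M \<inter> U. F x = f x"
    using smooth_mapE[OF assms(2)] by blast
  then show "\<exists>U F. open U \<and> p \<in> U \<and> smooth_on U F \<and> (\<forall>x\<in>M \<inter> U. F x = h (f x))"
    by (intro exI[of _ U] exI[of _ "\<lambda>x. h (F x)"]) (simp add: smooth_on_linear[OF assms(1)])
qed

lemma smooth_map_common_extension:
  assumes "smooth_map M f" "smooth_map M g" "p \<in> M"
  obtains U F G where "open U" "p \<in> U" "smooth_on U F" "\<forall>x\<in>M \<inter> U. F x = f x"
    "smooth_on U G" "\<forall>x\<in>M \<inter> U. G x = g x"
proof -
  obtain U F where U: "open U" "p \<in> U" "smooth_on U F" "\<forall>x\<in>M \<inter> U. F x = f x"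
    using smooth_mapE[OF assms(1,3)] by blast
  obtain V G where V: "open V" "p \<in> V" "smooth_on V G" "\<forall>x\<in>M \<inter> V. G x = g x"
    using smooth_mapE[OF assms(2,3)] by blast
  have "open (U \<inter> V)" using U V by blast
  show ?thesis
    by (rule that[of "U \<inter> V" F G])
       (use U V \<open>open (U \<inter> V)\<close> smooth_on_open_subset[of U "U \<inter> V" F] smooth_on_open_subset[of V "U \<inter> V" G] in auto)
qed

lemma smooth_map_bilinear:
  assumes "bounded_bilinear h" "smooth_map M f" "smooth_map M g"
  shows "smooth_map M (\<lambda>x. h (f x) (g x))"
proof (rule smooth_mapI)
  fix p assume "p \<in> M"
  then obtain U F G where "open U" "p \<in> U" "smooth_on U F" "\<forall>x\<in>M \<inter> U. F x = f x"
    "smooth_on U G" "\<forall>x\<in>M \<inter> U. G x = g x"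
    using smooth_map_common_extension[OF assms(2,3)] by blast
  then show "\<exists>U F. open U \<and> p \<in> U \<and> smooth_on U F \<and> (\<forall>x\<in>M \<inter> U. F x = h (f x) (g x))"
    by (intro exI[of _ U] exI[of _ "\<lambda>x. h (F x) (G x)"]) (simp add: smooth_on_bilinear[OF assms(1)])
qed

lemma smooth_map_add:
  assumes "smooth_map M f" "smooth_map M g"
  shows "smooth_map M (\<lambda>x. f x + g x)"
proof (rule smooth_mapI)
  fix p assume "p \<in> M"
  then obtain U F G where "open U" "p \<in> U" "smooth_on U F" "\<forall>x\<in>M \<inter> U. F x = f x"
    "smooth_on U G" "\<forall>x\<in>M \<inter> U. G x = g x"
    using smooth_map_common_extension[OF assms] by blast
  then show "\<exists>U F. open U \<and> p \<in> U \<and> smooth_on U F \<and> (\<forall>x\<in>M \<inter> U. F x = f x + g x)"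
    by (intro exI[of _ U] exI[of _ "\<lambda>x. F x + G x"]) (simp add: smooth_on_add)
qed

lemma smooth_map_diff:
  "smooth_map M f \<Longrightarrow> smooth_map M g \<Longrightarrow> smooth_map M (\<lambda>x. f x - g x)"
  using smooth_map_add[OF _ smooth_map_linear[OF bounded_linear_minus[OF bounded_linear_ident]], of M f g] by simp

text \<open>Locally this is the derivative of an ambient extension of \<open>Y\<close> along an
  ambient extension of \<open>X\<close>; tangency of \<open>X\<close> makes the value independent of
  the extension.\<close>

lemma smooth_map_derivative_along:
  assumes "smooth_map M Y" "vector_field M X"
  shows "smooth_map M (\<lambda>p. diff M Y p (X p))"
proof (rule smooth_mapI)
  fix p assume "p \<in> M"
  moreover have "smooth_map M X" using assms(2) by (simp add: vector_field_def)
  ultimately obtain U F G where F: "open U" "p \<in> U" "smooth_on U F" "\<forall>x\<in>M \<inter> U. F x = Y x"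
    "smooth_on U G" "\<forall>x\<in>M \<inter> U. G x = X x"
    using smooth_map_common_extension[OF assms(1)] by blast
  have "diff M Y q (X q) = frechet_derivative F (at q) (G q)" if "q \<in> M \<inter> U" for q
    using diff_eqI[OF _ extension_has_derivative[OF F(1) _ _ F(3,4)], of "X q" q] that assms(2) F(6)
    by (auto simp: vector_field_def)
  then show "\<exists>U F. open U \<and> p \<in> U \<and> smooth_on U F \<and> (\<forall>q\<in>M \<inter> U. F q = diff M Y q (X q))"
    using F smooth_on_derivative_along[OF F(1,3,5)]
    by (intro exI[of _ U] exI[of _ "\<lambda>q. frechet_derivative F (at q) (G q)"]) simp
qed

lemma derivative_along_has_derivative:
  fixes F :: "'a::euclidean_space \<Rightarrow> 'b::euclidean_space"
  assumes "open U" "smooth_on U F" "smooth_on U G" "p \<in> U"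
  defines "S \<equiv> \<lambda>b. frechet_derivative (\<lambda>q. frechet_derivative F (at q) b) (at p)"
  shows "((\<lambda>q. frechet_derivative F (at q) (G q)) has_derivative
    (\<lambda>v. (\<Sum>b\<in>Basis. (G p \<bullet> b) *\<^sub>R S b v) + frechet_derivative F (at p) (frechet_derivative G (at p) v))) (at p)"
proof (rule has_derivative_transform_within_open[OF _ assms(1,4)])
  have expand: "frechet_derivative F (at q) u = (\<Sum>b\<in>Basis. (u \<bullet> b) *\<^sub>R frechet_derivative F (at q) b)"
    if "q \<in> U" for q u
  proof -
    have "linear (frechet_derivative F (at q))"
      using smooth_on_has_derivative[OF assms(1,2) that] has_derivative_linear by blast
    then have "frechet_derivative F (at q) (\<Sum>b\<in>Basis. (u \<bullet> b) *\<^sub>R b)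
        = (\<Sum>b\<in>Basis. (u \<bullet> b) *\<^sub>R frechet_derivative F (at q) b)"
      by (simp add: linear_sum linear_cmul)
    then show ?thesis by (simp add: euclidean_representation)
  qed
  show "(\<Sum>b\<in>Basis. (G q \<bullet> b) *\<^sub>R frechet_derivative F (at q) b) = frechet_derivative F (at q) (G q)"
    if "q \<in> U" for q by (rule expand[OF that, symmetric])
  have "((\<lambda>q. \<Sum>b\<in>Basis. (G q \<bullet> b) *\<^sub>R frechet_derivative F (at q) b) has_derivative
    (\<lambda>v. \<Sum>b\<in>Basis. (G p \<bullet> b) *\<^sub>R S b v + (frechet_derivative G (at p) v \<bullet> b) *\<^sub>R frechet_derivative F (at p) b)) (at p)"
    unfolding S_def
    by (intro has_derivative_sum has_derivative_scaleR has_derivative_inner_left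
        smooth_on_has_derivative[OF assms(1) _ assms(4)] assms(2,3) smooth_on_directional_derivative[OF assms(2)])
  then show "((\<lambda>q. \<Sum>b\<in>Basis. (G q \<bullet> b) *\<^sub>R frechet_derivative F (at q) b) has_derivative
    (\<lambda>v. (\<Sum>b\<in>Basis. (G p \<bullet> b) *\<^sub>R S b v) + frechet_derivative F (at p) (frechet_derivative G (at p) v))) (at p)"
    by (simp add: sum.distrib expand[OF assms(4), symmetric])
qed

text \<open>Each iterated derivative is the Hessian of an extension in the two directions plus a
  first-order term; the Hessians cancel by symmetry. The bracket must be tangent for the remaining
  first-order term to be a value of \<open>diff\<close>; this is supplied later by the torsion-free
  connection.\<close>

lemma diff_commutator:
  fixes Z :: "'a::euclidean_space \<Rightarrow> 'b::euclidean_space"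
  assumes "smooth_map M Z" "vector_field M X" "vector_field M Y" "p \<in> M"
    and br: "field_bracket M X Y p \<in> tangent M p"
  shows "diff M (\<lambda>q. diff M Z q (Y q)) p (X p) - diff M (\<lambda>q. diff M Z q (X q)) p (Y p)
    = diff M Z p (field_bracket M X Y p)"
proof -
  have sm: "smooth_map M X" "smooth_map M Y" using assms by (auto simp: vector_field_def)
  have tan: "X q \<in> tangent M q" "Y q \<in> tangent M q" if "q \<in> M" for q
    using assms that by (auto simp: vector_field_def)
  obtain U F where F: "open U" "p \<in> U" "smooth_on U F" "\<forall>x\<in>M \<inter> U. F x = Z x"
    using smooth_mapE[OF assms(1,4)] by blast
  define S where "S b v = frechet_derivative (\<lambda>q. frechet_derivative F (at q) b) (at p) v" for b v
  let ?DF = "frechet_derivative F (at p)"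
  have dZ: "diff M Z q v = frechet_derivative F (at q) v" if "q \<in> M" "q \<in> U" "v \<in> tangent M q" for q v
    by (rule diff_eqI[OF that(3) extension_has_derivative[OF F(1) that(2,1) F(3,4)]])
  have key: "diff M (\<lambda>q. diff M Z q (Y q)) p (X p)
      = (\<Sum>b\<in>Basis. \<Sum>b'\<in>Basis. ((Y p \<bullet> b) * (X p \<bullet> b')) *\<^sub>R S b b') + ?DF (diff M Y p (X p))"
    if vf: "vector_field M X" "vector_field M Y" for X Y
  proof -
    have tan: "X q \<in> tangent M q" "Y q \<in> tangent M q" if "q \<in> M" for q
      using vf that by (auto simp: vector_field_def)
    obtain V G where G: "open V" "p \<in> V" "smooth_on V G" "\<forall>x\<in>M \<inter> V. G x = Y x"
      using smooth_mapE[of M Y p] assms(4) vf(2) unfolding vector_field_def by blast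
    let ?W = "U \<inter> V"
    have W: "open ?W" "p \<in> ?W" "smooth_on ?W F" "smooth_on ?W G"
      using F G smooth_on_open_subset[of U ?W F] smooth_on_open_subset[of V ?W G] by auto
    have ext: "\<forall>q\<in>M \<inter> ?W. frechet_derivative F (at q) (G q) = diff M Z q (Y q)"
      using dZ tan G(4) by simp
    have dG: "diff M Y p (X p) = frechet_derivative G (at p) (X p)"
      by (rule diff_eqI[OF tan(1)[OF assms(4)] extension_has_derivative[OF G(1,2) assms(4) G(3,4)]])
    have "frechet_derivative (\<lambda>q. frechet_derivative F (at q) (G q)) (at p)
        = (\<lambda>v. (\<Sum>b\<in>Basis. (G p \<bullet> b) *\<^sub>R S b v) + ?DF (frechet_derivative G (at p) v))"
      using derivative_along_has_derivative[OF W(1,3,4,2)] unfolding S_def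
      by (rule frechet_derivative_at[symmetric])
    then have "diff M (\<lambda>q. diff M Z q (Y q)) p (X p)
        = (\<Sum>b\<in>Basis. (Y p \<bullet> b) *\<^sub>R S b (X p)) + ?DF (diff M Y p (X p))"
      using diff_eqI[OF tan(1)[OF assms(4)] extension_has_derivative[OF W(1,2) assms(4)
            smooth_on_derivative_along[OF W(1,3,4)] ext]] G(2,4) assms(4)
      by (simp add: dG)
    moreover have "S b (X p) = (\<Sum>b'\<in>Basis. (X p \<bullet> b') *\<^sub>R S b b')" for b
    proof -
      have "linear (S b)"
        unfolding S_def
        using smooth_on_has_derivative[OF F(1) smooth_on_directional_derivative[OF F(3)] F(2)]
          has_derivative_linear by blast
      then have "S b (\<Sum>b'\<in>Basis. (X p \<bullet> b') *\<^sub>R b') = (\<Sum>b'\<in>Basis. (X p \<bullet> b') *\<^sub>R S b b')"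
        by (simp add: linear_sum linear_cmul)
      then show ?thesis by (simp add: euclidean_representation)
    qed
    ultimately show ?thesis by (simp add: scaleR_sum_right)
  qed
  have S: "S b b' = S b' b" for b b'
    unfolding S_def by (rule symmetric_second_derivative[OF F(1,3,2)])
  have "(\<Sum>b\<in>Basis. \<Sum>b'\<in>Basis. ((Y p \<bullet> b) * (X p \<bullet> b')) *\<^sub>R S b b')
      = (\<Sum>b\<in>Basis. \<Sum>b'\<in>Basis. ((X p \<bullet> b) * (Y p \<bullet> b')) *\<^sub>R S b b')"
    by (subst sum.swap) (simp add: S mult.commute)
  then have "diff M (\<lambda>q. diff M Z q (Y q)) p (X p) - diff M (\<lambda>q. diff M Z q (X q)) p (Y p)
      = ?DF (diff M Y p (X p)) - ?DF (diff M X p (Y p))"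
    using key[OF assms(2,3)] key[OF assms(3,2)] by simp
  also have "\<dots> = ?DF (field_bracket M X Y p)"
    using has_derivative_linear[OF smooth_on_has_derivative[OF F(1,3,2)]]
    by (simp add: field_bracket_def linear_diff)
  also have "\<dots> = diff M Z p (field_bracket M X Y p)"
    using dZ[OF assms(4) F(2) br] by simp
  finally show ?thesis .
qed

section \<open>Homogeneous metrics\<close>

text \<open>The trace in an unknown basis is rewritten by expanding \<open>L b\<close> in the frame
  and then each \<open>e i\<close> in the basis. A Parseval frame is enough, so no basis adapted to
  the base point has to be built. \<open>f\<close> has to agree with the linear \<open>L\<close> on
  \<open>S\<close> only.\<close>

lemma trace_on_frame:
  fixes e :: "'i \<Rightarrow> 'a::euclidean_space"
  assumes "finite I" "subspace S" "linear L"
    and "\<And>x. x \<in> S \<Longrightarrow> f x = L x \<and> L x \<in> S"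
    and "\<And>i. i \<in> I \<Longrightarrow> e i \<in> S"
    and frame: "\<And>x. x \<in> S \<Longrightarrow> (\<Sum>i\<in>I. (x \<bullet> e i) *\<^sub>R e i) = x"
  shows "trace_on S f = (\<Sum>i\<in>I. f (e i) \<bullet> e i)"
proof -
  define B where "B = (SOME B. independent B \<and> span B = S)"
  have "\<exists>B. independent B \<and> span B = S"
    using maximal_independent_subset[of S] assms(2) by (metis span_subspace)
  then have B: "independent B" "span B = S" unfolding B_def by (rule someI2_ex, simp)+
  have fin: "finite B" using B(1) by (rule finiteI_independent)
  have LS: "L b \<in> S" "f b = L b" if "b \<in> B" for b
    using that B(2) span_base assms(4) by blast+
  have "trace_on S f = (\<Sum>b\<in>B. representation B (L b) b)"
    by (simp add: trace_on_def Let_def B_def[symmetric] LS)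
  also have "\<dots> = (\<Sum>b\<in>B. \<Sum>i\<in>I. (L b \<bullet> e i) * representation B (e i) b)"
  proof (rule sum.cong[OF refl])
    fix b assume b: "b \<in> B"
    have "representation B (\<Sum>i\<in>I. (L b \<bullet> e i) *\<^sub>R e i) b = (\<Sum>i\<in>I. (L b \<bullet> e i) * representation B (e i) b)"
      using B(1) assms(5)
      by (subst representation_sum) (auto simp: B(2) representation_scale subspace_scale[OF assms(2)])
    then show "representation B (L b) b = (\<Sum>i\<in>I. (L b \<bullet> e i) * representation B (e i) b)"
      by (simp add: frame[OF LS(1)[OF b]])
  qed
  also have "\<dots> = (\<Sum>i\<in>I. L (\<Sum>b\<in>B. representation B (e i) b *\<^sub>R b) \<bullet> e i)"
    by (subst sum.swap) (simp add: linear_sum[OF assms(3)] linear_cmul[OF assms(3)] inner_sum_left mult.commute)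
  also have "\<dots> = (\<Sum>i\<in>I. f (e i) \<bullet> e i)"
  proof (rule sum.cong[OF refl])
    fix i assume i: "i \<in> I"
    have "(\<Sum>b\<in>B. representation B (e i) b *\<^sub>R b) = e i"
      using B assms(5)[OF i] fin by (intro sum_representation_eq) auto
    then show "L (\<Sum>b\<in>B. representation B (e i) b *\<^sub>R b) \<bullet> e i = f (e i) \<bullet> e i"
      using assms(4,5) i by simp
  qed
  finally show ?thesis .
qed

section \<open>Equivariant metrics and their curvature\<close>

text \<open>A relation instead of a value: product rules compose without separate differentiability
  proofs, and only one direction is kept, the one in which equivariance simplifies the
  result.\<close>

definition has_directional_derivative ::
  "'a::euclidean_space set \<Rightarrow> 'a \<Rightarrow> 'a \<Rightarrow> ('a \<Rightarrow> 'b::real_normed_vector) \<Rightarrow> 'b \<Rightarrow> bool" where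
  "has_directional_derivative M p v f l \<longleftrightarrow> (\<exists>f'. (f has_derivative f') (at p within M) \<and> f' v = l)"

lemma has_directional_derivative_diff:
  "v \<in> tangent M p \<Longrightarrow> has_directional_derivative M p v f l \<Longrightarrow> diff M f p v = l"
  unfolding has_directional_derivative_def using diff_eqI by metis

lemma smooth_map_has_directional_derivative:
  "smooth_map M f \<Longrightarrow> p \<in> M \<Longrightarrow> has_directional_derivative M p v f (diff M f p v)"
  unfolding has_directional_derivative_def using smooth_map_has_derivative by blast

lemma has_directional_derivative_ident: "has_directional_derivative M p v (\<lambda>q. q) v"
  unfolding has_directional_derivative_def by (intro exI[of _ "\<lambda>v. v"]) simp

lemma has_directional_derivative_linear:
  assumes "bounded_linear h" "has_directional_derivative M p v f l"
  shows "has_directional_derivative M p v (\<lambda>q. h (f q)) (h l)"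
proof -
  obtain f' where f: "(f has_derivative f') (at p within M)" "f' v = l"
    using assms(2) by (auto simp: has_directional_derivative_def)
  show ?thesis
    unfolding has_directional_derivative_def
    using bounded_linear.has_derivative[OF assms(1) f(1)] f(2) by (intro exI[of _ "\<lambda>v. h (f' v)"]) simp
qed

lemma has_directional_derivative_bilinear:
  assumes "bounded_bilinear h" "has_directional_derivative M p v f l" "has_directional_derivative M p v g m"
  shows "has_directional_derivative M p v (\<lambda>q. h (f q) (g q)) (h (f p) m + h l (g p))"
proof -
  obtain f' g' where f: "(f has_derivative f') (at p within M)" "f' v = l"
    and g: "(g has_derivative g') (at p within M)" "g' v = m"
    using assms(2,3) by (auto simp: has_directional_derivative_def)
  show ?thesis
    unfolding has_directional_derivative_def
    using bounded_bilinear.FDERIV[OF assms(1) f(1) g(1)] f(2) g(2)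
    by (intro exI[of _ "\<lambda>v. h (f p) (g' v) + h (f' v) (g p)"]) simp
qed

lemma has_directional_derivative_add:
  assumes "has_directional_derivative M p v f l" "has_directional_derivative M p v g m"
  shows "has_directional_derivative M p v (\<lambda>q. f q + g q) (l + m)"
proof -
  obtain f' g' where f: "(f has_derivative f') (at p within M)" "f' v = l"
    and g: "(g has_derivative g') (at p within M)" "g' v = m"
    using assms by (auto simp: has_directional_derivative_def)
  show ?thesis
    unfolding has_directional_derivative_def
    using has_derivative_add[OF f(1) g(1)] f(2) g(2) by (intro exI[of _ "\<lambda>v. f' v + g' v"]) simp
qed

lemma has_directional_derivative_sub:
  assumes "has_directional_derivative M p v f l" "has_directional_derivative M p v g m"
  shows "has_directional_derivative M p v (\<lambda>q. f q - g q) (l - m)"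
  using has_directional_derivative_add[OF assms(1) has_directional_derivative_linear[OF
        bounded_linear_minus[OF bounded_linear_ident] assms(2)]] by simp

text \<open>\<open>\<LL>\<close> consists of linear fields that generate the group action. Along
  \<open>A\<close>, the term \<open>y - A (Y p)\<close> is the Lie derivative of \<open>Y\<close>,
  so \<open>derivative_\<Gamma>\<close> and \<open>derivative_g\<close> say that
  \<open>\<Gamma>\<close> and \<open>g\<close> have vanishing Lie derivative. Skewness of
  \<open>A v + \<Gamma> p (A p) v\<close> is metric compatibility with all derivatives of vector
  fields stripped off.\<close>

locale homogeneous_metric =
  fixes M :: "'a::euclidean_space set" and \<LL> :: "('a \<Rightarrow> 'a) set"
    and \<Gamma> :: "'a \<Rightarrow> 'a \<Rightarrow> 'a \<Rightarrow> 'a" and g :: "'a tensor2"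
  assumes generator_linear: "\<And>A. A \<in> \<LL> \<Longrightarrow> bounded_linear A"
    and tangent_eq: "\<And>p. p \<in> M \<Longrightarrow> tangent M p = (\<lambda>A. A p) ` \<LL>"
    and subspace_tangent: "\<And>p. p \<in> M \<Longrightarrow> subspace (tangent M p)"
    and bilinear_\<Gamma>: "\<And>p. bilinear (\<Gamma> p)"
    and \<Gamma>_commute: "\<And>p u v. \<Gamma> p u v = \<Gamma> p v u"
    and smooth_\<Gamma>: "\<And>X Y. smooth_map M X \<Longrightarrow> smooth_map M Y \<Longrightarrow> smooth_map M (\<lambda>p. \<Gamma> p (X p) (Y p))"
    and derivative_\<Gamma>: "\<And>A p Y Z y z. A \<in> \<LL> \<Longrightarrow> p \<in> M \<Longrightarrow>
      has_directional_derivative M p (A p) Y y \<Longrightarrow> has_directional_derivative M p (A p) Z z \<Longrightarrow>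
      has_directional_derivative M p (A p) (\<lambda>q. \<Gamma> q (Y q) (Z q))
        (A (\<Gamma> p (Y p) (Z p)) + \<Gamma> p (y - A (Y p)) (Z p) + \<Gamma> p (Y p) (z - A (Z p)))"
    and tangent_\<Gamma>: "\<And>A p v. A \<in> \<LL> \<Longrightarrow> p \<in> M \<Longrightarrow> v \<in> tangent M p \<Longrightarrow> A v + \<Gamma> p (A p) v \<in> tangent M p"
    and tangent_lie_derivative: "\<And>A p Y. A \<in> \<LL> \<Longrightarrow> p \<in> M \<Longrightarrow> vector_field M Y \<Longrightarrow>
      diff M Y p (A p) - A (Y p) \<in> tangent M p"
    and bilinear_g: "\<And>p. bilinear (g p)"
    and derivative_g: "\<And>A p Y Z y z. A \<in> \<LL> \<Longrightarrow> p \<in> M \<Longrightarrow>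
      has_directional_derivative M p (A p) Y y \<Longrightarrow> has_directional_derivative M p (A p) Z z \<Longrightarrow>
      has_directional_derivative M p (A p) (\<lambda>q. g q (Y q) (Z q))
        (g p (y - A (Y p)) (Z p) + g p (Y p) (z - A (Z p)))"
    and g_\<Gamma>_skew: "\<And>A p v w. A \<in> \<LL> \<Longrightarrow> p \<in> M \<Longrightarrow> v \<in> tangent M p \<Longrightarrow> w \<in> tangent M p \<Longrightarrow>
      g p (A v + \<Gamma> p (A p) v) w + g p v (A w + \<Gamma> p (A p) w) = 0"
begin

definition covariant_derivative :: "'a connection" where
  "covariant_derivative X Y p = diff M Y p (X p) + \<Gamma> p (X p) (Y p)"

text \<open>
  The difference of the covariant derivative and the Lie derivative along the generator \<open>A\<close>, which
  is tensorial.
\<close>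

definition \<Lambda> :: "'a \<Rightarrow> ('a \<Rightarrow> 'a) \<Rightarrow> 'a \<Rightarrow> 'a" where
  "\<Lambda> p A v = A v + \<Gamma> p (A p) v"

lemmas \<Gamma>_simps = bilinear_ladd[OF bilinear_\<Gamma>] bilinear_radd[OF bilinear_\<Gamma>]
  bilinear_lsub[OF bilinear_\<Gamma>] bilinear_rsub[OF bilinear_\<Gamma>]
  bilinear_lmul[OF bilinear_\<Gamma>] bilinear_rmul[OF bilinear_\<Gamma>]

lemmas g_simps = bilinear_ladd[OF bilinear_g] bilinear_radd[OF bilinear_g]
  bilinear_lsub[OF bilinear_g] bilinear_rsub[OF bilinear_g]

lemma vector_field_generator: "A \<in> \<LL> \<Longrightarrow> vector_field M A"
  using smooth_map_linear[OF generator_linear smooth_map_id] tangent_eq by (auto simp: vector_field_def)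

lemma generator_through:
  assumes "vector_field M X" "p \<in> M"
  obtains A where "A \<in> \<LL>" "X p = A p"
  using assms tangent_eq unfolding vector_field_def by blast

lemma vector_field_has_derivative:
  "vector_field M X \<Longrightarrow> p \<in> M \<Longrightarrow> (X has_derivative diff M X p) (at p within M)"
  by (simp add: vector_field_def smooth_map_has_derivative)

lemma vector_field_tangent: "vector_field M X \<Longrightarrow> p \<in> M \<Longrightarrow> X p \<in> tangent M p"
  by (simp add: vector_field_def)

lemma covariant_derivative_split:
  assumes "A \<in> \<LL>" "X p = A p"
  shows "covariant_derivative X Y p = (diff M Y p (A p) - A (Y p)) + \<Lambda> p A (Y p)"
  by (simp add: covariant_derivative_def \<Lambda>_def assms)

lemma vector_field_covariant_derivative:
  assumes "vector_field M X" "vector_field M Y"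
  shows "vector_field M (covariant_derivative X Y)"
  unfolding vector_field_def
proof (intro conjI ballI)
  have "smooth_map M X" "smooth_map M Y" using assms by (auto simp: vector_field_def)
  then show "smooth_map M (covariant_derivative X Y)"
    unfolding covariant_derivative_def
    by (intro smooth_map_add smooth_map_derivative_along smooth_\<Gamma> assms)
next
  fix p assume p: "p \<in> M"
  obtain A where A: "A \<in> \<LL>" "X p = A p" using generator_through[OF assms(1) p] .
  show "covariant_derivative X Y p \<in> tangent M p"
    unfolding covariant_derivative_split[of A X p, OF A] \<Lambda>_def
    by (intro subspace_add[OF subspace_tangent] tangent_lie_derivative tangent_\<Gamma> A p assms(2)
        vector_field_tangent)
qed

lemma field_bracket_eq:
  "p \<in> M \<Longrightarrow> field_bracket M X Y p = covariant_derivative X Y p - covariant_derivative Y X p"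
  by (simp add: field_bracket_def covariant_derivative_def \<Gamma>_commute[of p "X p"])

text \<open>Torsion-freeness exhibits the bracket as a difference of covariant derivatives, which
  are tangent by equivariance.\<close>

lemma field_bracket_tangent:
  "vector_field M X \<Longrightarrow> vector_field M Y \<Longrightarrow> p \<in> M \<Longrightarrow> field_bracket M X Y p \<in> tangent M p"
  unfolding field_bracket_eq
  by (intro subspace_diff[OF subspace_tangent] vector_field_tangent vector_field_covariant_derivative)

lemma levi_civita_covariant_derivative: "levi_civita M g covariant_derivative"
  unfolding levi_civita_def affine_connection_def
proof (intro conjI allI impI ballI; (elim conjE)?)
  fix X Y assume "vector_field M X" "vector_field M Y"
  then show "vector_field M (covariant_derivative X Y)" by (rule vector_field_covariant_derivative)
next
  fix X X' Y p assume "vector_field M X" "vector_field M X'" "vector_field M Y" "p \<in> M"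
  then show "covariant_derivative (\<lambda>q. X q + X' q) Y p = covariant_derivative X Y p + covariant_derivative X' Y p"
    using has_derivative_linear[OF vector_field_has_derivative, of Y p]
    by (simp add: covariant_derivative_def linear_add \<Gamma>_simps)
next
  fix X Y Y' p assume *: "vector_field M X" "vector_field M Y" "vector_field M Y'" "p \<in> M"
  show "covariant_derivative X (\<lambda>q. Y q + Y' q) p = covariant_derivative X Y p + covariant_derivative X Y' p"
    using diff_eqI[OF vector_field_tangent[OF *(1,4)] has_derivative_add[OF
          vector_field_has_derivative[OF *(2,4)] vector_field_has_derivative[OF *(3,4)]]]
    by (simp add: covariant_derivative_def \<Gamma>_simps)
next
  fix f :: "'a \<Rightarrow> real" and X Y p assume *: "smooth_map M f" "vector_field M X" "vector_field M Y" "p \<in> M"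
  show "covariant_derivative (\<lambda>q. f q *\<^sub>R X q) Y p = f p *\<^sub>R covariant_derivative X Y p"
    using has_derivative_linear[OF vector_field_has_derivative[OF *(3,4)]]
    by (simp add: covariant_derivative_def linear_cmul \<Gamma>_simps scaleR_add_right)
  show "covariant_derivative X (\<lambda>q. f q *\<^sub>R Y q) p = f p *\<^sub>R covariant_derivative X Y p + diff M f p (X p) *\<^sub>R Y p"
    using diff_eqI[OF vector_field_tangent[OF *(2,4)] has_derivative_scaleR[OF
          smooth_map_has_derivative[OF *(1,4)] vector_field_has_derivative[OF *(3,4)]]]
    by (simp add: covariant_derivative_def \<Gamma>_simps scaleR_add_right)
next
  fix X Y p assume "p \<in> M"
  then show "covariant_derivative X Y p - covariant_derivative Y X p = field_bracket M X Y p"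
    by (simp add: field_bracket_eq)
next
  fix X Y Z p assume *: "vector_field M X" "vector_field M Y" "vector_field M Z" "p \<in> M"
  \<comment> \<open>The Lie derivative parts of the two covariant derivatives make up the derivative
    of the invariant \<open>g\<close>; the \<open>\<Lambda>\<close> parts cancel by
    skewness.\<close>
  obtain A where A: "A \<in> \<LL>" "X p = A p" using generator_through[OF *(1,4)] .
  have "smooth_map M Y" "smooth_map M Z" using * by (auto simp: vector_field_def)
  from this[THEN smooth_map_has_directional_derivative, OF *(4)]
  have d: "diff M (\<lambda>q. g q (Y q) (Z q)) p (A p)
      = g p (diff M Y p (A p) - A (Y p)) (Z p) + g p (Y p) (diff M Z p (A p) - A (Z p))"
    using vector_field_tangent[OF *(1,4)] A(2)
    by (intro has_directional_derivative_diff derivative_g A(1) *(4)) simp_all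
  moreover have "g p (\<Lambda> p A (Y p)) (Z p) + g p (Y p) (\<Lambda> p A (Z p)) = 0"
    unfolding \<Lambda>_def by (rule g_\<Gamma>_skew) (use A * vector_field_tangent in auto)
  ultimately show "diff M (\<lambda>q. g q (Y q) (Z q)) p (X p)
      = g p (covariant_derivative X Y p) (Z p) + g p (Y p) (covariant_derivative X Z p)"
    unfolding covariant_derivative_split[of A X p, OF A] A(2) d g_simps(1,2) by simp
qed

text \<open>For \<open>X\<close> = \<open>A\<close> and \<open>Y\<close> = \<open>B\<close> each
  covariant derivative is a Lie derivative plus \<open>\<Lambda>\<close>. By equivariance the
  commutator of a Lie derivative with \<open>\<Lambda>\<close> is \<open>\<Lambda>\<close> of the
  field bracket; this occurs twice, and subtracting the derivative along the bracket leaves it once.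
  The bracket of linear fields is minus the commutator of the maps, whence the last sign. Arbitrary
  \<open>X\<close> and \<open>Y\<close> are allowed since all other derivatives cancel.\<close>

lemma curvature_eq:
  assumes "vector_field M X" "vector_field M Y" "vector_field M Z" "p \<in> M"
    and "A \<in> \<LL>" "X p = A p" "B \<in> \<LL>" "Y p = B p"
  shows "curvature M covariant_derivative X Y Z p =
    \<Lambda> p A (\<Lambda> p B (Z p)) - \<Lambda> p B (\<Lambda> p A (Z p)) - \<Lambda> p (\<lambda>v. A (B v) - B (A v)) (Z p)"
proof -
  have second: "covariant_derivative X (covariant_derivative Y Z) p
      = diff M (\<lambda>q. diff M Z q (Y q)) p (A p)
        + (A (\<Gamma> p (Y p) (Z p)) + \<Gamma> p (diff M Y p (A p) - A (Y p)) (Z p) + \<Gamma> p (Y p) (diff M Z p (A p) - A (Z p)))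
        + \<Gamma> p (A p) (diff M Z p (Y p) + \<Gamma> p (Y p) (Z p))"
    if vf: "vector_field M X" "vector_field M Y" "A \<in> \<LL>" "X p = A p" for X Y A
  proof -
    have sm: "smooth_map M Y" "smooth_map M Z" "smooth_map M (\<lambda>q. diff M Z q (Y q))"
      using assms(3) vf(2) by (auto intro: smooth_map_derivative_along simp: vector_field_def)
    note d = sm[THEN smooth_map_has_directional_derivative, OF assms(4), of "A p"]
    have "A p \<in> tangent M p" using vector_field_tangent[OF vf(1) assms(4)] vf(4) by simp
    from has_directional_derivative_diff[OF this has_directional_derivative_add[OF d(3)
          derivative_\<Gamma>[OF vf(3) assms(4) d(1,2)]]]
    have "diff M (covariant_derivative Y Z) p (A p) = diff M (\<lambda>q. diff M Z q (Y q)) p (A p)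
        + (A (\<Gamma> p (Y p) (Z p)) + \<Gamma> p (diff M Y p (A p) - A (Y p)) (Z p) + \<Gamma> p (Y p) (diff M Z p (A p) - A (Z p)))"
      unfolding covariant_derivative_def .
    then show ?thesis
      unfolding covariant_derivative_def[of X "covariant_derivative Y Z"] vf(4)
      by (simp add: covariant_derivative_def)
  qed
  have "smooth_map M Z" using assms(3) by (simp add: vector_field_def)
  from diff_commutator[OF this assms(1,2,4) field_bracket_tangent[OF assms(1,2,4)]]
  have com: "diff M (\<lambda>q. diff M Z q (Y q)) p (A p)
      = diff M (\<lambda>q. diff M Z q (X q)) p (B p) + diff M Z p (field_bracket M X Y p)"
    by (simp add: assms algebra_simps)
  have lin: "A (v + w) = A v + A w" "B (v + w) = B v + B w" for v w
    by (rule linear_add[OF bounded_linear.linear[OF generator_linear]], fact assms)+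
  have comm: "\<Gamma> p (B p) v = \<Gamma> p v (B p)" "\<Gamma> p (A p) v = \<Gamma> p v (A p)" for v
    by (rule \<Gamma>_commute)+
  show ?thesis
    unfolding curvature_def second[OF assms(1,2,5,6)] second[OF assms(2,1,7,8)] com
    unfolding covariant_derivative_def[of "field_bracket M X Y"] \<Lambda>_def field_bracket_def[of M X Y p] assms(6,8)
    by (simp add: \<Gamma>_simps lin algebra_simps)
qed

text \<open>The generators witness that the choice in \<open>extension\<close> is not
  vacuous.\<close>

lemma extension_tangent:
  assumes "p \<in> M" "x \<in> tangent M p"
  shows "vector_field M (extension M p x)" "extension M p x p = x"
proof -
  obtain A where "A \<in> \<LL>" "x = A p" using assms tangent_eq by blast
  then have "\<exists>X. vector_field M X \<and> X p = x" using vector_field_generator by blast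
  then have "vector_field M (extension M p x) \<and> extension M p x p = x"
    unfolding extension_def by (rule someI_ex)
  then show "vector_field M (extension M p x)" "extension M p x p = x" by auto
qed

end

section \<open>Matrices\<close>

lemma bounded_bilinear_matrix_mult:
  "bounded_bilinear ((**) :: real^'b^'a \<Rightarrow> real^'c^'b \<Rightarrow> real^'c^'a)"
  unfolding bilinear_conv_bounded_bilinear[symmetric] bilinear_def
  by (auto intro!: linearI simp: matrix_matrix_mult_def vec_eq_iff sum.distrib sum_distrib_left algebra_simps)

interpretation matmul: bounded_bilinear "(**) :: real^'b^'a \<Rightarrow> real^'c^'b \<Rightarrow> real^'c^'a"
  by (rule bounded_bilinear_matrix_mult)

lemma linear_transpose: "linear (transpose :: real^'b^'a \<Rightarrow> real^'a^'b)"
  by (auto intro!: linearI simp: transpose_def vec_eq_iff)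

lemma bounded_linear_transpose: "bounded_linear (transpose :: real^'b^'a \<Rightarrow> real^'a^'b)"
  using linear_transpose by (simp add: linear_conv_bounded_linear)

lemmas transpose_simps = linear_add[OF linear_transpose] linear_diff[OF linear_transpose]
  linear_neg[OF linear_transpose] linear_cmul[OF linear_transpose] linear_0[OF linear_transpose]
  matrix_transpose_mul

lemmas matrix_distribs = matmul.add_left matmul.add_right matmul.diff_left matmul.diff_right
  matmul.minus_left matmul.minus_right matmul.scaleR_left matmul.scaleR_right
  matmul.zero_left matmul.zero_right

lemma inner_matrix: "(A :: real^'b^'a) \<bullet> B = (\<Sum>i\<in>UNIV. \<Sum>j\<in>UNIV. A $ i $ j * B $ i $ j)"
  by (simp add: inner_vec_def)

lemma inner_transpose: "transpose (A :: real^'b^'a) \<bullet> transpose B = A \<bullet> B"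
  unfolding inner_matrix transpose_def by (simp, rule sum.swap)

lemma inner_matrix_mult_left: "((A :: real^'b^'a) ** B) \<bullet> C = B \<bullet> (transpose A ** C)"
proof -
  have "(A ** B) \<bullet> C = (\<Sum>i\<in>UNIV. \<Sum>j\<in>UNIV. \<Sum>k\<in>UNIV. A $ i $ k * B $ k $ j * C $ i $ j)"
    by (simp add: inner_matrix matrix_matrix_mult_def sum_distrib_right)
  also have "\<dots> = (\<Sum>k\<in>UNIV. \<Sum>j\<in>UNIV. \<Sum>i\<in>UNIV. A $ i $ k * B $ k $ j * C $ i $ j)"
    by (subst sum.swap, subst (2) sum.swap, subst sum.swap, rule refl)
  also have "\<dots> = B \<bullet> (transpose A ** C)"
    by (simp add: inner_matrix matrix_matrix_mult_def transpose_def sum_distrib_left ac_simps)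
  finally show ?thesis .
qed

lemma inner_matrix_mult_right: "((A :: real^'b^'a) ** B) \<bullet> C = A \<bullet> (C ** transpose B)"
proof -
  have "(A ** B) \<bullet> C = (transpose B ** transpose A) \<bullet> transpose C"
    by (simp only: inner_transpose flip: matrix_transpose_mul)
  also have "\<dots> = transpose A \<bullet> transpose (C ** transpose B)"
    by (simp only: inner_matrix_mult_left matrix_transpose_mul transpose_transpose)
  finally show ?thesis by (simp only: inner_transpose)
qed

lemma so_iff: "A \<in> so \<longleftrightarrow> transpose A = - A"
  by (simp add: so_def)

lemma so_component:
  assumes "A \<in> so"
  shows "A $ i $ j = - A $ j $ i"
proof -
  have "transpose A $ j $ i = (- A) $ j $ i" using assms by (simp add: so_iff)
  then show ?thesis by (simp add: transpose_def)
qed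

lemma so_diagonal: "A \<in> so \<Longrightarrow> A $ i $ i = (0::real)"
  using so_component[of A i i] by simp

lemma subspace_so: "subspace (so :: (real^'n^'n) set)"
  by (auto simp: subspace_def so_iff transpose_simps)

definition unit_matrix :: "'a \<Rightarrow> 'b \<Rightarrow> real^'b^'a" where
  "unit_matrix i j = (\<chi> a b. if a = i \<and> b = j then 1 else 0)"

lemma unit_matrix_mult:
  "unit_matrix i j ** unit_matrix k l = (if j = k then unit_matrix i l else 0)"
  by (auto simp: unit_matrix_def matrix_matrix_mult_def vec_eq_iff sum.If_cases
      if_distrib[of "\<lambda>x. x * _"] cong: if_cong)

lemma transpose_unit_matrix: "transpose (unit_matrix i j) = unit_matrix j i"
  by (auto simp: unit_matrix_def transpose_def vec_eq_iff)

lemma matrix_sum_unit: "(\<Sum>i\<in>UNIV. \<Sum>j\<in>UNIV. A $ i $ j *\<^sub>R unit_matrix i j) = (A :: real^'b^'a)"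
proof -
  have "(\<Sum>i\<in>UNIV. \<Sum>j\<in>UNIV. A $ i $ j * (if a = i \<and> b = j then 1 else 0)) = A $ a $ b" for a b
  proof -
    have "A $ i $ j * (if a = i \<and> b = j then 1 else 0) = (if b = j then if a = i then A $ i $ j else 0 else 0)" for i j
      by simp
    then show ?thesis by simp
  qed
  then show ?thesis by (simp add: vec_eq_iff unit_matrix_def)
qed

section \<open>The tangent spaces of a Stiefel manifold\<close>

text \<open>For distinct \<open>i\<close> and \<open>j\<close> this is the exponential of
  \<open>t *\<^sub>R K\<close>, in Rodrigues' form: the cube of \<open>K\<close> is -
  \<open>K\<close>.\<close>

definition plane_rotation :: "'n \<Rightarrow> 'n \<Rightarrow> real \<Rightarrow> real^'n^'n" where
  "plane_rotation i j t = (let K = unit_matrix i j - unit_matrix j i in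
     mat 1 + sin t *\<^sub>R K + (1 - cos t) *\<^sub>R (K ** K))"

lemma plane_rotation_in_SO:
  fixes i j :: "'n::finite"
  assumes "i \<noteq> j"
  shows "plane_rotation i j t \<in> SO"
proof -
  define K :: "real^'n^'n" where "K = unit_matrix i j - unit_matrix j i"
  define P where "P = K ** K"
  have P: "P = - unit_matrix i i - unit_matrix j j"
    using assms by (simp add: P_def K_def matrix_distribs unit_matrix_mult)
  have mult: "K ** K = P" "P ** K = - K" "K ** P = - K" "P ** P = - P"
    using assms by (simp_all add: P, simp_all add: K_def matrix_distribs unit_matrix_mult)
  have tr: "transpose K = - K" "transpose P = P"
    by (simp_all add: P, simp_all add: K_def transpose_simps transpose_unit_matrix)
  have R: "plane_rotation i j t = mat 1 + sin t *\<^sub>R K + (1 - cos t) *\<^sub>R P" for t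
    by (simp add: plane_rotation_def K_def P_def Let_def)
  have cs: "(cos t * cos t) *\<^sub>R P + (sin t * sin t) *\<^sub>R P = P" for t
    by (simp flip: scaleR_add_left)
  have "transpose (plane_rotation i j t) ** plane_rotation i j t = mat 1" for t
    using cs[of t] by (simp add: R transpose_simps tr matrix_distribs mult algebra_simps)
  then have orth: "orthogonal_matrix (plane_rotation i j t)" for t
    by (simp add: orthogonal_matrix)
  \<comment> \<open>Orthogonality leaves the sign of the determinant open. A rotation is the square
    of the rotation by half the angle, so its determinant is nonnegative.\<close>
  have "plane_rotation i j (2 * t) = plane_rotation i j t ** plane_rotation i j t" for t
  proof -
    have "K * 2 = 2 *\<^sub>R K" by (simp add: scaleR_2 mult_2_right)
    moreover have "plane_rotation i j (2 * t)
        = mat 1 + (sin t * cos t + sin t * cos t) *\<^sub>R K + (1 - (cos t * cos t - sin t * sin t)) *\<^sub>R P"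
      by (simp add: R sin_double cos_double power2_eq_square)
    ultimately show ?thesis
      using cs[of t] by (simp add: R matrix_distribs mult algebra_simps)
  qed
  then have "det (plane_rotation i j (2 * t)) = (det (plane_rotation i j t))\<^sup>2" for t
    by (simp add: det_mul power2_eq_square)
  from this[of "t / 2"] have "det (plane_rotation i j t) \<ge> 0" by simp
  then show ?thesis
    using det_orthogonal_matrix[OF orth[of t]] orth[of t] by (auto simp: SO_def rotation_matrix_def)
qed

definition infinitesimal_rotation :: "real^'n^'n \<Rightarrow> bool" where
  "infinitesimal_rotation A \<longleftrightarrow>
     (\<exists>\<gamma>. (\<forall>t. \<gamma> t \<in> SO) \<and> \<gamma> 0 = mat 1 \<and> (\<gamma> has_vector_derivative A) (at (0::real)))"

lemma mat_1_in_SO: "mat 1 \<in> SO"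
  by (simp add: SO_def rotation_matrix_def orthogonal_matrix_id)

lemma infinitesimal_rotation_0: "infinitesimal_rotation 0"
  unfolding infinitesimal_rotation_def
  by (intro exI[of _ "\<lambda>t. mat 1"]) (simp add: mat_1_in_SO)

lemma infinitesimal_rotation_add:
  assumes "infinitesimal_rotation A" "infinitesimal_rotation B"
  shows "infinitesimal_rotation (A + B)"
proof -
  obtain \<gamma> \<delta> where *: "\<And>t. \<gamma> t \<in> SO" "\<gamma> 0 = mat 1" "(\<gamma> has_vector_derivative A) (at 0)"
    "\<And>t. \<delta> t \<in> SO" "\<delta> 0 = mat 1" "(\<delta> has_vector_derivative B) (at 0)"
    using assms unfolding infinitesimal_rotation_def by metis
  have "((\<lambda>t. \<gamma> t ** \<delta> t) has_vector_derivative (A + B)) (at 0)"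
    using matmul.has_vector_derivative[OF *(3,6)] by (simp add: * add.commute)
  then show ?thesis
    unfolding infinitesimal_rotation_def by (intro exI[of _ "\<lambda>t. \<gamma> t ** \<delta> t"]) (simp add: * SO_mult)
qed

lemma infinitesimal_rotation_sum:
  "finite I \<Longrightarrow> (\<And>i. i \<in> I \<Longrightarrow> infinitesimal_rotation (A i)) \<Longrightarrow> infinitesimal_rotation (\<Sum>i\<in>I. A i)"
  by (induction I rule: finite_induct) (auto intro: infinitesimal_rotation_0 infinitesimal_rotation_add)

lemma infinitesimal_rotation_plane:
  "infinitesimal_rotation (a *\<^sub>R (unit_matrix i j - unit_matrix j i))"
proof (cases "i = j")
  case True
  then show ?thesis by (simp add: infinitesimal_rotation_0)
next
  case False
  have "((\<lambda>t. plane_rotation i j (a * t)) has_vector_derivative a *\<^sub>R (unit_matrix i j - unit_matrix j i)) (at 0)"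
    unfolding plane_rotation_def Let_def
    by (auto intro!: derivative_eq_intros simp: has_vector_derivative_def algebra_simps)
  moreover have "plane_rotation i j 0 = mat 1" by (simp add: plane_rotation_def Let_def)
  ultimately show ?thesis
    unfolding infinitesimal_rotation_def
    by (intro exI[of _ "\<lambda>t. plane_rotation i j (a * t)"]) (simp add: plane_rotation_in_SO[OF False])
qed

text \<open>Velocities at the identity add when curves are multiplied, and a skew matrix is a
  combination of generators of plane rotations. Only the velocity at 0 of the resulting curve
  matters.\<close>

lemma infinitesimal_rotation_so:
  assumes "A \<in> so"
  shows "infinitesimal_rotation A"
proof -
  \<comment> \<open>Each plane occurs as (i, j) and as (j, i), hence the factor 1/2.\<close>
  have "(\<Sum>i\<in>UNIV. \<Sum>j\<in>UNIV. (A $ i $ j / 2) *\<^sub>R (unit_matrix i j - unit_matrix j i))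
      = (1/2) *\<^sub>R (\<Sum>i\<in>UNIV. \<Sum>j\<in>UNIV. A $ i $ j *\<^sub>R unit_matrix i j)
        - (1/2) *\<^sub>R transpose (\<Sum>i\<in>UNIV. \<Sum>j\<in>UNIV. A $ i $ j *\<^sub>R unit_matrix i j)"
    by (simp add: linear_sum[OF linear_transpose] transpose_simps transpose_unit_matrix scaleR_diff_right
        sum_subtractf scaleR_sum_right)
  also have "\<dots> = A"
    unfolding matrix_sum_unit using assms by (simp add: so_iff flip: scaleR_add_left)
  finally show ?thesis
    using infinitesimal_rotation_sum infinitesimal_rotation_plane by (metis (no_types, lifting) finite)
qed

lemma stiefel_orthonormal:
  assumes "p \<in> (stiefel :: (real^'m^('m + 'l::finite)) set)"
  shows "transpose p ** p = mat 1"
proof -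
  obtain a where a: "a \<in> SO" "p = a ** base_frame" using assms by (auto simp: stiefel_def)
  have "transpose a ** a = mat 1" using a by (simp add: SO_def rotation_matrix_def orthogonal_matrix)
  then have "transpose p ** p = transpose base_frame ** (base_frame :: real^'m^('m + 'l))"
    unfolding a(2) matrix_transpose_mul by (metis matrix_mul_assoc matrix_mul_lid)
  also have "\<dots> = mat 1"
    by (auto simp: vec_eq_iff matrix_matrix_mult_def transpose_def base_frame_def mat_def sum_UNIV_Plus
        if_distrib[of "\<lambda>x. x * _"] cong: if_cong)
  finally show ?thesis .
qed

lemma stiefel_act: "a \<in> SO \<Longrightarrow> p \<in> stiefel \<Longrightarrow> a ** p \<in> stiefel"
  unfolding stiefel_def by (auto simp: matrix_mul_assoc intro!: imageI SO_mult)

text \<open>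
  Of the skew matrices \<open>A\<close> with \<open>A ** p = v\<close> this is the one that maps the orthogonal complement of the
  columns of \<open>p\<close> into their span.
\<close>

definition generator :: "real^'m^'n \<Rightarrow> real^'m^'n \<Rightarrow> real^'n^'n" where
  "generator p v = v ** transpose p - p ** transpose v - p ** transpose p ** v ** transpose p"

lemma generator_mult:
  assumes "transpose p ** p = mat 1" "transpose p ** v + transpose v ** p = 0"
  shows "generator p v \<in> so" "generator p v ** p = v"
proof -
  have v: "transpose v ** p = - (transpose p ** v)" using assms(2) by (simp add: eq_neg_iff_add_eq_0 add.commute)
  have e: "X ** transpose p ** p = X" "X ** transpose v ** p = - (X ** transpose p ** v)" for X :: "real^_^_"
    by (simp_all add: assms(1) v matrix_distribs flip: matrix_mul_assoc)
  show "generator p v ** p = v"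
    by (simp add: generator_def matrix_distribs e)
  show "generator p v \<in> so"
    by (simp add: so_iff generator_def transpose_simps matrix_mul_assoc v matrix_distribs e)
qed

text \<open>A cycle of three inclusions: the constant map \<open>transpose q ** q\<close> has
  derivative 0, \<open>generator\<close> solves \<open>A ** p = v\<close> for the solutions of that
  linear equation, and curves of rotations applied to \<open>p\<close> realise the velocities
  \<open>A ** p\<close>.\<close>

lemma tangent_stiefel:
  assumes "p \<in> (stiefel :: (real^'m^('m + 'l::finite)) set)"
  shows "tangent stiefel p = {v. transpose p ** v + transpose v ** p = 0}"
    and "tangent stiefel p = (\<lambda>A. A ** p) ` so"
proof -
  have 1: "tangent stiefel p \<subseteq> {v. transpose p ** v + transpose v ** p = 0}"
  proof
    fix v assume v: "v \<in> tangent stiefel p"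
    have "((\<lambda>q. transpose q ** q) has_derivative (\<lambda>u. transpose p ** u + transpose u ** p)) (at p within stiefel)"
      by (intro matmul.FDERIV bounded_linear.has_derivative[OF bounded_linear_transpose] has_derivative_ident)
    from diff_eqI[OF v this]
    have "diff stiefel (\<lambda>q. transpose q ** q) p v = transpose p ** v + transpose v ** p" .
    moreover have "((\<lambda>q. transpose q ** q) has_derivative (\<lambda>u. 0)) (at p within stiefel)"
      by (rule has_derivative_transform[OF assms _ has_derivative_const[of "mat 1"]]) (rule stiefel_orthonormal)
    from diff_eqI[OF v this] have "diff stiefel (\<lambda>q. transpose q ** q) p v = 0" .
    ultimately show "v \<in> {v. transpose p ** v + transpose v ** p = 0}" by simp
  qed
  have 2: "{v. transpose p ** v + transpose v ** p = 0} \<subseteq> (\<lambda>A. A ** p) ` so"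
    using generator_mult[OF stiefel_orthonormal[OF assms]] by (force simp: image_iff)
  have 3: "(\<lambda>A. A ** p) ` so \<subseteq> tangent stiefel p"
  proof clarify
    fix A :: "real^('m + 'l)^('m + 'l)" assume "A \<in> so"
    then obtain \<gamma> where \<gamma>: "\<And>t. \<gamma> t \<in> SO" "\<gamma> 0 = mat 1" "(\<gamma> has_vector_derivative A) (at 0)"
      using infinitesimal_rotation_so unfolding infinitesimal_rotation_def by metis
    have "((\<lambda>t. \<gamma> t ** p) has_vector_derivative A ** p) (at 0)"
      by (rule bounded_linear.has_vector_derivative[OF matmul.bounded_linear_left \<gamma>(3)])
    then show "A ** p \<in> tangent stiefel p"
      unfolding tangent_def using \<gamma> assms by (auto intro!: exI[of _ "\<lambda>t. \<gamma> t ** p"] stiefel_act)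
  qed
  show "tangent stiefel p = {v. transpose p ** v + transpose v ** p = 0}" "tangent stiefel p = (\<lambda>A. A ** p) ` so"
    using 1 2 3 by blast+
qed

section \<open>The metrics and their Levi-Civita connections\<close>

definition hadamard :: "('a \<Rightarrow> 'b \<Rightarrow> real) \<Rightarrow> real^'b^'a \<Rightarrow> real^'b^'a" where
  "hadamard w A = (\<chi> i j. w i j * A $ i $ j)"

lemma linear_hadamard: "linear (hadamard w)"
  by (auto intro!: linearI simp: hadamard_def vec_eq_iff algebra_simps)

lemma bounded_linear_hadamard: "bounded_linear (hadamard w :: real^'b^'a \<Rightarrow> real^'b^'a)"
  using linear_hadamard by (simp add: linear_conv_bounded_linear)

lemmas hadamard_simps = linear_add[OF linear_hadamard] linear_diff[OF linear_hadamard]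
  linear_neg[OF linear_hadamard] linear_cmul[OF linear_hadamard] linear_0[OF linear_hadamard]

lemma hadamard_component: "hadamard w A $ i $ j = w i j * A $ i $ j"
  by (simp add: hadamard_def)

lemma inner_hadamard: "hadamard w A \<bullet> B = A \<bullet> hadamard w B"
  by (simp add: inner_matrix hadamard_def ac_simps)

lemma so_inner_transpose: "A \<in> so \<Longrightarrow> transpose B \<bullet> A = - (B \<bullet> A)"
  using inner_transpose[of B A] by (auto simp: so_iff)

lemma inner_so_mult_left: "A \<in> so \<Longrightarrow> (A ** B) \<bullet> C = - (B \<bullet> (A ** C))"
  by (simp add: inner_matrix_mult_left so_iff matmul.minus_left)

lemma inner_so_mult_right: "A \<in> so \<Longrightarrow> (B ** A) \<bullet> C = - (B \<bullet> (C ** A))"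
  by (simp add: inner_matrix_mult_right so_iff matmul.minus_right)

lemma commutator_in_so: "A \<in> so \<Longrightarrow> B \<in> so \<Longrightarrow> A ** B - B ** A \<in> so"
  by (simp add: so_iff transpose_simps matrix_distribs)

lemma commutator_inner:
  assumes "A \<in> so"
  shows "(A ** B - B ** A) \<bullet> C = - (B \<bullet> (A ** C - C ** A))"
  using assms by (simp add: inner_so_mult_left inner_so_mult_right inner_diff_left inner_diff_right)

lemma has_directional_derivative_eq_rhs:
  "has_directional_derivative M p v f l \<Longrightarrow> l = m \<Longrightarrow> has_directional_derivative M p v f m"
  by simp

locale weights =
  fixes c :: "'m::finite \<Rightarrow> 'm \<Rightarrow> real"
  assumes c_commute: "c i j = c j i" and c_pos: "c i j > 0"
begin

abbreviation "C \<equiv> hadamard c"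
abbreviation "D \<equiv> hadamard (\<lambda>i j. c i j - 1)"
abbreviation "E \<equiv> hadamard (\<lambda>i j. 1 / c i j)"

lemma D_eq: "D A = C A - A"
  by (simp add: hadamard_def vec_eq_iff algebra_simps)

lemma C_E: "C (E A) = A"
  using c_pos by (simp add: hadamard_def vec_eq_iff less_imp_neq[THEN not_sym])

lemma hadamard_transpose: "transpose (C A) = C (transpose A)" "transpose (D A) = D (transpose A)"
    "transpose (E A) = E (transpose A)"
  by (simp_all add: hadamard_def transpose_def vec_eq_iff c_commute)

lemma hadamard_in_so: "A \<in> so \<Longrightarrow> C A \<in> so" "A \<in> so \<Longrightarrow> D A \<in> so" "A \<in> so \<Longrightarrow> E A \<in> so"
  by (simp_all add: so_iff hadamard_transpose hadamard_simps)

text \<open>\<open>transpose p ** u\<close> is the skew part W of \<open>u\<close>. As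
  \<open>D\<close> is \<open>C\<close> minus the identity, the Euclidean weight 1 is changed to
  \<open>c\<close> on W and kept on h. The formula is polynomial in \<open>p\<close>.\<close>

definition metric :: "(real^'m^'n::finite) tensor2" where
  "metric p u v = u \<bullet> v + (transpose p ** u) \<bullet> D (transpose p ** v)"

text \<open>The symmetric part of the Levi-Civita connection of the left-invariant metric on SO(m)
  with inertia operator \<open>C\<close>. It vanishes when all weights are equal.\<close>

definition \<Psi> :: "real^'m^'m \<Rightarrow> real^'m^'m \<Rightarrow> real^'m^'m" where
  "\<Psi> W U = (1/2) *\<^sub>R E ((W ** C U - C U ** W) + (U ** C W - C W ** U))"

text \<open>
  For a tangent vector \<open>u\<close> at \<open>p\<close> the matrix \<open>transpose p ** u\<close> is skew. The choice of the
  Christoffel tensor on vectors that are not tangent is immaterial.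
\<close>

definition christoffel :: "real^'m^'n \<Rightarrow> real^'m^'n \<Rightarrow> real^'m^'n \<Rightarrow> real^'m^'n::finite" where
  "christoffel p u v =
     p ** ((1/2) *\<^sub>R (transpose u ** v + transpose v ** u) + \<Psi> (transpose p ** u) (transpose p ** v))
     + (u - p ** (transpose p ** u)) ** D (transpose p ** v)
     + (v - p ** (transpose p ** v)) ** D (transpose p ** u)"

lemma \<Psi>_linear:
  "\<Psi> (A + B) U = \<Psi> A U + \<Psi> B U" "\<Psi> (A - B) U = \<Psi> A U - \<Psi> B U" "\<Psi> (a *\<^sub>R A) U = a *\<^sub>R \<Psi> A U"
  "\<Psi> U (A + B) = \<Psi> U A + \<Psi> U B" "\<Psi> U (A - B) = \<Psi> U A - \<Psi> U B" "\<Psi> U (a *\<^sub>R A) = a *\<^sub>R \<Psi> U A"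
  by (simp_all add: \<Psi>_def hadamard_simps matrix_distribs algebra_simps)

lemma bounded_bilinear_\<Psi>: "bounded_bilinear \<Psi>"
  unfolding bilinear_conv_bounded_bilinear[symmetric] bilinear_def
  by (auto intro!: linearI simp: \<Psi>_linear)

lemma \<Psi>_commute: "\<Psi> W U = \<Psi> U W"
  by (simp add: \<Psi>_def add.commute)

lemma \<Psi>_in_so: "W \<in> so \<Longrightarrow> U \<in> so \<Longrightarrow> \<Psi> W U \<in> so"
  unfolding \<Psi>_def
  by (intro subspace_scale[OF subspace_so] hadamard_in_so subspace_add[OF subspace_so] commutator_in_so)

lemma bilinear_metric: "bilinear (metric p)"
  unfolding bilinear_def metric_def
  by (auto intro!: linearI simp: hadamard_simps matrix_distribs algebra_simps)

lemma bilinear_christoffel: "bilinear (christoffel p)"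
  unfolding bilinear_def christoffel_def
  by (auto intro!: linearI simp: \<Psi>_linear hadamard_simps matrix_distribs transpose_simps algebra_simps)

lemma christoffel_commute: "christoffel p u v = christoffel p v u"
  by (simp add: christoffel_def \<Psi>_commute[of "transpose p ** u"] ac_simps)

lemma smooth_map_transpose_mult:
  fixes X Y :: "'x::euclidean_space \<Rightarrow> real^'b^'a"
  assumes "smooth_map M X" "smooth_map M Y"
  shows "smooth_map M (\<lambda>p. transpose (X p) ** Y p)"
  by (intro smooth_map_bilinear[OF bounded_bilinear_matrix_mult] smooth_map_linear[OF bounded_linear_transpose] assms)

lemma smooth_map_christoffel:
  fixes M :: "(real^'m^'n::finite) set"
  assumes "smooth_map M X" "smooth_map M Y"
  shows "smooth_map M (\<lambda>p. christoffel p (X p) (Y p))"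
  unfolding christoffel_def
  by (intro smooth_map_add smooth_map_diff smooth_map_bilinear[OF bounded_bilinear_matrix_mult]
      smooth_map_bilinear[OF bounded_bilinear_\<Psi>] smooth_map_linear[OF bounded_linear_scaleR_right]
      smooth_map_linear[OF bounded_linear_hadamard] smooth_map_transpose_mult smooth_map_id assms)

lemma smooth_map_metric:
  fixes M :: "(real^'m^'n::finite) set"
  assumes "smooth_map M X" "smooth_map M Y"
  shows "smooth_map M (\<lambda>p. metric p (X p) (Y p))"
  unfolding metric_def
  by (intro smooth_map_add smooth_map_bilinear[OF bounded_bilinear_inner]
      smooth_map_linear[OF bounded_linear_hadamard] smooth_map_transpose_mult smooth_map_id assms)

text \<open>Such products are invariant under left multiplication by rotations: the two terms
  containing \<open>A\<close> cancel since \<open>A\<close> is skew, and only Lie derivatives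
  remain.\<close>

lemma derivative_transpose_mult:
  fixes p :: "real^'m^'n::finite" and Y Z :: "real^'m^'n \<Rightarrow> real^'m^'n"
  assumes "A \<in> so" "has_directional_derivative M p (A ** p) Y y" "has_directional_derivative M p (A ** p) Z z"
  shows "has_directional_derivative M p (A ** p) (\<lambda>q. transpose (Y q) ** Z q)
    (transpose (y - A ** Y p) ** Z p + transpose (Y p) ** (z - A ** Z p))"
  using has_directional_derivative_bilinear[OF bounded_bilinear_matrix_mult
      has_directional_derivative_linear[OF bounded_linear_transpose assms(2)] assms(3)] assms(1)
  by (simp add: transpose_simps matrix_distribs so_iff matrix_mul_assoc add.commute)

lemma derivative_transpose_base:
  fixes p :: "real^'m^'n::finite" and Y :: "real^'m^'n \<Rightarrow> real^'m^'n"
  assumes "A \<in> so" "has_directional_derivative M p (A ** p) Y y"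
  shows "has_directional_derivative M p (A ** p) (\<lambda>q. transpose q ** Y q) (transpose p ** (y - A ** Y p))"
  using derivative_transpose_mult[OF assms(1) has_directional_derivative_ident assms(2)]
  by (simp add: matrix_distribs linear_0[OF linear_transpose])

lemma derivative_metric:
  fixes p :: "real^'m^'n::finite" and Y Z :: "real^'m^'n \<Rightarrow> real^'m^'n"
  assumes "A \<in> so" "has_directional_derivative M p (A ** p) Y y" "has_directional_derivative M p (A ** p) Z z"
  shows "has_directional_derivative M p (A ** p) (\<lambda>q. metric q (Y q) (Z q))
    (metric p (y - A ** Y p) (Z p) + metric p (Y p) (z - A ** Z p))"
proof -
  have "y \<bullet> Z p + Y p \<bullet> z = (y - A ** Y p) \<bullet> Z p + Y p \<bullet> (z - A ** Z p)"
    using inner_so_mult_left[OF assms(1), of "Y p" "Z p"] by (simp add: inner_diff_left inner_diff_right)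
  then show ?thesis
    using has_directional_derivative_add[OF
        has_directional_derivative_bilinear[OF bounded_bilinear_inner assms(2,3)]
        has_directional_derivative_bilinear[OF bounded_bilinear_inner
          derivative_transpose_base[OF assms(1,2)]
          has_directional_derivative_linear[OF bounded_linear_hadamard
            derivative_transpose_base[OF assms(1,3)]]]]
    unfolding metric_def by (simp add: algebra_simps)
qed

lemma derivative_horizontal:
  fixes p :: "real^'m^'n::finite" and Y :: "real^'m^'n \<Rightarrow> real^'m^'n"
  assumes "A \<in> so" "has_directional_derivative M p (A ** p) Y y"
  shows "has_directional_derivative M p (A ** p) (\<lambda>q. Y q - q ** (transpose q ** Y q))
    (A ** (Y p - p ** (transpose p ** Y p))
      + ((y - A ** Y p) - p ** (transpose p ** (y - A ** Y p))))"
  using has_directional_derivative_sub[OF assms(2) has_directional_derivative_bilinear[OF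
        bounded_bilinear_matrix_mult has_directional_derivative_ident derivative_transpose_base[OF assms]]]
  by (simp add: matrix_distribs matrix_mul_assoc algebra_simps)

text \<open>The tensor is assembled from \<open>q\<close>, the invariant products
  \<open>transpose q ** Y q\<close> and \<open>transpose (Y q) ** Z q\<close>, and the equivariant h
  parts. The product rule therefore yields one leading \<open>A\<close> and otherwise Lie
  derivatives of the arguments.\<close>

lemma derivative_christoffel:
  fixes p :: "real^'m^'n::finite" and Y Z :: "real^'m^'n \<Rightarrow> real^'m^'n"
  assumes "A \<in> so" "has_directional_derivative M p (A ** p) Y y" "has_directional_derivative M p (A ** p) Z z"
  shows "has_directional_derivative M p (A ** p) (\<lambda>q. christoffel q (Y q) (Z q))
    (A ** christoffel p (Y p) (Z p) + christoffel p (y - A ** Y p) (Z p) + christoffel p (Y p) (z - A ** Z p))"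
proof -
  note W = derivative_transpose_base[OF assms(1)]
  note inner_part = has_directional_derivative_add[OF
      has_directional_derivative_linear[OF bounded_linear_scaleR_right has_directional_derivative_add[OF
        derivative_transpose_mult[OF assms] derivative_transpose_mult[OF assms(1,3,2)]]]
      has_directional_derivative_bilinear[OF bounded_bilinear_\<Psi> W[OF assms(2)] W[OF assms(3)]], of "1/2"]
  note cross = has_directional_derivative_bilinear[OF bounded_bilinear_matrix_mult
      derivative_horizontal[OF assms(1)] has_directional_derivative_linear[OF bounded_linear_hadamard W]]
  note all = has_directional_derivative_add[OF has_directional_derivative_add[OF
      has_directional_derivative_bilinear[OF bounded_bilinear_matrix_mult
        has_directional_derivative_ident inner_part]
      cross[OF assms(2,3)]] cross[OF assms(3,2)]]
  define u where "u = y - A ** Y p"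
  define v where "v = z - A ** Z p"
  show ?thesis
    unfolding christoffel_def u_def[symmetric] v_def[symmetric]
    by (rule has_directional_derivative_eq_rhs[OF all[folded u_def v_def]])
       (simp add: matrix_distribs scaleR_add_right \<Psi>_linear matrix_mul_assoc algebra_simps)
qed

end

text \<open>
  A tangent vector at \<open>p\<close> is \<open>p ** \<omega> + h\<close> with \<open>\<omega>\<close> skew and the columns of \<open>h\<close> orthogonal to
  those of \<open>p\<close>; it is encoded as the pair \<open>(\<omega>, h)\<close>.
\<close>

definition join :: "real^'m^'n \<Rightarrow> (real^'m^'m) \<times> (real^'m^'n) \<Rightarrow> real^'m^'n" where
  "join p u = p ** fst u + snd u"

definition split_tangent :: "real^'m^'n::finite \<Rightarrow> ((real^'m^'m) \<times> (real^'m^'n)) set" where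
  "split_tangent p = {u. fst u \<in> so \<and> transpose p ** snd u = 0}"

text \<open>The commutator of the canonical generators of two tangent vectors, modulo skew matrices
  annihilating \<open>p\<close>.\<close>

definition bracket :: "(real^'m^'m) \<times> (real^'m^'n) \<Rightarrow> (real^'m^'m) \<times> (real^'m^'n) \<Rightarrow> (real^'m^'m) \<times> (real^'m^'n)" where
  "bracket u v = (fst u ** fst v - fst v ** fst u - transpose (snd u) ** snd v + transpose (snd v) ** snd u,
     snd u ** fst v - snd v ** fst u)"

lemma linear_join: "linear (join p)"
  by (auto intro!: linearI simp: join_def matrix_distribs scaleR_add_right)

lemma subspace_split_tangent: "subspace (split_tangent p)"
  by (auto simp: subspace_def split_tangent_def matrix_distribs
      intro: subspace_add[OF subspace_so] subspace_scale[OF subspace_so] subspace_0[OF subspace_so])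

context
  fixes p :: "real^'m^'n::finite"
  assumes orth: "transpose p ** p = mat 1"
begin

lemma orth_mult: "X ** transpose p ** p = X"
  by (simp add: orth flip: matrix_mul_assoc)

lemma split_tangentD:
  assumes "u \<in> split_tangent p"
  shows "transpose (fst u) = - fst u" "transpose p ** snd u = 0" "transpose (snd u) ** p = 0"
    "X ** transpose p ** snd u = 0" "X ** transpose (snd u) ** p = 0"
proof -
  show "transpose (fst u) = - fst u" and *: "transpose p ** snd u = 0"
    using assms by (auto simp: split_tangent_def so_iff)
  show **: "transpose (snd u) ** p = 0"
    using arg_cong[OF *, of transpose] by (simp add: transpose_simps)
  show "X ** transpose p ** snd u = 0" "X ** transpose (snd u) ** p = 0"
    by (simp_all add: * ** matrix_distribs flip: matrix_mul_assoc)
qed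

lemma transpose_mult_join:
  assumes "u \<in> split_tangent p"
  shows "transpose p ** join p u = fst u"
  by (simp add: join_def matrix_distribs orth matrix_mul_assoc split_tangentD[OF assms])

lemma join_inner:
  assumes "u \<in> split_tangent p" "v \<in> split_tangent p"
  shows "join p u \<bullet> join p v = u \<bullet> v"
proof -
  have "(p ** X) \<bullet> (p ** Y) = X \<bullet> Y" for X Y :: "real^'m^'m"
    by (simp add: inner_matrix_mult_left orth matrix_mul_assoc)
  moreover have "(p ** X) \<bullet> snd w = 0" if "w \<in> split_tangent p" for X w
    by (simp add: inner_matrix_mult_left split_tangentD[OF that])
  moreover have "snd w \<bullet> (p ** X) = 0" if "w \<in> split_tangent p" for X w
    using calculation(2)[OF that] by (simp add: inner_commute)
  ultimately show ?thesis
    using assms by (simp add: join_def inner_add_left inner_add_right inner_prod_def)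
qed

lemma split_tangent_bracket:
  assumes "u \<in> split_tangent p" "v \<in> split_tangent p"
  shows "bracket u v \<in> split_tangent p"
  by (simp add: bracket_def split_tangent_def so_iff transpose_simps matrix_distribs matrix_mul_assoc
      split_tangentD[OF assms(1)] split_tangentD[OF assms(2)])

lemma tangent_as_join: "{v. transpose p ** v + transpose v ** p = 0} = join p ` split_tangent p"
proof (intro equalityI subsetI)
  fix v assume "v \<in> {v. transpose p ** v + transpose v ** p = 0}"
  then have "transpose v ** p = - (transpose p ** v)"
    by (simp add: eq_neg_iff_add_eq_0 add.commute)
  then have "(transpose p ** v, v - p ** (transpose p ** v)) \<in> split_tangent p"
    by (simp add: split_tangent_def so_iff transpose_simps matrix_distribs matrix_mul_assoc orth)
  moreover have "v = join p (transpose p ** v, v - p ** (transpose p ** v))"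
    by (simp add: join_def)
  ultimately show "v \<in> join p ` split_tangent p" by blast
next
  fix v assume "v \<in> join p ` split_tangent p"
  then obtain u where u: "u \<in> split_tangent p" "v = join p u" by blast
  have "transpose v ** p = transpose (transpose p ** v)" by (simp add: transpose_simps)
  then show "v \<in> {v. transpose p ** v + transpose v ** p = 0}"
    by (simp add: u(2) transpose_mult_join[OF u(1)] split_tangentD[OF u(1)])
qed

lemma generator_join:
  assumes "u \<in> split_tangent p"
  shows "generator p (join p u) = p ** fst u ** transpose p + snd u ** transpose p - p ** transpose (snd u)"
    and "generator p (join p u) \<in> so" "generator p (join p u) ** p = join p u"
proof -
  show "generator p (join p u) = p ** fst u ** transpose p + snd u ** transpose p - p ** transpose (snd u)"
    by (simp add: generator_def join_def matrix_distribs transpose_simps matrix_mul_assoc orth_mult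
        split_tangentD[OF assms])
  have "join p u \<in> {v. transpose p ** v + transpose v ** p = 0}"
    using assms by (simp add: tangent_as_join)
  then show "generator p (join p u) \<in> so" "generator p (join p u) ** p = join p u"
    using generator_mult[OF orth] by auto
qed

text \<open>The last summand annihilates \<open>p\<close>, so it is invisible in the tangent vector
  \<open>bracket u v\<close>; but it acts on the h parts and becomes the correction term of
  \<open>nomizu_curvature\<close>.\<close>

lemma generator_commutator:
  assumes "u \<in> split_tangent p" "v \<in> split_tangent p"
  shows "generator p (join p u) ** generator p (join p v) - generator p (join p v) ** generator p (join p u)
    = generator p (join p (bracket u v)) + (snd v ** transpose (snd u) - snd u ** transpose (snd v))"
  unfolding generator_join(1)[OF assms(1)] generator_join(1)[OF assms(2)]
    generator_join(1)[OF split_tangent_bracket[OF assms]]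
  by (simp add: bracket_def matrix_distribs transpose_simps matrix_mul_assoc orth_mult
      split_tangentD[OF assms(1)] split_tangentD[OF assms(2)] algebra_simps)

end

lemma tangent_stiefel_join:
  "p \<in> stiefel \<Longrightarrow> tangent stiefel p = join p ` split_tangent p"
  by (simp add: tangent_stiefel(1) tangent_as_join stiefel_orthonormal)

section \<open>The connection as an algebraic map on pairs\<close>

context weights
begin

text \<open>The Levi-Civita connection of the left-invariant metric on SO(m) with inertia operator
  \<open>C\<close>, on left-invariant fields.\<close>

definition \<phi> :: "real^'m^'m \<Rightarrow> real^'m^'m \<Rightarrow> real^'m^'m" where
  "\<phi> W U = (1/2) *\<^sub>R (W ** U - U ** W) + \<Psi> W U"

definition nomizu :: "(real^'m^'m) \<times> (real^'m^'n::finite) \<Rightarrow> (real^'m^'m) \<times> (real^'m^'n) \<Rightarrow> (real^'m^'m) \<times> (real^'m^'n)" where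
  "nomizu u v = (\<phi> (fst u) (fst v) + (1/2) *\<^sub>R (transpose (snd v) ** snd u - transpose (snd u) ** snd v),
     snd u ** C (fst v) + snd v ** D (fst u))"

lemma \<phi>_linear:
  "\<phi> (A + B) U = \<phi> A U + \<phi> B U" "\<phi> (A - B) U = \<phi> A U - \<phi> B U" "\<phi> (a *\<^sub>R A) U = a *\<^sub>R \<phi> A U"
  "\<phi> U (A + B) = \<phi> U A + \<phi> U B" "\<phi> U (A - B) = \<phi> U A - \<phi> U B" "\<phi> U (a *\<^sub>R A) = a *\<^sub>R \<phi> U A"
  by (simp_all add: \<phi>_def \<Psi>_linear matrix_distribs algebra_simps)

lemma \<phi>_zero: "\<phi> 0 U = 0" "\<phi> U 0 = 0"
  using \<phi>_linear(3)[of 0 0 U] \<phi>_linear(6)[of U 0 0] by simp_all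

lemma \<phi>_in_so: "W \<in> so \<Longrightarrow> U \<in> so \<Longrightarrow> \<phi> W U \<in> so"
  unfolding \<phi>_def
  by (intro subspace_add[OF subspace_so] subspace_scale[OF subspace_so] commutator_in_so \<Psi>_in_so)

lemma linear_nomizu_left: "linear (\<lambda>u. nomizu u v)"
  by (rule linearI) (simp_all add: nomizu_def prod_eq_iff \<phi>_linear transpose_simps matrix_distribs
      hadamard_simps algebra_simps)

lemma linear_nomizu_right: "linear (nomizu u)"
  by (rule linearI) (simp_all add: nomizu_def prod_eq_iff \<phi>_linear transpose_simps matrix_distribs
      hadamard_simps algebra_simps)

lemma nomizu_torsion_free: "bracket u v = nomizu u v - nomizu v u"
proof -
  have half: "(1/2) *\<^sub>R (X - Y) - (1/2) *\<^sub>R (Y - X) = X - Y" for X Y :: "real^'m^'m"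
    by (simp add: algebra_simps flip: scaleR_add_left)
  have "\<phi> W U - \<phi> U W = W ** U - U ** W" for W U
    using half[of "W ** U" "U ** W"] by (simp add: \<phi>_def \<Psi>_commute[of U W])
  then show ?thesis
    using half[of "transpose (snd v) ** snd u" "transpose (snd u) ** snd v"]
    by (simp add: bracket_def nomizu_def prod_eq_iff D_eq matrix_distribs algebra_simps)
qed

lemma split_tangent_nomizu:
  assumes "transpose p ** p = mat 1" "u \<in> split_tangent p" "v \<in> split_tangent p"
  shows "nomizu u v \<in> split_tangent p"
proof -
  have "\<phi> (fst u) (fst v) \<in> so"
    using assms by (intro \<phi>_in_so) (auto simp: split_tangent_def)
  then show ?thesis
    by (simp add: nomizu_def split_tangent_def so_iff transpose_simps matrix_distribs matrix_mul_assoc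
        split_tangentD[OF assms(1,2)] split_tangentD[OF assms(1,3)] algebra_simps)
qed

lemma metric_join:
  assumes "transpose p ** p = mat 1" "u \<in> split_tangent p" "v \<in> split_tangent p"
  shows "metric p (join p u) (join p v) = fst u \<bullet> C (fst v) + snd u \<bullet> snd v"
  by (simp add: metric_def join_inner assms transpose_mult_join[OF assms(1)] D_eq inner_diff_right inner_prod_def)

text \<open>\<open>A\<close> is any skew matrix with the given value at \<open>p\<close>, because a
  commutator of generators, which is in general not canonical, has to be inserted later. The summand
  added to \<open>nomizu u v\<close> measures the part of \<open>A\<close> that fixes
  \<open>p\<close>; it vanishes for \<open>generator p (join p u)\<close>.\<close>

lemma covariant_generator:
  assumes p: "transpose p ** p = mat 1" and u: "u \<in> split_tangent p" and v: "v \<in> split_tangent p"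
    and A: "A \<in> so" "A ** p = join p u"
  shows "A ** join p v + christoffel p (A ** p) (join p v)
    = join p (nomizu u v + (0, A ** snd v + p ** (transpose (snd u) ** snd v)))"
proof -
  note sp = split_tangentD[OF p u] split_tangentD[OF p v]
  have tr: "transpose (join p u) ** join p v = - (fst u ** fst v) + transpose (snd u) ** snd v"
    "transpose (join p v) ** join p u = - (fst v ** fst u) + transpose (snd v) ** snd u"
    by (simp_all add: join_def transpose_simps matrix_distribs matrix_mul_assoc sp orth_mult[OF p])
  have "A ** join p v = join p u ** fst v + A ** snd v"
    by (simp add: join_def matrix_distribs matrix_mul_assoc A(2)[unfolded join_def])
  moreover have "join p w - p ** fst w = snd w" for w by (simp add: join_def)
  ultimately show ?thesis
    unfolding A(2) christoffel_def transpose_mult_join[OF p u] transpose_mult_join[OF p v] tr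
    by (simp add: join_def nomizu_def \<phi>_def D_eq matrix_distribs matrix_mul_assoc algebra_simps
        flip: scaleR_add_left)
qed

lemma split_tangent_covariant_generator:
  assumes p: "transpose p ** p = mat 1" and u: "u \<in> split_tangent p" and v: "v \<in> split_tangent p"
    and A: "A \<in> so" "A ** p = join p u"
  shows "nomizu u v + (0, A ** snd v + p ** (transpose (snd u) ** snd v)) \<in> split_tangent p"
proof -
  \<comment> \<open>Skewness makes \<open>A ** p\<close> determine \<open>transpose p ** A\<close>,
    although \<open>A\<close> itself is not determined.\<close>
  have "transpose p ** A = - transpose (A ** p)"
    using A(1) by (simp add: transpose_simps so_iff matmul.minus_right)
  also have "\<dots> = fst u ** transpose p - transpose (snd u)"
    by (simp add: A(2) join_def transpose_simps split_tangentD[OF p u] matrix_distribs)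
  finally have pA: "transpose p ** A = fst u ** transpose p - transpose (snd u)" .
  have "(0, A ** snd v + p ** (transpose (snd u) ** snd v)) \<in> split_tangent p"
    by (simp add: split_tangent_def subspace_0[OF subspace_so] matrix_distribs matrix_mul_assoc pA p
        split_tangentD[OF p v])
  then show ?thesis
    by (intro subspace_add[OF subspace_split_tangent] split_tangent_nomizu p u v)
qed

lemma inner_C: "A \<bullet> C B = C A \<bullet> B"
  by (simp add: inner_hadamard)

lemma \<phi>_skew:
  assumes "W \<in> so" "U \<in> so" "V \<in> so"
  shows "\<phi> W U \<bullet> C V + \<phi> W V \<bullet> C U = 0"
proof -
  \<comment> \<open>This is the Koszul formula: its right-hand side is antisymmetric in
    \<open>U\<close> and \<open>V\<close>. The factor \<open>E\<close> in \<open>\<Psi>\<close>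
    cancels \<open>C\<close>.\<close>
  have "\<phi> W U \<bullet> C V
      = (V \<bullet> (W ** C U - C U ** W) - U \<bullet> (W ** C V - C V ** W) + (V ** U - U ** V) \<bullet> C W) / 2"
    if UV: "U \<in> so" "V \<in> so" for U V
  proof -
    have "\<phi> W U \<bullet> C V = ((W ** U - U ** W) \<bullet> C V
        + (W ** C U - C U ** W) \<bullet> V + (U ** C W - C W ** U) \<bullet> V) / 2"
      by (simp add: \<phi>_def \<Psi>_def inner_add_left inner_C C_E hadamard_simps)
    moreover have "(W ** U - U ** W) \<bullet> C V = - (U \<bullet> (W ** C V - C V ** W))"
      by (rule commutator_inner[OF assms(1)])
    moreover have "(U ** C W - C W ** U) \<bullet> V = (V ** U - U ** V) \<bullet> C W"
      using commutator_inner[OF UV(1), of "C W" V] by (simp add: inner_diff_left inner_diff_right inner_commute)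
    ultimately show ?thesis by (simp add: inner_commute)
  qed
  from this[OF assms(2,3)] this[OF assms(3,2)] show ?thesis
    by (simp add: inner_diff_left)
qed

lemma covariant_generator_skew:
  assumes p: "transpose p ** p = mat 1" and u: "u \<in> split_tangent p"
    and v: "v \<in> split_tangent p" and w: "w \<in> split_tangent p"
    and A: "A \<in> so" "A ** p = join p u"
  shows "metric p (A ** join p v + christoffel p (A ** p) (join p v)) (join p w)
    + metric p (join p v) (A ** join p w + christoffel p (A ** p) (join p w)) = 0"
proof -
  have so: "fst u \<in> so" "fst v \<in> so" "fst w \<in> so" using u v w by (auto simp: split_tangent_def)
  let ?x = "\<lambda>v. nomizu u v + (0, A ** snd v + p ** (transpose (snd u) ** snd v))"
  have x: "?x v \<in> split_tangent p" "?x w \<in> split_tangent p"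
    using split_tangent_covariant_generator[OF p u _ A] v w by blast+
  have p0: "(p ** X) \<bullet> snd v = 0" if "v \<in> split_tangent p" for X v
    by (simp add: inner_matrix_mult_left split_tangentD[OF p that])
  \<comment> \<open>Exchanging \<open>v\<close> and \<open>w\<close> reverses every contribution:
    the first by \<open>\<phi>_skew\<close>, the next two as a pair, the last two because
    \<open>D (fst u)\<close> and \<open>A\<close> are skew.\<close>
  have key: "metric p (join p (?x v)) (join p w) = \<phi> (fst u) (fst v) \<bullet> C (fst w)
      - (snd v \<bullet> (snd u ** C (fst w))) + (snd w \<bullet> (snd u ** C (fst v)))
      + (snd v ** D (fst u)) \<bullet> snd w + (A ** snd v) \<bullet> snd w"
    if v: "v \<in> split_tangent p" and w: "w \<in> split_tangent p" for v w
  proof -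
    have "fst w \<in> so" using w by (simp add: split_tangent_def)
    then have "(transpose (snd v) ** snd u - transpose (snd u) ** snd v) \<bullet> C (fst w)
        = - 2 * (snd v \<bullet> (snd u ** C (fst w)))"
      using so_inner_transpose[OF hadamard_in_so(1), of "fst w" "transpose (snd u) ** snd v"]
      by (simp add: inner_diff_left transpose_simps inner_matrix_mult_left)
    then show ?thesis
      unfolding metric_join[OF p split_tangent_covariant_generator[OF p u v A] w]
      using p0[OF w] by (simp add: nomizu_def inner_add_left inner_add_right inner_commute)
  qed
  have "metric p (join p v) (join p (?x w)) = metric p (join p (?x w)) (join p v)"
    unfolding metric_join[OF p v x(2)] metric_join[OF p x(2) v]
    by (simp add: inner_commute[of "fst v"] inner_commute[of "snd v"] inner_hadamard)
  then show ?thesis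
    unfolding covariant_generator[OF p u v A] covariant_generator[OF p u w A] key[OF v w]
    using key[OF w v] \<phi>_skew[OF so] inner_so_mult_left[OF A(1), of "snd v" "snd w"]
      inner_so_mult_right[OF hadamard_in_so(2)[OF so(1)], of "snd v" "snd w"]
    by (simp add: inner_commute)
qed

text \<open>Differentiating the linear condition for \<open>Y q\<close> to be tangent along
  \<open>A ** p\<close>, the terms with \<open>A\<close> cancel, and the Lie derivative satisfies
  the same condition at \<open>p\<close>.\<close>

lemma tangent_lie_derivative:
  fixes p :: "real^'m^('m + 'l::finite)"
  assumes p: "p \<in> stiefel" and A: "A \<in> so" and Y: "vector_field stiefel Y"
  shows "diff stiefel Y p (A ** p) - A ** Y p \<in> tangent stiefel p"
proof -
  let ?y = "diff stiefel Y p (A ** p)"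
  have t: "A ** p \<in> tangent stiefel p" using tangent_stiefel(2)[OF p] A by blast
  have Yd: "has_directional_derivative stiefel p (A ** p) Y ?y"
    using Y p by (simp add: vector_field_def smooth_map_has_directional_derivative)
  have "has_directional_derivative stiefel p (A ** p) (\<lambda>q. transpose q ** Y q + transpose (Y q) ** q)
      (transpose p ** (?y - A ** Y p) + transpose (?y - A ** Y p) ** p)"
    using has_directional_derivative_add[OF derivative_transpose_base[OF A Yd]
        derivative_transpose_mult[OF A Yd has_directional_derivative_ident]]
    by (simp add: matrix_distribs)
  from has_directional_derivative_diff[OF t this]
  have "diff stiefel (\<lambda>q. transpose q ** Y q + transpose (Y q) ** q) p (A ** p)
      = transpose p ** (?y - A ** Y p) + transpose (?y - A ** Y p) ** p" .
  moreover have "((\<lambda>q. transpose q ** Y q + transpose (Y q) ** q) has_derivative (\<lambda>u. 0)) (at p within stiefel)"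
    by (rule has_derivative_transform[OF p _ has_derivative_const[of 0]])
       (use Y tangent_stiefel(1) in \<open>auto simp: vector_field_def\<close>)
  from diff_eqI[OF t this]
  have "diff stiefel (\<lambda>q. transpose q ** Y q + transpose (Y q) ** q) p (A ** p) = 0" .
  ultimately show ?thesis by (simp add: tangent_stiefel(1)[OF p])
qed

lemma homogeneous_metric_stiefel:
  "homogeneous_metric (stiefel :: (real^'m^('m + 'l::finite)) set) ((\<lambda>A X. A ** X) ` so) christoffel metric"
proof (rule homogeneous_metric.intro, goal_cases)
  case (1 A)
  then show ?case using matmul.bounded_linear_right by blast
next
  case (2 p)
  then show ?case by (simp add: tangent_stiefel(2) image_image)
next
  case (3 p)
  then show ?case
    by (simp add: tangent_stiefel_join linear_subspace_image[OF linear_join subspace_split_tangent])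
next
  case (4 p)
  show ?case by (rule bilinear_christoffel)
next
  case (5 p u v)
  show ?case by (rule christoffel_commute)
next
  case (6 X Y)
  then show ?case by (rule smooth_map_christoffel)
next
  case (7 A p Y Z y z)
  then show ?case using derivative_christoffel by blast
next
  case (8 A p v)
  then obtain A' u w where A: "A = (\<lambda>X. A' ** X)" "A' \<in> so" and u: "u \<in> split_tangent p" "A' ** p = join p u"
    and w: "w \<in> split_tangent p" "v = join p w"
    using tangent_stiefel(2)[OF 8(2)] tangent_stiefel_join[OF 8(2)] by blast
  show ?case
    using covariant_generator[OF stiefel_orthonormal[OF 8(2)] u(1) w(1) A(2) u(2)]
      split_tangent_covariant_generator[OF stiefel_orthonormal[OF 8(2)] u(1) w(1) A(2) u(2)]
    by (simp add: A(1) w(2) tangent_stiefel_join[OF 8(2)])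
next
  case (9 A p Y)
  then show ?case using tangent_lie_derivative by blast
next
  case (10 p)
  show ?case by (rule bilinear_metric)
next
  case (11 A p Y Z y z)
  then show ?case using derivative_metric by blast
next
  case (12 A p v v')
  then obtain A' w w' where A: "A = (\<lambda>X. A' ** X)" "A' \<in> so"
    and w: "w \<in> split_tangent p" "v = join p w" "w' \<in> split_tangent p" "v' = join p w'"
    unfolding tangent_stiefel_join[OF 12(2)] by blast
  have "A' ** p \<in> join p ` split_tangent p"
    using A(2) tangent_stiefel(2)[OF 12(2)] tangent_stiefel_join[OF 12(2)] by blast
  then obtain u where u: "u \<in> split_tangent p" "A' ** p = join p u" by blast
  show ?case
    using covariant_generator_skew[OF stiefel_orthonormal[OF 12(2)] u(1) w(1,3) A(2) u(2)]
    by (simp add: A(1) w)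
qed

end

section \<open>Curvature at an arbitrary point\<close>

context weights
begin

definition nomizu_curvature ::
  "(real^'m^'m) \<times> (real^'m^'n::finite) \<Rightarrow> (real^'m^'m) \<times> (real^'m^'n) \<Rightarrow> (real^'m^'m) \<times> (real^'m^'n)
    \<Rightarrow> (real^'m^'m) \<times> (real^'m^'n)" where
  "nomizu_curvature u v w = nomizu u (nomizu v w) - nomizu v (nomizu u w) - nomizu (bracket u v) w
     - (0, snd v ** (transpose (snd u) ** snd w) - snd u ** (transpose (snd v) ** snd w))"

abbreviation levi_civita_connection :: "(real^'m^('m + 'l::finite)) connection" where
  "levi_civita_connection \<equiv> homogeneous_metric.covariant_derivative stiefel christoffel"

lemma linear_nomizu_curvature: "linear (\<lambda>u. nomizu_curvature u v w)"
proof -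
  have "linear (\<lambda>u. nomizu u (nomizu v w))" by (rule linear_nomizu_left)
  moreover have "linear (\<lambda>u. nomizu v (nomizu u w))"
    using linear_compose[OF linear_nomizu_left linear_nomizu_right, unfolded o_def] .
  moreover have "linear (\<lambda>u. bracket u v)"
    unfolding nomizu_torsion_free by (intro linear_compose_sub linear_nomizu_left linear_nomizu_right)
  then have "linear (\<lambda>u. nomizu (bracket u v) w)"
    using linear_compose[OF _ linear_nomizu_left, unfolded o_def] by blast
  moreover have "linear (\<lambda>u. (0 :: real^'m^'m, snd v ** (transpose (snd u) ** snd w)
      - snd u ** (transpose (snd v) ** snd w)))"
    by (rule linearI) (simp_all add: transpose_simps matrix_distribs algebra_simps)
  ultimately show ?thesis
    unfolding nomizu_curvature_def by (intro linear_compose_sub)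
qed

lemma split_tangent_nomizu_curvature:
  assumes "transpose p ** p = mat 1" "u \<in> split_tangent p" "v \<in> split_tangent p" "w \<in> split_tangent p"
  shows "nomizu_curvature u v w \<in> split_tangent p"
proof -
  have "(0, snd v ** (transpose (snd u) ** snd w) - snd u ** (transpose (snd v) ** snd w)) \<in> split_tangent p"
    by (simp add: split_tangent_def subspace_0[OF subspace_so] matrix_distribs matrix_mul_assoc
        split_tangentD[OF assms(1,2)] split_tangentD[OF assms(1,3)])
  then show ?thesis
    unfolding nomizu_curvature_def
    by (intro subspace_diff[OF subspace_split_tangent] split_tangent_nomizu split_tangent_bracket assms)
qed

lemma curvature_stiefel:
  fixes p :: "real^'m^('m + 'l::finite)"
  assumes "vector_field stiefel X" "vector_field stiefel Y" "vector_field stiefel Z" and p: "p \<in> stiefel"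
    and u: "u \<in> split_tangent p" "X p = join p u" and v: "v \<in> split_tangent p" "Y p = join p v"
    and w: "w \<in> split_tangent p" "Z p = join p w"
  shows "curvature stiefel levi_civita_connection X Y Z p = join p (nomizu_curvature u v w)"
proof -
  interpret homogeneous_metric "stiefel :: (real^'m^('m + 'l)) set" "(\<lambda>A X. A ** X) ` so" christoffel metric
    by (rule homogeneous_metric_stiefel)
  note orth = stiefel_orthonormal[OF p]
  let ?A = "generator p (join p u)" and ?B = "generator p (join p v)"
  let ?K = "snd v ** transpose (snd u) - snd u ** transpose (snd v)"
  have \<Lambda>: "\<Lambda> p (\<lambda>X. generator p (join p u) ** X) (join p v) = join p (nomizu u v)"
    if "u \<in> split_tangent p" "v \<in> split_tangent p" for u v
  proof -
    \<comment> \<open>The canonical generator maps the orthogonal complement of the columns of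
      \<open>p\<close> into their span, so the correction in \<open>covariant_generator\<close>
      disappears.\<close>
    have "generator p (join p u) ** snd v + p ** (transpose (snd u) ** snd v) = 0"
      unfolding generator_join(1)[OF orth that(1)]
      by (simp add: matrix_distribs matrix_mul_assoc split_tangentD[OF orth that(2)])
    then show ?thesis
      using covariant_generator[OF orth that generator_join(2,3)[OF orth that(1)]]
      by (simp add: \<Lambda>_def zero_prod_def[symmetric])
  qed
  have com: "?A ** ?B - ?B ** ?A = generator p (join p (bracket u v)) + ?K"
    by (rule generator_commutator[OF orth u(1) v(1)])
  have br: "bracket u v \<in> split_tangent p"
    by (rule split_tangent_bracket[OF orth u(1) v(1)])
  have "(?A ** ?B - ?B ** ?A) ** p = join p (bracket u v)"
    unfolding com using generator_join(3)[OF orth br]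
    by (simp add: matrix_distribs matrix_mul_assoc split_tangentD[OF orth u(1)] split_tangentD[OF orth v(1)])
  moreover have "?A ** ?B - ?B ** ?A \<in> so"
    by (intro commutator_in_so generator_join orth u v)
  \<comment> \<open>For the commutator the correction survives as \<open>?K\<close>, since it agrees
    with the generator of \<open>bracket u v\<close> at \<open>p\<close> only up to a matrix
    annihilating \<open>p\<close>.\<close>
  moreover have "(?A ** ?B - ?B ** ?A) ** snd w + p ** (transpose (snd (bracket u v)) ** snd w) = ?K ** snd w"
    unfolding com generator_join(1)[OF orth br]
    by (simp add: matrix_distribs matrix_mul_assoc split_tangentD[OF orth w(1)])
  ultimately have "\<Lambda> p (\<lambda>X. ?A ** (?B ** X) - ?B ** (?A ** X)) (join p w)
      = join p (nomizu (bracket u v) w + (0, ?K ** snd w))"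
    using covariant_generator[OF orth br w(1), of "?A ** ?B - ?B ** ?A"]
    by (simp add: \<Lambda>_def matrix_mul_assoc matrix_distribs)
  moreover have "curvature stiefel levi_civita_connection X Y Z p =
      \<Lambda> p (\<lambda>X. ?A ** X) (\<Lambda> p (\<lambda>X. ?B ** X) (Z p)) - \<Lambda> p (\<lambda>X. ?B ** X) (\<Lambda> p (\<lambda>X. ?A ** X) (Z p))
      - \<Lambda> p (\<lambda>X. ?A ** (?B ** X) - ?B ** (?A ** X)) (Z p)"
    by (rule curvature_eq[OF assms(1-3) p])
       (use generator_join(2,3)[OF orth u(1)] generator_join(2,3)[OF orth v(1)] u v in auto)
  ultimately show ?thesis
    unfolding w(2) \<Lambda>[OF u(1) w(1)] \<Lambda>[OF v(1) w(1)]
      \<Lambda>[OF u(1) split_tangent_nomizu[OF orth v(1) w(1)]] \<Lambda>[OF v(1) split_tangent_nomizu[OF orth u(1) w(1)]]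
    by (simp add: nomizu_curvature_def linear_diff[OF linear_join] linear_add[OF linear_join]
        matrix_distribs matrix_mul_assoc algebra_simps)
qed

end

section \<open>Ricci curvature\<close>

text \<open>The orthogonal projection of \<open>unit_matrix i j\<close> to the skew matrices.
  Projecting an orthonormal basis gives a Parseval frame, so all ordered pairs are used and the
  index type needs no order.\<close>

definition skew_unit :: "'a::finite \<Rightarrow> 'a \<Rightarrow> real^'a^'a" where
  "skew_unit i j = (1/2) *\<^sub>R (unit_matrix i j - unit_matrix j i)"

definition split_frame :: "real^'m^'n \<Rightarrow> ('m::finite \<times> 'm) + ('n::finite \<times> 'm) \<Rightarrow> (real^'m^'m) \<times> (real^'m^'n)" where
  "split_frame p i = (case i of Inl (i, j) \<Rightarrow> (skew_unit i j, 0)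
     | Inr (a, j) \<Rightarrow> (0, unit_matrix a j - p ** (transpose p ** unit_matrix a j)))"

definition so_trace :: "(real^'a^'a \<Rightarrow> real^'a^'a) \<Rightarrow> real" where
  "so_trace L = (\<Sum>i\<in>UNIV. \<Sum>j\<in>UNIV. L (skew_unit i j) \<bullet> skew_unit i j)"

definition horizontal_trace :: "real^'m^'n \<Rightarrow> (real^'m^'n \<Rightarrow> real^'m^'n) \<Rightarrow> real" where
  "horizontal_trace p L = (\<Sum>a\<in>UNIV. \<Sum>j\<in>UNIV.
     L (unit_matrix a j - p ** (transpose p ** unit_matrix a j))
       \<bullet> (unit_matrix a j - p ** (transpose p ** unit_matrix a j)))"

definition frame_trace :: "real^'m^'n::finite \<Rightarrow> ((real^'m^'m) \<times> (real^'m^'n) \<Rightarrow> (real^'m^'m) \<times> (real^'m^'n)) \<Rightarrow> real" where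
  "frame_trace p F = (\<Sum>i\<in>UNIV. F (split_frame p i) \<bullet> split_frame p i)"

lemma sum_UNIV_prod: "(\<Sum>x\<in>UNIV. f x) = (\<Sum>i\<in>UNIV. \<Sum>j\<in>UNIV. f (i, j))"
  for f :: "'a::finite \<times> 'b::finite \<Rightarrow> 'c::comm_monoid_add"
  unfolding sum.cartesian_product by (rule sum.cong) auto

lemma inner_unit_matrix: "A \<bullet> unit_matrix i j = A $ i $ j"
proof -
  have "A $ a $ b * (if a = i \<and> b = j then 1 else 0) = (if b = j then if a = i then A $ a $ b else 0 else 0)" for a b
    by simp
  then show ?thesis by (simp add: inner_matrix unit_matrix_def)
qed

lemma inner_skew_unit: "A \<bullet> skew_unit i j = (A $ i $ j - A $ j $ i) / 2"
  by (simp add: skew_unit_def inner_diff_right inner_unit_matrix)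

lemma skew_unit_in_so: "skew_unit i j \<in> so"
  by (simp add: skew_unit_def so_iff transpose_simps transpose_unit_matrix algebra_simps)

lemma skew_unit_frame:
  assumes "A \<in> so"
  shows "(\<Sum>i\<in>UNIV. \<Sum>j\<in>UNIV. (A \<bullet> skew_unit i j) *\<^sub>R skew_unit i j) = A"
proof -
  have "A \<bullet> skew_unit i j = A $ i $ j" for i j
    using so_component[OF assms, of j i] by (simp add: inner_skew_unit)
  then have "(\<Sum>i\<in>UNIV. \<Sum>j\<in>UNIV. (A \<bullet> skew_unit i j) *\<^sub>R skew_unit i j)
      = (1/2) *\<^sub>R (\<Sum>i\<in>UNIV. \<Sum>j\<in>UNIV. A $ i $ j *\<^sub>R unit_matrix i j)
        - (1/2) *\<^sub>R transpose (\<Sum>i\<in>UNIV. \<Sum>j\<in>UNIV. A $ i $ j *\<^sub>R unit_matrix i j)"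
    by (simp add: skew_unit_def linear_sum[OF linear_transpose] transpose_simps transpose_unit_matrix
        scaleR_diff_right sum_subtractf scaleR_sum_right mult.commute)
  also have "\<dots> = A"
    unfolding matrix_sum_unit using assms by (simp add: so_iff flip: scaleR_add_left)
  finally show ?thesis .
qed

lemma frame_trace_split:
  "frame_trace p F = so_trace (\<lambda>W. fst (F (W, 0))) + horizontal_trace p (\<lambda>h. snd (F (0, h)))"
  unfolding frame_trace_def sum_UNIV_Plus sum_UNIV_prod
  by (simp add: split_frame_def so_trace_def horizontal_trace_def inner_prod_def)

context
  fixes p :: "real^'m^'n::finite"
  assumes orth: "transpose p ** p = mat 1"
begin

lemma split_frame_in: "split_frame p i \<in> split_tangent p"
  by (cases i) (auto simp: split_frame_def split_tangent_def skew_unit_in_so subspace_0[OF subspace_so]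
      matrix_distribs matrix_mul_assoc orth)

lemma inner_horizontal_unit:
  assumes "transpose p ** X = 0"
  shows "X \<bullet> (unit_matrix a j - p ** (transpose p ** unit_matrix a j)) = X $ a $ j"
proof -
  have "X \<bullet> (p ** Y) = (transpose p ** X) \<bullet> Y" for Y
    using inner_matrix_mult_left[of p Y X] by (simp add: inner_commute)
  then show ?thesis using assms by (simp add: inner_diff_right inner_unit_matrix)
qed

lemma split_frame_frame:
  assumes u: "u \<in> split_tangent p"
  shows "(\<Sum>i\<in>UNIV. (u \<bullet> split_frame p i) *\<^sub>R split_frame p i) = u"
proof -
  have so: "fst u \<in> so" using u by (simp add: split_tangent_def)
  have "(\<Sum>a\<in>UNIV. \<Sum>j\<in>UNIV. (snd u $ a $ j) *\<^sub>R (unit_matrix a j - p ** (transpose p ** unit_matrix a j)))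
     = (\<Sum>a\<in>UNIV. \<Sum>j\<in>UNIV. (snd u $ a $ j) *\<^sub>R unit_matrix a j)
       - p ** (transpose p ** (\<Sum>a\<in>UNIV. \<Sum>j\<in>UNIV. (snd u $ a $ j) *\<^sub>R unit_matrix a j))"
    by (simp add: scaleR_diff_right sum_subtractf matmul.sum_right matmul.scaleR_right)
  also have "\<dots> = snd u"
    by (simp add: matrix_sum_unit split_tangentD[OF orth u])
  finally have "(\<Sum>a\<in>UNIV. \<Sum>j\<in>UNIV. (snd u \<bullet> snd (split_frame p (Inr (a, j)))) *\<^sub>R split_frame p (Inr (a, j)))
      = (0, snd u)"
    by (simp add: split_frame_def inner_horizontal_unit split_tangentD[OF orth u] prod_eq_iff fst_sum snd_sum)
  moreover have "(\<Sum>i\<in>UNIV. \<Sum>j\<in>UNIV. (fst u \<bullet> skew_unit i j) *\<^sub>R (skew_unit i j, 0 :: real^'m^'n)) = (fst u, 0)"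
    using skew_unit_frame[OF so] by (simp add: prod_eq_iff fst_sum snd_sum)
  ultimately show ?thesis
    unfolding sum_UNIV_Plus sum_UNIV_prod
    by (simp add: split_frame_def inner_prod_def prod_eq_iff)
qed

text \<open>The frame reproduces only vectors of \<open>split_tangent p\<close>, so both maps have
  to preserve that space before one can be expanded through the other.\<close>

lemma frame_trace_commute:
  assumes "linear F" "linear G"
    and "\<And>u. u \<in> split_tangent p \<Longrightarrow> F u \<in> split_tangent p" "\<And>u. u \<in> split_tangent p \<Longrightarrow> G u \<in> split_tangent p"
  shows "frame_trace p (\<lambda>u. F (G u)) = frame_trace p (\<lambda>u. G (F u))"
proof -
  let ?e = "split_frame p"
  have expand: "F (G (?e i)) \<bullet> ?e i = (\<Sum>j\<in>UNIV. (G (?e i) \<bullet> ?e j) * (F (?e j) \<bullet> ?e i))"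
    if "linear F" "\<And>u. u \<in> split_tangent p \<Longrightarrow> G u \<in> split_tangent p" for F G and i
  proof -
    have "F (\<Sum>j\<in>UNIV. (G (?e i) \<bullet> ?e j) *\<^sub>R ?e j) \<bullet> ?e i = (\<Sum>j\<in>UNIV. (G (?e i) \<bullet> ?e j) * (F (?e j) \<bullet> ?e i))"
      by (simp add: linear_sum[OF that(1)] linear_cmul[OF that(1)] inner_sum_left)
    then show ?thesis using split_frame_frame[OF that(2)[OF split_frame_in]] by simp
  qed
  have "frame_trace p (\<lambda>u. F (G u)) = (\<Sum>i\<in>UNIV. \<Sum>j\<in>UNIV. (G (?e i) \<bullet> ?e j) * (F (?e j) \<bullet> ?e i))"
    unfolding frame_trace_def by (rule sum.cong[OF refl expand[OF assms(1,4)]])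
  also have "\<dots> = (\<Sum>i\<in>UNIV. \<Sum>j\<in>UNIV. (F (?e i) \<bullet> ?e j) * (G (?e j) \<bullet> ?e i))"
    by (subst sum.swap) (simp add: mult.commute)
  also have "\<dots> = frame_trace p (\<lambda>u. G (F u))"
    unfolding frame_trace_def by (rule sum.cong[OF refl expand[OF assms(2,3), symmetric]])
  finally show ?thesis .
qed

end

lemma frame_trace_diff: "frame_trace p (\<lambda>u. F u - G u) = frame_trace p F - frame_trace p G"
  by (simp add: frame_trace_def inner_diff_left sum_subtractf)

context weights
begin

lemma ricci_stiefel_frame:
  fixes p :: "real^'m^('m + 'l::finite)"
  assumes "vector_field stiefel Y" "vector_field stiefel Z" and p: "p \<in> stiefel"
    and v: "v \<in> split_tangent p" "Y p = join p v" and w: "w \<in> split_tangent p" "Z p = join p w"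
  shows "ricci stiefel levi_civita_connection Y Z p = frame_trace p (\<lambda>u. nomizu_curvature u v w)"
proof -
  interpret homogeneous_metric "stiefel :: (real^'m^('m + 'l)) set" "(\<lambda>A X. A ** X) ` so" christoffel metric
    by (rule homogeneous_metric_stiefel)
  note orth = stiefel_orthonormal[OF p]
  define split :: "real^'m^('m + 'l) \<Rightarrow> _" where
    "split x = (transpose p ** x, x - p ** (transpose p ** x))" for x
  have "linear split"
    unfolding split_def by (rule linearI) (simp_all add: matrix_distribs algebra_simps)
  have split_join: "split (join p u) = u" if "u \<in> split_tangent p" for u
    using transpose_mult_join[OF orth that] by (simp add: split_def join_def prod_eq_iff)
  let ?f = "\<lambda>x. curvature stiefel levi_civita_connection (extension stiefel p x) Y Z p"
  \<comment> \<open>\<open>?f\<close> is tied to a chosen extension and is controlled only on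
    tangent vectors; \<open>?L\<close> is linear on the whole ambient space.\<close>
  let ?L = "\<lambda>x. join p (nomizu_curvature (split x) v w)"
  have f: "?f (join p u) = join p (nomizu_curvature u v w)" if "u \<in> split_tangent p" for u
  proof -
    have "join p u \<in> tangent stiefel p" using that by (simp add: tangent_stiefel_join[OF p])
    from extension_tangent[OF p this] show ?thesis
      by (intro curvature_stiefel assms that)
  qed
  have "ricci stiefel levi_civita_connection Y Z p
      = (\<Sum>i\<in>UNIV. ?f (join p (split_frame p i)) \<bullet> join p (split_frame p i))"
    unfolding ricci_def
  proof (rule trace_on_frame[where L = ?L])
    show "subspace (tangent stiefel p)" by (rule subspace_tangent[OF p])
    show "linear ?L"
      using linear_compose[OF linear_compose[OF \<open>linear split\<close> linear_nomizu_curvature] linear_join]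
      by (simp add: o_def)
    fix x assume "x \<in> tangent stiefel p"
    then obtain u where u: "u \<in> split_tangent p" "x = join p u" by (auto simp: tangent_stiefel_join[OF p])
    show "?f x = ?L x \<and> ?L x \<in> tangent stiefel p"
      using f[OF u(1)] u split_tangent_nomizu_curvature[OF orth u(1) v(1) w(1)]
      by (simp add: split_join tangent_stiefel_join[OF p])
    have "(\<Sum>i\<in>UNIV. (x \<bullet> join p (split_frame p i)) *\<^sub>R join p (split_frame p i))
        = join p (\<Sum>i\<in>UNIV. (u \<bullet> split_frame p i) *\<^sub>R split_frame p i)"
      using u by (simp add: join_inner[OF orth u(1) split_frame_in[OF orth]] linear_sum[OF linear_join] linear_cmul[OF linear_join])
    then show "(\<Sum>i\<in>UNIV. (x \<bullet> join p (split_frame p i)) *\<^sub>R join p (split_frame p i)) = x"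
      by (simp add: split_frame_frame[OF orth u(1)] u(2))
  next
    fix i show "join p (split_frame p i) \<in> tangent stiefel p"
      by (simp add: tangent_stiefel_join[OF p] split_frame_in[OF orth])
  qed simp
  then show ?thesis
    by (simp add: frame_trace_def f split_frame_in[OF orth] join_inner[OF orth]
        split_tangent_nomizu_curvature[OF orth _ v(1) w(1)])
qed

end

section \<open>Traces over the skew part\<close>

lemma so_trace_add: "so_trace (\<lambda>W. F W + G W) = so_trace F + so_trace G"
  by (simp add: so_trace_def inner_add_left sum.distrib)

lemma matrix_mult_component: "(A ** B) $ i $ j = (\<Sum>k\<in>UNIV. A $ i $ k * B $ k $ j)"
  by (simp add: matrix_matrix_mult_def)

lemma skew_unit_component:
  "skew_unit i j $ a $ b = ((if a = i \<and> b = j then 1 else 0) - (if a = j \<and> b = i then 1 else 0)) / 2"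
  by (simp add: skew_unit_def unit_matrix_def)

lemma mult_unit_matrix_component: "(A ** unit_matrix a j) $ b $ k = (if k = j then A $ b $ a else 0)"
proof -
  have "A $ b $ r * (if r = a \<and> k = j then 1 else 0) = (if r = a then if k = j then A $ b $ r else 0 else 0)" for r
    by simp
  then show ?thesis by (simp add: matrix_mult_component unit_matrix_def)
qed

lemma unit_matrix_mult_component: "(unit_matrix j a ** A) $ k $ b = (if k = j then A $ a $ b else 0)"
proof -
  have "(if k = j \<and> r = a then 1 else 0) * A $ r $ b = (if r = a then if k = j then A $ r $ b else 0 else 0)" for r
    by simp
  then show ?thesis by (simp add: matrix_mult_component unit_matrix_def)
qed

context weights
begin

text \<open>Twice the coefficient of \<open>W $ i $ k * U $ k $ j\<close> in
  \<open>\<phi> W U $ i $ j\<close>: the commutator contributes 1 and \<open>\<Psi>\<close>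
  contributes \<open>(c k j - c i k) / c i j\<close>.\<close>

definition structure_weight :: "'m \<Rightarrow> 'm \<Rightarrow> 'm \<Rightarrow> real" where
  "structure_weight i k j = (c i j + c k j - c i k) / c i j"

text \<open>
  The Ricci curvature of the left-invariant metric on \<open>SO(m)\<close> with weights \<open>c\<close> in the direction of the
  matrix entry \<open>(j, k)\<close>.
\<close>

definition group_ricci :: "'m \<Rightarrow> 'm \<Rightarrow> real" where
  "group_ricci j k = (\<Sum>i\<in>- {j, k}. ((c j k)\<^sup>2 - (c i j - c i k)\<^sup>2) / (c i j * c i k)) / 4"

lemma \<phi>_component:
  "\<phi> W U $ i $ j = (\<Sum>k\<in>UNIV. W $ i $ k * U $ k $ j * structure_weight i k j
     - U $ i $ k * W $ k $ j * structure_weight j k i) / 2"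
proof -
  have "c i j \<noteq> 0" using c_pos[of i j] by simp
  then have "(W $ i $ k * U $ k $ j * structure_weight i k j - U $ i $ k * W $ k $ j * structure_weight j k i)
    = W $ i $ k * U $ k $ j - U $ i $ k * W $ k $ j
      + (W $ i $ k * (c k j * U $ k $ j) - c i k * U $ i $ k * W $ k $ j
         + (U $ i $ k * (c k j * W $ k $ j) - c i k * W $ i $ k * U $ k $ j)) / c i j" for k
    unfolding structure_weight_def c_commute[of j i] c_commute[of k i] c_commute[of j k]
    by (simp add: field_simps)
  then show ?thesis
    by (simp add: \<phi>_def \<Psi>_def matrix_mult_component hadamard_component sum_subtractf sum.distrib
        sum_divide_distrib[symmetric] add_divide_distrib diff_divide_distrib)
qed

lemma \<phi>_skew_unit_component:
  assumes U: "U \<in> so"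
  shows "\<phi> (skew_unit i j) U $ i $ k
    = ((if i = j then 0 else U $ j $ k * structure_weight i j k)
       + (if k = i then U $ i $ j * structure_weight i j i else 0)) / 4"
proof (cases "i = j")
  case True
  then show ?thesis using so_diagonal[OF U] by (simp add: skew_unit_def \<phi>_zero)
next
  case False
  have 1: "skew_unit i j $ i $ r * U $ r $ k * structure_weight i r k
      = (if r = j then U $ r $ k * structure_weight i r k / 2 else 0)" for r
    using False by (simp add: skew_unit_component)
  have 2: "U $ i $ r * skew_unit i j $ r $ k * structure_weight k r i
      = (if r = j then if k = i then - (U $ i $ r * structure_weight k r i) / 2 else 0 else 0)" for r
    using False so_diagonal[OF U, of i] by (auto simp: skew_unit_component)
  show ?thesis
    unfolding \<phi>_component sum_subtractf 1 2 using False
    by (simp only: sum.delta finite UNIV_I if_True if_False, cases "k = i")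
       (simp_all only: if_True if_False simp_thms, simp_all)
qed

text \<open>Unimodularity: the entry (i, j) of \<open>\<phi> (skew_unit i j) U\<close> involves only
  diagonal entries of \<open>U\<close>.\<close>

lemma so_trace_\<phi>:
  assumes "U \<in> so"
  shows "so_trace (\<lambda>W. \<phi> W U) = 0"
proof -
  have "\<phi> (skew_unit i j) U $ i $ j = 0" for i j
    using so_diagonal[OF assms] by (simp add: \<phi>_skew_unit_component[OF assms])
  moreover have "\<phi> (skew_unit i j) U $ j $ i = 0" for i j
    using so_component[of "\<phi> (skew_unit i j) U" j i, OF \<phi>_in_so[OF skew_unit_in_so assms]] calculation[of i j]
    by simp
  ultimately show ?thesis by (simp add: so_trace_def inner_skew_unit)
qed

text \<open>The two sums produced by \<open>\<phi>_component\<close> are opposite after exchanging i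
  and j, so one sum over row i of the inner matrix remains. There the two structure weights multiply
  to a difference of squares over \<open>c i j * c i k\<close>, the summand of
  \<open>group_ricci\<close>.\<close>

lemma so_trace_\<phi>_\<phi>:
  assumes U: "U \<in> so" and V: "V \<in> so"
  shows "so_trace (\<lambda>W. \<phi> (\<phi> W U) V) = - (\<Sum>j\<in>UNIV. \<Sum>k\<in>UNIV. group_ricci j k * U $ j $ k * V $ j $ k)"
proof -
  let ?t = "\<lambda>i j. \<phi> (skew_unit i j) U" and ?q = structure_weight
  have so: "?t i j \<in> so" for i j by (intro \<phi>_in_so skew_unit_in_so U)
  have swap: "?t j i = - ?t i j" for i j
  proof -
    have "skew_unit j i = - skew_unit i j" by (simp add: skew_unit_def algebra_simps)
    then show ?thesis using \<phi>_linear(3)[of "-1" "skew_unit i j" U] by simp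
  qed
  let ?S = "\<Sum>i\<in>UNIV. \<Sum>j\<in>UNIV. \<Sum>k\<in>UNIV. ?t i j $ i $ k * V $ k $ j * ?q i k j"
  have "\<phi> (?t i j) V \<bullet> skew_unit i j = \<phi> (?t i j) V $ i $ j" for i j
    using so_component[of "\<phi> (?t i j) V" j i, OF \<phi>_in_so[OF so V]] by (simp add: inner_skew_unit)
  then have "so_trace (\<lambda>W. \<phi> (\<phi> W U) V) = (\<Sum>i\<in>UNIV. \<Sum>j\<in>UNIV. \<phi> (?t i j) V $ i $ j)"
    by (simp add: so_trace_def)
  also have "\<dots> = (?S - (\<Sum>i\<in>UNIV. \<Sum>j\<in>UNIV. \<Sum>k\<in>UNIV. V $ i $ k * ?t i j $ k $ j * ?q j k i)) / 2"
    unfolding \<phi>_component[of "?t _ _"] by (simp add: sum_subtractf sum_divide_distrib[symmetric])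
  also have "(\<Sum>i\<in>UNIV. \<Sum>j\<in>UNIV. \<Sum>k\<in>UNIV. V $ i $ k * ?t i j $ k $ j * ?q j k i) = - ?S"
  proof -
    have "V $ j $ k * ?t j i $ k $ i * ?q i k j = - (?t i j $ i $ k * V $ k $ j * ?q i k j)" for i j k
      using so_component[OF V, of j k] so_component[of "?t i j" k i, OF so] by (simp add: swap[of j i])
    then show ?thesis
      by (subst sum.swap) (simp add: sum_negf)
  qed
  also have "(?S - - ?S) / 2 = ?S" by simp
  also have "?S = (\<Sum>i\<in>UNIV. \<Sum>j\<in>UNIV. \<Sum>k\<in>UNIV.
      - (if i = j \<or> i = k then 0 else U $ j $ k * V $ j $ k * (?q i k j * ?q i j k) / 4))"
  proof -
    have "(\<Sum>k\<in>UNIV. ?t i j $ i $ k * V $ k $ j * ?q i k j)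
      = (\<Sum>k\<in>UNIV. - (if i = j \<or> i = k then 0 else U $ j $ k * V $ j $ k * (?q i k j * ?q i j k) / 4))" for i j
    proof -
      have "?t i j $ i $ k * V $ k $ j * ?q i k j
          = - (if i = j \<or> i = k then 0 else U $ j $ k * V $ j $ k * (?q i k j * ?q i j k) / 4)" for k
        using so_component[OF V, of k j] so_component[OF U, of i j] so_diagonal[OF U]
        by (cases "i = j"; cases "k = i") (auto simp: \<phi>_skew_unit_component[OF U] algebra_simps)
      then show ?thesis by simp
    qed
    then show ?thesis by simp
  qed
  also have "\<dots> = - (\<Sum>j\<in>UNIV. \<Sum>k\<in>UNIV. \<Sum>i\<in>UNIV.
      if i = j \<or> i = k then 0 else U $ j $ k * V $ j $ k * (?q i k j * ?q i j k) / 4)"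
    by (subst sum.swap) (simp add: sum_negf, subst (2) sum.swap, rule refl)
  also have "(\<Sum>j\<in>UNIV. \<Sum>k\<in>UNIV. \<Sum>i\<in>UNIV.
      if i = j \<or> i = k then 0 else U $ j $ k * V $ j $ k * (?q i k j * ?q i j k) / 4)
      = (\<Sum>j\<in>UNIV. \<Sum>k\<in>UNIV. group_ricci j k * U $ j $ k * V $ j $ k)"
  proof (intro sum.cong refl)
    fix j k
    have "?q i k j * ?q i j k = ((c j k)\<^sup>2 - (c i j - c i k)\<^sup>2) / (c i j * c i k)" for i
      unfolding structure_weight_def c_commute[of k j] by (simp add: power2_eq_square algebra_simps)
    then have "(\<Sum>i\<in>UNIV. if i = j \<or> i = k then 0 else U $ j $ k * V $ j $ k * (?q i k j * ?q i j k) / 4)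
      = (\<Sum>i\<in>- {j, k}. U $ j $ k * V $ j $ k * (((c j k)\<^sup>2 - (c i j - c i k)\<^sup>2) / (c i j * c i k)) / 4)"
      by (intro sum.mono_neutral_cong_right) auto
    then show "(\<Sum>i\<in>UNIV. if i = j \<or> i = k then 0 else U $ j $ k * V $ j $ k * (?q i k j * ?q i j k) / 4)
      = group_ricci j k * U $ j $ k * V $ j $ k"
      by (simp add: group_ricci_def sum_distrib_left sum_divide_distrib ac_simps)
  qed
  finally show ?thesis .
qed

text \<open>Each diagonal entry of \<open>P\<close> is weighted by a row sum of
  \<open>c - 1\<close>. Equal row sums turn this into the trace of \<open>P\<close>, which is what
  makes the Ricci form a scalar on the h part.\<close>

lemma so_trace_mult_D:
  assumes "\<And>i. (\<Sum>j\<in>- {i}. c i j - 1) = \<delta>"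
  shows "so_trace (\<lambda>W. P ** D W) = \<delta> / 2 * (\<Sum>i\<in>UNIV. P $ i $ i)"
proof -
  let ?d = "\<lambda>i j. if i = j then 0 else c i j - 1"
  have d: "?d i j = ?d j i" for i j by (simp add: c_commute)
  have "\<delta> = (\<Sum>j\<in>UNIV. ?d i j)" for i
    unfolding assms[of i, symmetric] by (rule sum.mono_neutral_cong_left) auto
  then have row: "(\<Sum>j\<in>UNIV. ?d i j) = \<delta>" for i by simp
  have Dsk: "D (skew_unit i j) = ?d i j *\<^sub>R skew_unit i j" for i j
    by (auto simp: vec_eq_iff hadamard_component skew_unit_component c_commute)
  have comp: "(P ** skew_unit i j) $ a $ b = ((if b = j then P $ a $ i else 0) - (if b = i then P $ a $ j else 0)) / 2"
    for i j a b
    by (simp add: skew_unit_def matrix_distribs mult_unit_matrix_component)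
  have entry: "(P ** D (skew_unit i j)) \<bullet> skew_unit i j = ?d i j * (P $ i $ i + P $ j $ j) / 4" for i j
    by (simp add: Dsk matmul.scaleR_right inner_skew_unit comp algebra_simps) (simp add: field_simps)
  have "so_trace (\<lambda>W. P ** D W) = (\<Sum>i\<in>UNIV. \<Sum>j\<in>UNIV. ?d i j * (P $ i $ i + P $ j $ j) / 4)"
    by (simp only: so_trace_def entry)
  also have "\<dots> = ((\<Sum>i\<in>UNIV. \<Sum>j\<in>UNIV. ?d i j * P $ i $ i) + (\<Sum>i\<in>UNIV. \<Sum>j\<in>UNIV. ?d i j * P $ j $ j)) / 4"
    by (simp add: distrib_left sum.distrib sum_divide_distrib add_divide_distrib)
  also have "(\<Sum>i\<in>UNIV. \<Sum>j\<in>UNIV. ?d i j * P $ j $ j) = (\<Sum>i\<in>UNIV. \<Sum>j\<in>UNIV. ?d i j * P $ i $ i)"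
    by (subst sum.swap) (simp only: d)
  also have "(\<Sum>i\<in>UNIV. \<Sum>j\<in>UNIV. ?d i j * P $ i $ i) = \<delta> * (\<Sum>i\<in>UNIV. P $ i $ i)"
    unfolding sum_distrib_right[symmetric] row by (simp add: sum_distrib_left)
  finally show ?thesis by simp
qed

end

section \<open>Traces over the h part\<close>

context
  fixes p :: "real^'m^'n::finite"
  assumes orth: "transpose p ** p = mat 1"
begin

lemma horizontal_trace_eq:
  assumes "\<And>h. transpose p ** h = 0 \<Longrightarrow> transpose p ** L h = 0"
  shows "horizontal_trace p L = (\<Sum>a\<in>UNIV. \<Sum>j\<in>UNIV. L (unit_matrix a j - p ** (transpose p ** unit_matrix a j)) $ a $ j)"
proof -
  have "transpose p ** (unit_matrix a j - p ** (transpose p ** unit_matrix a j)) = 0" for a :: 'n and j :: 'm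
    by (simp add: matrix_distribs matrix_mul_assoc orth)
  then show ?thesis
    unfolding horizontal_trace_def using assms by (simp add: inner_horizontal_unit[OF orth])
qed

lemma horizontal_trace_mult_right:
  "horizontal_trace p (\<lambda>h. h ** M) = (real CARD('n) - real CARD('m)) * (\<Sum>j\<in>UNIV. M $ j $ j)"
proof -
  let ?P = "mat 1 - p ** transpose p"
  have "horizontal_trace p (\<lambda>h. h ** M)
      = (\<Sum>a\<in>UNIV. \<Sum>j\<in>UNIV. ((unit_matrix a j - p ** (transpose p ** unit_matrix a j)) ** M) $ a $ j)"
    by (rule horizontal_trace_eq) (simp add: matrix_mul_assoc matmul.zero_left)
  also have "\<dots> = (\<Sum>a\<in>UNIV. \<Sum>j\<in>UNIV. ?P $ a $ a * M $ j $ j)"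
  proof (intro sum.cong refl)
    fix a :: 'n and j :: 'm
    have "(unit_matrix a j - p ** (transpose p ** unit_matrix a j)) ** M = ?P ** (unit_matrix a j ** M)"
      by (simp add: matrix_distribs matrix_mul_assoc)
    also have "(?P ** (unit_matrix a j ** M)) $ a $ j = (\<Sum>r\<in>UNIV. if r = a then ?P $ a $ r * M $ j $ j else 0)"
      unfolding matrix_mult_component[of ?P] by (rule sum.cong) (auto simp: unit_matrix_mult_component)
    finally show "((unit_matrix a j - p ** (transpose p ** unit_matrix a j)) ** M) $ a $ j = ?P $ a $ a * M $ j $ j"
      by simp
  qed
  also have "\<dots> = (\<Sum>a\<in>UNIV. ?P $ a $ a) * (\<Sum>j\<in>UNIV. M $ j $ j)"
    by (simp add: sum_product)
  \<comment> \<open>The trace of the projection is the dimension of the complement of the columns of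
    \<open>p\<close>; for the Stiefel manifold it is l.\<close>
  also have "(\<Sum>a\<in>UNIV. ?P $ a $ a) = real CARD('n) - real CARD('m)"
  proof -
    have "(\<Sum>a\<in>UNIV. (p ** transpose p) $ a $ a) = p \<bullet> p"
      by (simp add: matrix_mult_component transpose_def inner_matrix)
    also have "\<dots> = (mat 1 :: real^'m^'m) \<bullet> (transpose p ** p)"
      using inner_matrix_mult_left[of p "mat 1" p] by simp
    also have "\<dots> = real CARD('m)"
      by (simp add: orth inner_matrix mat_def if_distrib[of "\<lambda>x. x * _"] cong: if_cong)
    finally show ?thesis by (simp add: mat_def sum_subtractf)
  qed
  finally show ?thesis .
qed

lemma horizontal_trace_transpose:
  assumes A: "transpose p ** A = 0" and B: "transpose p ** B = 0"
  shows "horizontal_trace p (\<lambda>h. A ** (transpose h ** B)) = A \<bullet> B"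
proof -
  have "horizontal_trace p (\<lambda>h. A ** (transpose h ** B))
      = (\<Sum>a\<in>UNIV. \<Sum>j\<in>UNIV. (A ** (transpose (unit_matrix a j - p ** (transpose p ** unit_matrix a j)) ** B)) $ a $ j)"
    by (rule horizontal_trace_eq) (simp add: matrix_mul_assoc A matmul.zero_left)
  also have "\<dots> = (\<Sum>a\<in>UNIV. \<Sum>j\<in>UNIV. A $ a $ j * B $ a $ j)"
  proof (intro sum.cong refl)
    fix a :: 'n and j :: 'm
    have B': "X ** transpose p ** B = 0" for X :: "real^'m^'x" by (simp add: B matrix_distribs flip: matrix_mul_assoc)
    have "transpose (unit_matrix a j - p ** (transpose p ** unit_matrix a j)) ** B = unit_matrix j a ** B"
      by (simp add: transpose_simps transpose_unit_matrix matrix_distribs matrix_mul_assoc B')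
    moreover have "(A ** (unit_matrix j a ** B)) $ a $ j = (\<Sum>r\<in>UNIV. if r = j then A $ a $ r * B $ a $ j else 0)"
      unfolding matrix_mult_component[of A] by (rule sum.cong) (auto simp: unit_matrix_mult_component)
    ultimately show "(A ** (transpose (unit_matrix a j - p ** (transpose p ** unit_matrix a j)) ** B)) $ a $ j
        = A $ a $ j * B $ a $ j" by simp
  qed
  finally show ?thesis by (simp add: inner_matrix)
qed

text \<open>The two terms in the bracket cancel on the diagonal, and off it the variable
  \<open>h\<close> contributes through \<open>transpose h ** B\<close>; summing over j leaves the
  row sums of \<open>d\<close>.\<close>

lemma horizontal_trace_hadamard:
  assumes A: "transpose p ** A = 0" and B: "transpose p ** B = 0"
    and d: "\<And>i. (\<Sum>j\<in>- {i}. d i j) = \<delta>"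
  shows "horizontal_trace p (\<lambda>h. A ** hadamard d (transpose B ** h - transpose h ** B)) = \<delta> * (A \<bullet> B)"
proof -
  have "horizontal_trace p (\<lambda>h. A ** hadamard d (transpose B ** h - transpose h ** B))
      = (\<Sum>a\<in>UNIV. \<Sum>j\<in>UNIV. (A ** hadamard d (transpose B ** (unit_matrix a j - p ** (transpose p ** unit_matrix a j))
           - transpose (unit_matrix a j - p ** (transpose p ** unit_matrix a j)) ** B)) $ a $ j)"
    by (rule horizontal_trace_eq) (simp add: matrix_mul_assoc A matmul.zero_left)
  also have "\<dots> = (\<Sum>a\<in>UNIV. \<Sum>j\<in>UNIV. \<Sum>k\<in>UNIV. if k = j then 0 else A $ a $ k * B $ a $ k * d k j)"
  proof (intro sum.cong refl)
    fix a :: 'n and j :: 'm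
    have B': "X ** transpose p ** B = 0" for X :: "real^'m^'x" by (simp add: B matrix_distribs flip: matrix_mul_assoc)
    have B'': "transpose B ** p = 0"
      using arg_cong[OF B, of transpose] by (simp add: transpose_simps)
    have "transpose B ** (unit_matrix a j - p ** (transpose p ** unit_matrix a j))
           - transpose (unit_matrix a j - p ** (transpose p ** unit_matrix a j)) ** B
        = transpose B ** unit_matrix a j - unit_matrix j a ** B"
      by (simp add: transpose_simps transpose_unit_matrix matrix_distribs matrix_mul_assoc B' B'')
    moreover have "(A ** hadamard d (transpose B ** unit_matrix a j - unit_matrix j a ** B)) $ a $ j
        = (\<Sum>k\<in>UNIV. if k = j then 0 else A $ a $ k * B $ a $ k * d k j)"
      unfolding matrix_mult_component[of A] hadamard_component
      by (rule sum.cong) (auto simp: unit_matrix_mult_component mult_unit_matrix_component transpose_def)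
    ultimately show "(A ** hadamard d (transpose B ** (unit_matrix a j - p ** (transpose p ** unit_matrix a j))
           - transpose (unit_matrix a j - p ** (transpose p ** unit_matrix a j)) ** B)) $ a $ j
        = (\<Sum>k\<in>UNIV. if k = j then 0 else A $ a $ k * B $ a $ k * d k j)" by simp
  qed
  also have "\<dots> = (\<Sum>a\<in>UNIV. \<Sum>k\<in>UNIV. \<Sum>j\<in>UNIV. if k = j then 0 else A $ a $ k * B $ a $ k * d k j)"
  proof (rule sum.cong[OF refl])
    fix a show "(\<Sum>j\<in>UNIV. \<Sum>k\<in>UNIV. if k = j then 0 else A $ a $ k * B $ a $ k * d k j)
      = (\<Sum>k\<in>UNIV. \<Sum>j\<in>UNIV. if k = j then 0 else A $ a $ k * B $ a $ k * d k j)"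
      by (rule sum.swap)
  qed
  also have "\<dots> = (\<Sum>a\<in>UNIV. \<Sum>k\<in>UNIV. \<delta> * (A $ a $ k * B $ a $ k))"
  proof (intro sum.cong refl)
    fix a k
    have "(\<Sum>j\<in>UNIV. if k = j then 0 else A $ a $ k * B $ a $ k * d k j) = (\<Sum>j\<in>- {k}. A $ a $ k * B $ a $ k * d k j)"
      by (rule sum.mono_neutral_cong_right) auto
    then show "(\<Sum>j\<in>UNIV. if k = j then 0 else A $ a $ k * B $ a $ k * d k j) = \<delta> * (A $ a $ k * B $ a $ k)"
      by (simp add: d sum_distrib_left[symmetric])
  qed
  finally show ?thesis by (simp add: inner_matrix sum_distrib_left)
qed

end

lemma sum_diagonal_transpose_mult: "(\<Sum>i\<in>UNIV. (transpose A ** B) $ i $ i) = A \<bullet> B"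
  by (simp add: matrix_mult_component transpose_def inner_matrix, rule sum.swap)

section \<open>The Ricci form and the Einstein condition\<close>

context weights
begin

lemma frame_trace_nomizu:
  assumes orth: "transpose p ** p = mat 1" and w: "w \<in> split_tangent p"
  shows "frame_trace p (\<lambda>u. nomizu u w) = 0"
proof -
  have W: "fst w \<in> so" using w by (simp add: split_tangent_def)
  have "frame_trace p (\<lambda>u. nomizu u w)
      = so_trace (\<lambda>X. \<phi> X (fst w)) + horizontal_trace p (\<lambda>h. h ** C (fst w))"
    unfolding frame_trace_split
    by (simp add: nomizu_def linear_0[OF linear_transpose] matrix_distribs hadamard_simps)
  then show ?thesis
    using so_diagonal[OF hadamard_in_so(1)[OF W]]
    by (simp add: so_trace_\<phi>[OF W] horizontal_trace_mult_right[OF orth])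
qed

lemma frame_trace_nomizu_nomizu:
  fixes p :: "real^'m^'n::finite"
  assumes orth: "transpose p ** p = mat 1" and v: "v \<in> split_tangent p" and w: "w \<in> split_tangent p"
    and row: "\<And>i. (\<Sum>j\<in>- {i}. c i j - 1) = \<delta>"
  shows "frame_trace p (\<lambda>u. nomizu (nomizu u v) w)
    = \<delta> * (snd v \<bullet> snd w) - (\<Sum>j\<in>UNIV. \<Sum>k\<in>UNIV. group_ricci j k * fst v $ j $ k * fst w $ j $ k)
      - (real CARD('n) - real CARD('m)) * (C (fst v) \<bullet> C (fst w))"
proof -
  have V: "fst v \<in> so" and W: "fst w \<in> so" using v w by (simp_all add: split_tangent_def)
  have skew: "(X - transpose X) \<bullet> skew_unit i j = 2 * (X \<bullet> skew_unit i j)" for X :: "real^'m^'m" and i j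
    by (simp add: inner_diff_left so_inner_transpose[OF skew_unit_in_so])
  have "fst (nomizu (nomizu (X, 0) v) w) = \<phi> (\<phi> X (fst v)) (fst w)
      + (1/2) *\<^sub>R ((transpose (snd w) ** snd v) ** D X - transpose ((transpose (snd w) ** snd v) ** D X))" for X
    by (simp add: nomizu_def linear_0[OF linear_transpose] matrix_distribs transpose_simps matrix_mul_assoc)
  then have "so_trace (\<lambda>X. fst (nomizu (nomizu (X, 0) v) w))
      = so_trace (\<lambda>X. \<phi> (\<phi> X (fst v)) (fst w)) + so_trace (\<lambda>X. (transpose (snd w) ** snd v) ** D X)"
    by (simp add: so_trace_add) (simp add: so_trace_def skew)
  then have so: "so_trace (\<lambda>X. fst (nomizu (nomizu (X, 0) v) w))
      = \<delta> / 2 * (snd v \<bullet> snd w) - (\<Sum>j\<in>UNIV. \<Sum>k\<in>UNIV. group_ricci j k * fst v $ j $ k * fst w $ j $ k)"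
    by (simp add: so_trace_\<phi>_\<phi>[OF V W] so_trace_mult_D[OF row] sum_diagonal_transpose_mult inner_commute)
  have "snd (nomizu (nomizu (0, h) v) w) = h ** (C (fst v) ** C (fst w))
      + (1/2) *\<^sub>R (snd w ** D (transpose (snd v) ** h - transpose h ** snd v))" for h
    by (simp add: nomizu_def \<phi>_zero hadamard_simps matrix_distribs matrix_mul_assoc)
  then have "horizontal_trace p (\<lambda>h. snd (nomizu (nomizu (0, h) v) w))
      = horizontal_trace p (\<lambda>h. h ** (C (fst v) ** C (fst w)))
        + (1/2) * horizontal_trace p (\<lambda>h. snd w ** D (transpose (snd v) ** h - transpose h ** snd v))"
    by (simp add: horizontal_trace_def inner_add_left sum.distrib sum_divide_distrib)
  moreover have "(\<Sum>j\<in>UNIV. (C (fst v) ** C (fst w)) $ j $ j) = - (C (fst v) \<bullet> C (fst w))"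
    using sum_diagonal_transpose_mult[of "C (fst v)" "C (fst w)"] hadamard_in_so(1)[OF V]
    by (simp add: so_iff matmul.minus_left sum_negf)
  ultimately have "horizontal_trace p (\<lambda>h. snd (nomizu (nomizu (0, h) v) w))
      = \<delta> / 2 * (snd v \<bullet> snd w) - (real CARD('n) - real CARD('m)) * (C (fst v) \<bullet> C (fst w))"
    using horizontal_trace_hadamard[OF orth split_tangentD(2)[OF orth w] split_tangentD(2)[OF orth v] row]
    by (simp add: horizontal_trace_mult_right[OF orth] inner_commute)
  with so show ?thesis unfolding frame_trace_split by simp
qed

text \<open>With the bracket written as \<open>nomizu u v - nomizu v u\<close>, cyclicity of the
  trace cancels the terms in which \<open>v\<close> acts last against those in which it acts first,
  and unimodularity removes \<open>nomizu u (nomizu v w)\<close>. Only the trace of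
  \<open>nomizu (nomizu u v) w\<close> and that of the correction term remain.\<close>

lemma frame_trace_nomizu_curvature:
  fixes p :: "real^'m^'n::finite"
  assumes orth: "transpose p ** p = mat 1" and v: "v \<in> split_tangent p" and w: "w \<in> split_tangent p"
    and row: "\<And>i. (\<Sum>j\<in>- {i}. c i j - 1) = \<delta>"
  defines "l \<equiv> real CARD('n) - real CARD('m)"
  shows "frame_trace p (\<lambda>u. nomizu_curvature u v w)
    = (\<Sum>j\<in>UNIV. \<Sum>k\<in>UNIV. group_ricci j k * fst v $ j $ k * fst w $ j $ k)
      + l * (C (fst v) \<bullet> C (fst w)) + (l - 1 - \<delta>) * (snd v \<bullet> snd w)"
proof -
  let ?K = "\<lambda>u. (0 :: real^'m^'m, snd v ** (transpose (snd u) ** snd w) - snd u ** (transpose (snd v) ** snd w))"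
  have "nomizu_curvature u v w = nomizu u (nomizu v w) - nomizu v (nomizu u w)
      - (nomizu (nomizu u v) w - nomizu (nomizu v u) w) - ?K u" for u
    unfolding nomizu_curvature_def nomizu_torsion_free
    by (simp only: linear_diff[OF linear_nomizu_left])
  then have "frame_trace p (\<lambda>u. nomizu_curvature u v w)
      = frame_trace p (\<lambda>u. nomizu u (nomizu v w)) - frame_trace p (\<lambda>u. nomizu v (nomizu u w))
        - (frame_trace p (\<lambda>u. nomizu (nomizu u v) w) - frame_trace p (\<lambda>u. nomizu (nomizu v u) w))
        - frame_trace p ?K"
    by (simp only: frame_trace_diff)
  moreover have "frame_trace p (\<lambda>u. nomizu v (nomizu u w)) = frame_trace p (\<lambda>u. nomizu (nomizu v u) w)"
    by (rule frame_trace_commute[OF orth linear_nomizu_right linear_nomizu_left])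
       (intro split_tangent_nomizu orth v w, assumption)+
  moreover have "frame_trace p (\<lambda>u. nomizu u (nomizu v w)) = 0"
    by (intro frame_trace_nomizu split_tangent_nomizu orth v w)
  moreover have "frame_trace p ?K = (1 - l) * (snd v \<bullet> snd w)"
  proof -
    have "frame_trace p ?K = horizontal_trace p (\<lambda>h. snd v ** (transpose h ** snd w))
        - horizontal_trace p (\<lambda>h. h ** (transpose (snd v) ** snd w))"
      unfolding frame_trace_split
      by (simp add: so_trace_def horizontal_trace_def inner_diff_left sum_subtractf)
    then show ?thesis
      using horizontal_trace_transpose[OF orth split_tangentD(2)[OF orth v] split_tangentD(2)[OF orth w]]
      by (simp add: horizontal_trace_mult_right[OF orth] sum_diagonal_transpose_mult l_def algebra_simps)
  qed
  ultimately show ?thesis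
    unfolding frame_trace_nomizu_nomizu[OF orth v w row] l_def by (simp add: algebra_simps)
qed

lemma metric_commute: "metric p u v = metric p v u"
proof -
  have "(transpose p ** u) \<bullet> D (transpose p ** v) = (transpose p ** v) \<bullet> D (transpose p ** u)"
    by (subst inner_commute) (rule inner_hadamard)
  then show ?thesis by (simp add: metric_def inner_commute)
qed

lemma riemannian_metric_stiefel: "riemannian_metric (stiefel :: (real^'m^('m + 'l::finite)) set) metric"
  unfolding riemannian_metric_def
proof (intro conjI ballI allI impI)
  fix p :: "real^'m^('m + 'l)" and u v w a
  show "metric p u v = metric p v u" by (rule metric_commute)
  show "metric p (u + v) w = metric p u w + metric p v w"
    by (rule bilinear_ladd[OF bilinear_metric])
  show "metric p (a *\<^sub>R u) w = a * metric p u w"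
    using bilinear_lmul[OF bilinear_metric] by simp
next
  fix p u :: "real^'m^('m + 'l)" assume p: "p \<in> stiefel" "u \<in> tangent stiefel p" "u \<noteq> 0"
  then obtain x where x: "x \<in> split_tangent p" "u = join p x" by (auto simp: tangent_stiefel_join)
  have c0: "0 \<le> c i j * (fst x $ i $ j * fst x $ i $ j)" for i j using c_pos[of i j] by simp
  have fst: "fst x \<bullet> C (fst x) = (\<Sum>i\<in>UNIV. \<Sum>j\<in>UNIV. c i j * (fst x $ i $ j * fst x $ i $ j))"
    by (simp add: inner_matrix hadamard_component ac_simps)
  have "fst x \<bullet> C (fst x) > 0" if nonzero: "fst x \<noteq> 0"
  proof -
    obtain i j where ij: "fst x $ i $ j \<noteq> 0" using nonzero unfolding vec_eq_iff by auto
    have "0 < c i j * (fst x $ i $ j * fst x $ i $ j)"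
      using ij c_pos[of i j] by (auto simp: zero_less_mult_iff linorder_neq_iff)
    then show ?thesis
      unfolding fst by (intro sum_pos2[of _ i] sum_pos2[of _ j] sum_nonneg) (auto simp: c0)
  qed
  moreover have "fst x \<bullet> C (fst x) \<ge> 0" unfolding fst by (intro sum_nonneg c0)
  moreover have "fst x \<noteq> 0 \<or> snd x \<noteq> 0" using p(3) by (auto simp: x(2) join_def matrix_distribs)
  ultimately have "fst x \<bullet> C (fst x) + snd x \<bullet> snd x > 0"
    by (metis add_nonneg_pos add_pos_nonneg inner_ge_zero inner_gt_zero_iff)
  then show "0 < metric p u u"
    by (simp add: x(2) metric_join[OF stiefel_orthonormal[OF p(1)] x(1) x(1)])
next
  fix X Y :: "real^'m^('m + 'l) \<Rightarrow> real^'m^('m + 'l)"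
  assume "vector_field stiefel X \<and> vector_field stiefel Y"
  then show "smooth_map stiefel (\<lambda>p. metric p (X p) (Y p))"
    by (intro smooth_map_metric) (auto simp: vector_field_def)
qed

text \<open>The h part forces the Einstein constant \<open>real CARD('l) - 1 - \<delta>\<close>; the
  W part then gives one scalar equation for each off-diagonal entry, as the Ricci form is diagonal
  in the entries.\<close>

lemma einstein_stiefel:
  assumes row: "\<And>i. (\<Sum>j\<in>- {i}. c i j - 1) = \<delta>"
    and ein: "\<And>j k. j \<noteq> k \<Longrightarrow> group_ricci j k + real CARD('l) * (c j k)\<^sup>2 = (real CARD('l) - 1 - \<delta>) * c j k"
  shows "einstein (stiefel :: (real^'m^('m + 'l::finite)) set) metric"
  unfolding einstein_def
proof (intro conjI riemannian_metric_stiefel exI allI impI ballI)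
  interpret homogeneous_metric "stiefel :: (real^'m^('m + 'l)) set" "(\<lambda>A X. A ** X) ` so" christoffel metric
    by (rule homogeneous_metric_stiefel)
  show "levi_civita (stiefel :: (real^'m^('m + 'l)) set) metric levi_civita_connection"
    by (rule levi_civita_covariant_derivative)
next
  fix Y Z :: "real^'m^('m + 'l) \<Rightarrow> real^'m^('m + 'l)" and p :: "real^'m^('m + 'l)"
  assume "vector_field stiefel Y \<and> vector_field stiefel Z" and p: "p \<in> stiefel"
  then have YZ: "vector_field stiefel Y" "vector_field stiefel Z" by auto
  note orth = stiefel_orthonormal[OF p]
  have "Y p \<in> join p ` split_tangent p" "Z p \<in> join p ` split_tangent p"
    using YZ p by (auto simp: vector_field_def tangent_stiefel_join[symmetric])
  then obtain v w where v: "v \<in> split_tangent p" "Y p = join p v" and w: "w \<in> split_tangent p" "Z p = join p w"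
    by blast
  let ?l = "real CARD('l)"
  have l: "real CARD('m + 'l) - real CARD('m) = ?l" by simp
  have V: "fst v \<in> so" using v by (simp add: split_tangent_def)
  have "group_ricci j k * fst v $ j $ k * fst w $ j $ k + ?l * (C (fst v) $ j $ k * C (fst w) $ j $ k)
      = (?l - 1 - \<delta>) * (fst v $ j $ k * C (fst w) $ j $ k)" for j k
  proof (cases "j = k")
    case True
    then show ?thesis by (simp add: so_diagonal[OF V] hadamard_component)
  next
    case False
    have "group_ricci j k * fst v $ j $ k * fst w $ j $ k + ?l * (C (fst v) $ j $ k * C (fst w) $ j $ k)
      = (group_ricci j k + ?l * (c j k)\<^sup>2) * (fst v $ j $ k * fst w $ j $ k)"
      by (simp add: hadamard_component power2_eq_square algebra_simps)
    then show ?thesis by (simp add: ein[OF False] hadamard_component)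
  qed
  then have "(\<Sum>j\<in>UNIV. \<Sum>k\<in>UNIV. group_ricci j k * fst v $ j $ k * fst w $ j $ k) + ?l * (C (fst v) \<bullet> C (fst w))
      = (?l - 1 - \<delta>) * (fst v \<bullet> C (fst w))"
    unfolding inner_matrix sum_distrib_left sum.distrib[symmetric] by simp
  then show "ricci stiefel levi_civita_connection Y Z p = (?l - 1 - \<delta>) * metric p (Y p) (Z p)"
    using ricci_stiefel_frame[OF YZ p v w] frame_trace_nomizu_curvature[OF orth v(1) w(1) row]
    unfolding v(2) w(2) metric_join[OF orth v(1) w(1)] l by (simp add: distrib_left)
qed

end

section \<open>The Killing form\<close>

text \<open>\<open>M ** X ** N\<close> need not be skew; pairing with \<open>skew_unit\<close>
  projects it, so this is the trace of its skew part.\<close>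

lemma so_trace_conj:
  "so_trace (\<lambda>X. M ** X ** N) = ((\<Sum>i\<in>UNIV. M $ i $ i) * (\<Sum>i\<in>UNIV. N $ i $ i) - M \<bullet> N) / 2"
proof -
  have comp: "(M ** unit_matrix i j ** N) $ a $ b = M $ a $ i * N $ j $ b" for i j a b
  proof -
    have "(M ** unit_matrix i j) $ a $ r * N $ r $ b = (if r = j then M $ a $ i * N $ r $ b else 0)" for r
      by (simp add: mult_unit_matrix_component)
    then show ?thesis unfolding matrix_mult_component[of "M ** unit_matrix i j"] by simp
  qed
  have entry: "(M ** skew_unit i j ** N) \<bullet> skew_unit i j
      = (M $ i $ i * N $ j $ j + M $ j $ j * N $ i $ i - M $ i $ j * N $ i $ j - M $ j $ i * N $ j $ i) / 4" for i j
    unfolding inner_skew_unit by (simp add: skew_unit_def matrix_distribs comp) (simp add: field_simps)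
  have "so_trace (\<lambda>X. M ** X ** N)
      = ((\<Sum>i\<in>UNIV. \<Sum>j\<in>UNIV. M $ i $ i * N $ j $ j) + (\<Sum>i\<in>UNIV. \<Sum>j\<in>UNIV. M $ j $ j * N $ i $ i)
        - (\<Sum>i\<in>UNIV. \<Sum>j\<in>UNIV. M $ i $ j * N $ i $ j) - (\<Sum>i\<in>UNIV. \<Sum>j\<in>UNIV. M $ j $ i * N $ j $ i)) / 4"
    by (simp add: so_trace_def entry sum_divide_distrib[symmetric] sum_subtractf sum.distrib)
  also have "(\<Sum>i\<in>UNIV. \<Sum>j\<in>UNIV. M $ j $ j * N $ i $ i) = (\<Sum>i\<in>UNIV. \<Sum>j\<in>UNIV. M $ i $ i * N $ j $ j)"
    by (rule sum.swap)
  also have "(\<Sum>i\<in>UNIV. \<Sum>j\<in>UNIV. M $ j $ i * N $ j $ i) = (\<Sum>i\<in>UNIV. \<Sum>j\<in>UNIV. M $ i $ j * N $ i $ j)"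
    by (rule sum.swap)
  finally show ?thesis by (simp add: inner_matrix sum_product)
qed

lemma killing_eq:
  fixes A B :: "real^'n^'n"
  assumes A: "A \<in> so" and B: "B \<in> so"
  shows "killing A B = - (real CARD('n) - 2) * (A \<bullet> B)"
proof -
  let ?L = "\<lambda>X. commutator A (commutator B X)"
  \<comment> \<open>Of the four terms the two outer ones contribute -(n - 1) times
    \<open>A \<bullet> B\<close>, and the two with \<open>X\<close> in the middle contribute
    \<open>A \<bullet> B\<close>, since skew matrices have trace 0.\<close>
  have L: "?L X = A ** B ** X ** mat 1 - A ** X ** B - B ** X ** A + mat 1 ** X ** (B ** A)" for X
    by (simp add: commutator_def matrix_distribs matrix_mul_assoc)
  have "linear ?L"
    by (rule linearI) (simp_all add: L matrix_distribs algebra_simps)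
  have frame: "(\<Sum>i\<in>UNIV. (X \<bullet> skew_unit (fst i) (snd i)) *\<^sub>R skew_unit (fst i) (snd i)) = X" if "X \<in> so" for X :: "real^'n^'n"
    unfolding sum_UNIV_prod using skew_unit_frame[OF that] by simp
  have "killing A B = (\<Sum>i\<in>UNIV. ?L (skew_unit (fst i) (snd i)) \<bullet> skew_unit (fst i) (snd i))"
    unfolding killing_def
    by (rule trace_on_frame[OF _ subspace_so \<open>linear ?L\<close>])
       (use A B in \<open>auto simp: skew_unit_in_so frame commutator_def intro!: commutator_in_so\<close>)
  also have "\<dots> = so_trace ?L" by (simp add: sum_UNIV_prod so_trace_def)
  also have "\<dots> = so_trace (\<lambda>X. (A ** B) ** X ** mat 1) - so_trace (\<lambda>X. A ** X ** B)
      - so_trace (\<lambda>X. B ** X ** A) + so_trace (\<lambda>X. mat 1 ** X ** (B ** A))"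
    unfolding L so_trace_def by (simp only: inner_diff_left inner_add_left sum_subtractf sum.distrib)
  also have "\<dots> = - (real CARD('n) - 2) * (A \<bullet> B)"
  proof -
    have tr: "(\<Sum>i\<in>UNIV. (A ** B) $ i $ i) = - (A \<bullet> B)" "(\<Sum>i\<in>UNIV. (B ** A) $ i $ i) = - (A \<bullet> B)"
      using sum_diagonal_transpose_mult[of A B] sum_diagonal_transpose_mult[of B A] A B
      by (simp_all add: so_iff matmul.minus_left sum_negf inner_commute)
    moreover have "X \<bullet> mat 1 = (\<Sum>i\<in>UNIV. X $ i $ i)" "mat 1 \<bullet> X = (\<Sum>i\<in>UNIV. X $ i $ i)" for X :: "real^'n^'n"
      by (simp_all add: inner_matrix mat_def if_distrib[of "\<lambda>x. _ * x"] if_distrib[of "\<lambda>x. x * _"] cong: if_cong)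
    ultimately show ?thesis
      unfolding so_trace_conj
      by (simp add: so_diagonal[OF A] so_diagonal[OF B] inner_commute mat_def field_simps)
  qed
  finally show ?thesis .
qed

section \<open>The equations for block weights\<close>

text \<open>The quadratic is Jensen's in the variable c with x1 : x12 = 2c : 1. It is positive at 0
  and 1, and at 1/2 it equals (m + 1 - n) / 4.\<close>

lemma quadratic_two_roots:
  fixes m n :: real
  assumes "m > 2" "n > m + 1"
  obtains c d where "0 < c" "c < 1/2" "1/2 < d"
    "(m - 2) / 4 - (n - 2) * c + (n - 1) * c\<^sup>2 = 0" "(m - 2) / 4 - (n - 2) * d + (n - 1) * d\<^sup>2 = 0"
proof -
  let ?f = "\<lambda>x. (m - 2) / 4 - (n - 2) * x + (n - 1) * x\<^sup>2"
  have cont: "continuous_on S ?f" for S by (intro continuous_intros)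
  have half: "?f (1/2) < 0" using assms by (simp add: power2_eq_square field_simps)
  have zero: "?f 0 > 0" and one: "?f 1 > 0" using assms by (simp_all add: field_simps)
  obtain c where c: "0 \<le> c" "c \<le> 1/2" "?f c = 0"
    using IVT2'[of ?f "1/2" 0 0] half zero cont by auto
  obtain d where d: "1/2 \<le> d" "d \<le> 1" "?f d = 0"
    using IVT'[of ?f "1/2" 0 1] half one cont by auto
  have "c \<noteq> 0" "c \<noteq> 1/2" "d \<noteq> 1/2"
    using c(3) d(3) half zero by (metis order_less_irrefl)+
  then show ?thesis
    using c d by (intro that[of c d]) auto
qed

text \<open>
  The Einstein equations for the weights \<open>a\<close> within and \<open>b\<close> between blocks of size \<open>k\<close>, with
  \<open>m = s * k\<close>.
\<close>

definition block_einstein :: "real \<Rightarrow> real \<Rightarrow> real \<Rightarrow> real \<Rightarrow> real \<Rightarrow> bool" where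
  "block_einstein k l m a b \<longleftrightarrow> 0 < a \<and> 0 < b
    \<and> (k - 2) / 4 + (m - k) / 4 * (a / b)\<^sup>2 + l * a\<^sup>2 = (l + m - 2 - (k - 1) * a - (m - k) * b) * a
    \<and> (k - 1) / 2 * (2 - a / b) + (m - 2 * k) / 4 + l * b\<^sup>2 = (l + m - 2 - (k - 1) * a - (m - k) * b) * b"

text \<open>
  The difference of the two equations is divisible by \<open>a - b\<close>; cancelling this factor gives
  \<open>a = (k - 2) * b / (4 * l * b\<^sup>2 + m + k - 2)\<close>, and substituting into either equation leaves one
  equation for \<open>b\<close>, whose sign changes twice.
\<close>

lemma block_einstein_solutions:
  fixes k l m :: real
  assumes k: "k \<ge> 3" and l: "l > k" and m: "m \<ge> 2 * k"
  obtains a b a' b' where "block_einstein k l m a b" "a < b" "block_einstein k l m a' b'" "a' < b'" "b < b'"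
proof -
  let ?Q = "\<lambda>b. 4 * l * b\<^sup>2 + m + k - 2"
  \<comment> \<open>\<open>t b\<close> is the ratio a / b forced by the cancelled factor.\<close>
  define t where "t b = (k - 2) / ?Q b" for b
  \<comment> \<open>The first equation divided by \<open>t b\<close>, with (k - 2) /
    \<open>t b\<close> replaced by \<open>?Q b\<close>.\<close>
  define f where "f b = ?Q b / 4 + (m - k) * t b / 4 + (l + k - 1) * t b * b\<^sup>2 + (m - k) * b\<^sup>2 - (l + m - 2) * b" for b
  have Q: "?Q b > 0" "?Q b > k - 2" for b
  proof -
    have "0 \<le> 4 * l * b\<^sup>2" using k l by simp
    then show "?Q b > 0" "?Q b > k - 2" using k m by linarith+
  qed
  have t: "0 < t b" "t b < 1" "t b * ?Q b = k - 2" for b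
    using Q[of b] k by (simp_all add: t_def)
  have sol: "block_einstein k l m (t b * b) b" "t b * b < b" if b: "b > 0" "f b = 0" for b
  proof -
    have "t b * (4 * l * b\<^sup>2) = k - 2 - t b * (m + k - 2)"
      using t(3)[of b] by (simp add: algebra_simps)
    then have lt: "l * (t b * b\<^sup>2) = (k - 2 - t b * (m + k - 2)) / 4" by (simp add: field_simps)
    have lam: "(l + m - 2 - (k - 1) * (t b * b) - (m - k) * b) * b = ?Q b / 4 + (m - k) * t b / 4 + l * (t b * b\<^sup>2)"
      using b(2) unfolding f_def by (simp add: power2_eq_square algebra_simps)
    have quot: "t b * b / b = t b" using b by simp
    have "(k - 2) / 4 + (m - k) / 4 * (t b)\<^sup>2 + l * (t b * b)\<^sup>2
        = t b * (?Q b / 4 + (m - k) * t b / 4 + l * (t b * b\<^sup>2))"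
      using t(3)[of b, symmetric] by (simp add: power2_eq_square algebra_simps) (simp add: field_simps)
    then have 1: "(k - 2) / 4 + (m - k) / 4 * (t b)\<^sup>2 + l * (t b * b)\<^sup>2
        = (l + m - 2 - (k - 1) * (t b * b) - (m - k) * b) * (t b * b)"
      unfolding lam[symmetric] by (simp add: algebra_simps)
    have 2: "(k - 1) / 2 * (2 - t b) + (m - 2 * k) / 4 + l * b\<^sup>2
        = (l + m - 2 - (k - 1) * (t b * b) - (m - k) * b) * b"
      unfolding lam lt by (simp add: field_simps)
    show "block_einstein k l m (t b * b) b" "t b * b < b"
      unfolding block_einstein_def quot using 1 2 t[of b] b by simp_all
  qed
  have cont: "continuous_on S f" for S
    unfolding f_def t_def using Q by (intro continuous_intros) (auto simp: less_imp_neq[THEN not_sym])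
  have pos: "(m - k) * t b / 4 \<ge> 0" "(l + k - 1) * t b * b\<^sup>2 \<ge> 0" for b
    using t(1)[of b] k l m by simp_all
  have "f 0 = (m + k - 2) / 4 + (m - k) * t 0 / 4" by (simp add: f_def)
  moreover have "(m + k - 2) / 4 > 0" using k m by simp
  ultimately have f0: "f 0 > 0" using pos(1)[of 0] by linarith
  have "f 2 = (16 * l + m + k - 2) / 4 + (m - k) * t 2 / 4 + (l + k - 1) * t 2 * 2\<^sup>2 + (m - k) * 4 - (l + m - 2) * 2"
    by (simp add: f_def)
  then have f2: "f 2 > 0" using pos[of 2] k l m by argo
  \<comment> \<open>At b = 1/2 the term 4 l b^2 is l, so \<open>t (1/2)\<close> is (k - 2) / (l + m
    + k - 2) and \<open>4 * f (1/2)\<close> is less than (k - 2) + (2 - l).\<close>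
  have fhalf: "f (1/2) < 0"
  proof -
    have "t (1/2) * (l + m + k - 2) = k - 2" using t(3)[of "1/2"] by (simp add: power2_eq_square)
    moreover have "t (1/2) * (m + l - 1) < t (1/2) * (l + m + k - 2)"
      using t(1)[of "1/2"] k by (intro mult_strict_left_mono) auto
    ultimately have "t (1/2) * (m + l - 1) < k - 2" by simp
    moreover have "4 * f (1/2) = 2 - l + t (1/2) * (m + l - 1)"
      by (simp add: f_def power2_eq_square field_simps)
    ultimately show ?thesis using l k by linarith
  qed
  obtain b where b: "0 \<le> b" "b \<le> 1/2" "f b = 0"
    using IVT2'[of f "1/2" 0 0] f0 fhalf cont by auto
  obtain b' where b': "1/2 \<le> b'" "b' \<le> 2" "f b' = 0"
    using IVT'[of f "1/2" 0 2] f2 fhalf cont by auto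
  have "b \<noteq> 0" "b \<noteq> 1/2" "b' \<noteq> 1/2" using b(3) b'(3) f0 fhalf by (metis order_less_irrefl)+
  then show ?thesis
    using b b' by (intro that[of "t b * b" b "t b' * b'" b'] sol) auto
qed

section \<open>Row sums and Ricci curvature for block weights\<close>

definition block_weight :: "real \<Rightarrow> real \<Rightarrow> 's \<times> 'k \<Rightarrow> 's \<times> 'k \<Rightarrow> real" where
  "block_weight a b i j = (if fst i = fst j then a else b)"

lemma weights_block_weight: "a > 0 \<Longrightarrow> b > 0 \<Longrightarrow> weights (block_weight a b)"
  by unfold_locales (auto simp: block_weight_def)

lemma sum_blocks:
  fixes g :: "'s::finite \<Rightarrow> real"
  shows "(\<Sum>i\<in>(UNIV :: ('s \<times> 'k::finite) set). g (fst i)) = real CARD('k) * (\<Sum>f\<in>UNIV. g f)"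
  by (simp add: sum_UNIV_prod sum_distrib_left)

lemma sum_one_exception: "(\<Sum>f\<in>UNIV. if f = f1 then x else y) = x + (real CARD('s) - 1) * y"
  for f1 :: "'s::finite" and x y :: real
proof -
  have "(if f = f1 then x else y) = y + (if f = f1 then x - y else 0)" for f by simp
  then have "(\<Sum>f\<in>UNIV. if f = f1 then x else y) = (\<Sum>f\<in>(UNIV :: 's set). y + (if f = f1 then x - y else 0))"
    by (rule sum.cong[OF refl])
  then show ?thesis by (simp add: sum.distrib algebra_simps)
qed

lemma sum_two_exceptions:
  fixes f1 f2 :: "'s::finite" and x y :: real
  assumes "f1 \<noteq> f2"
  shows "(\<Sum>f\<in>UNIV. if f = f1 \<or> f = f2 then x else y) = 2 * x + (real CARD('s) - 2) * y"
proof -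
  have "(if f = f1 \<or> f = f2 then x else y) = y + (if f = f1 then x - y else 0) + (if f = f2 then x - y else 0)" for f
    using assms by simp
  then have "(\<Sum>f\<in>UNIV. if f = f1 \<or> f = f2 then x else y)
      = (\<Sum>f\<in>(UNIV :: 's set). y + (if f = f1 then x - y else 0) + (if f = f2 then x - y else 0))"
    by (rule sum.cong[OF refl])
  then show ?thesis by (simp add: sum.distrib algebra_simps)
qed

lemma sum_block_weight_row:
  fixes i :: "'s::finite \<times> 'k::finite"
  shows "(\<Sum>j\<in>- {i}. block_weight a b i j - 1)
    = (real CARD('k) - 1) * (a - 1) + (real CARD('s) - 1) * real CARD('k) * (b - 1)"
proof -
  have "(\<Sum>j\<in>UNIV. block_weight a b i j - 1) = real CARD('k) * (\<Sum>f\<in>(UNIV :: 's set). if f = fst i then a - 1 else b - 1)"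
    unfolding sum_blocks[symmetric] by (rule sum.cong) (auto simp: block_weight_def)
  moreover have "(\<Sum>j\<in>- {i}. block_weight a b i j - 1) = (\<Sum>j\<in>UNIV. block_weight a b i j - 1) - (a - 1)"
    using sum.remove[of UNIV i "\<lambda>j. block_weight a b i j - 1"] by (simp add: Compl_eq_Diff_UNIV block_weight_def)
  ultimately show ?thesis by (simp add: sum_one_exception algebra_simps)
qed

lemma sum_minus_two:
  fixes g :: "'a::finite \<Rightarrow> real"
  assumes "j \<noteq> k"
  shows "(\<Sum>i\<in>- {j, k}. g i) = (\<Sum>i\<in>UNIV. g i) - g j - g k"
proof -
  have "sum g (UNIV - {j, k}) = sum g UNIV - sum g {j, k}" by (rule sum_diff) auto
  then show ?thesis using assms by (simp add: Compl_eq_Diff_UNIV)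
qed

lemma group_ricci_block_weight:
  fixes i j :: "'s::finite \<times> 'k::finite"
  assumes "a > 0" "b > 0" "i \<noteq> j"
  shows "weights.group_ricci (block_weight a b) i j = (if fst i = fst j
    then (real CARD('k) - 2) / 4 + (real CARD('s) - 1) * real CARD('k) / 4 * (a / b)\<^sup>2
    else (real CARD('k) - 1) / 2 * (2 - a / b) + (real CARD('s) - 2) * real CARD('k) / 4)"
proof -
  interpret weights "block_weight a b :: 's \<times> 'k \<Rightarrow> _" by (rule weights_block_weight[OF assms(1,2)])
  let ?w = "block_weight a b"
  let ?g = "\<lambda>r. ((?w i j)\<^sup>2 - (?w r i - ?w r j)\<^sup>2) / (?w r i * ?w r j)"
  \<comment> \<open>The sum is extended to all indices so that it depends on blocks only; the two
    extra terms use the diagonal weight \<open>a\<close> and are subtracted again.\<close>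
  have ricci: "group_ricci i j = ((\<Sum>r\<in>UNIV. ?g r) - ?g i - ?g j) / 4"
    unfolding group_ricci_def sum_minus_two[OF assms(3)] ..
  have same: "(\<Sum>r\<in>UNIV. ?g r) = real CARD('k) * (1 + (real CARD('s) - 1) * (a / b)\<^sup>2)" "?g i = 1" "?g j = 1"
    if eq: "fst i = fst j"
  proof -
    have "(\<Sum>r\<in>UNIV. ?g r) = real CARD('k) * (\<Sum>f\<in>(UNIV :: 's set). if f = fst i then 1 else (a / b)\<^sup>2)"
      unfolding sum_blocks[symmetric]
      by (rule sum.cong) (use eq assms in \<open>auto simp: block_weight_def power2_eq_square\<close>)
    then show "(\<Sum>r\<in>UNIV. ?g r) = real CARD('k) * (1 + (real CARD('s) - 1) * (a / b)\<^sup>2)"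
      by (simp add: sum_one_exception)
    show "?g i = 1" "?g j = 1" using eq assms by (simp_all add: block_weight_def power2_eq_square)
  qed
  have different: "(\<Sum>r\<in>UNIV. ?g r) = real CARD('k) * (2 * (2 - a / b) + (real CARD('s) - 2))"
    "?g i = 2 - a / b" "?g j = 2 - a / b" if neq: "fst i \<noteq> fst j"
  proof -
    \<comment> \<open>For \<open>r\<close> in one of the two blocks the term is (b^2 - (a - b)^2) /
      (a b) = 2 - a / b; in a third block the difference of weights vanishes.\<close>
    have g: "?g r = (if fst r = fst i \<or> fst r = fst j then 2 - a / b else 1)" for r
      using neq assms by (auto simp: block_weight_def power2_eq_square field_simps)
    have "(\<Sum>r\<in>UNIV. ?g r) = real CARD('k) * (\<Sum>f\<in>(UNIV :: 's set). if f = fst i \<or> f = fst j then 2 - a / b else 1)"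
      unfolding sum_blocks[symmetric] g ..
    then show "(\<Sum>r\<in>UNIV. ?g r) = real CARD('k) * (2 * (2 - a / b) + (real CARD('s) - 2))"
      using sum_two_exceptions[OF neq, of "2 - a / b" 1] by simp
    show "?g i = 2 - a / b" "?g j = 2 - a / b" unfolding g by simp_all
  qed
  show ?thesis
  proof (cases "fst i = fst j")
    case True
    have "(k * (1 + (s - 1) * x) - 1 - 1) / 4 = (k - 2) / 4 + (s - 1) * k / 4 * x" for k s x :: real
      by (simp add: field_simps)
    with True show ?thesis unfolding ricci same[OF True] by (simp only: if_True simp_thms)
  next
    case False
    have "(k * (2 * x + (s - 2)) - x - x) / 4 = (k - 1) / 2 * x + (s - 2) * k / 4" for k s x :: real
      by (simp add: field_simps)
    with False show ?thesis unfolding ricci different[OF False] by (simp only: if_False simp_thms)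
  qed
qed

definition block_metric :: "real \<Rightarrow> real \<Rightarrow> (real^('s::finite \<times> 'k::finite)^('s \<times> 'k + 'l::finite)) tensor2" where
  "block_metric a b = weights.metric (block_weight a b)"

lemma einstein_block_metric:
  fixes a b :: real
  defines "k \<equiv> real CARD('k::finite)" and "l \<equiv> real CARD('l::finite)" and "m \<equiv> real CARD('s::finite) * real CARD('k)"
  assumes ein: "block_einstein k l m a b"
  shows "einstein stiefel (block_metric a b :: (real^('s \<times> 'k)^('s \<times> 'k + 'l)) tensor2)"
proof -
  note e = ein[unfolded block_einstein_def]
  have pos: "a > 0" "b > 0" using e by blast+
  interpret weights "block_weight a b :: 's \<times> 'k \<Rightarrow> _" by (rule weights_block_weight[OF pos])
  have mk: "(real CARD('s) - 1) * real CARD('k) = m - k" "(real CARD('s) - 2) * real CARD('k) = m - 2 * k"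
    by (simp_all add: m_def k_def algebra_simps)
  show ?thesis
    unfolding block_metric_def
  proof (rule einstein_stiefel)
    show "(\<Sum>j\<in>- {i}. block_weight a b i j - 1) = (k - 1) * (a - 1) + (m - k) * (b - 1)" for i :: "'s \<times> 'k"
      unfolding sum_block_weight_row mk by (simp add: k_def)
    fix i j :: "'s \<times> 'k" assume "i \<noteq> j"
    have "real CARD('l) - 1 - ((k - 1) * (a - 1) + (m - k) * (b - 1)) = l + m - 2 - (k - 1) * a - (m - k) * b"
      by (simp add: l_def algebra_simps)
    then show "group_ricci i j + real CARD('l) * (block_weight a b i j)\<^sup>2
        = (real CARD('l) - 1 - ((k - 1) * (a - 1) + (m - k) * (b - 1))) * block_weight a b i j"
      using e unfolding group_ricci_block_weight[OF pos \<open>i \<noteq> j\<close>] mk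
      by (simp add: block_weight_def k_def l_def)
  qed
qed

section \<open>Invariance, proportionality and Jensen's metrics\<close>

lemma diff_act:
  assumes "u \<in> tangent M p"
  shows "diff M (act a b) p u = a ** u ** transpose b"
  unfolding act_def
  by (rule diff_eqI[OF assms])
     (intro bounded_linear.has_derivative[OF matmul.bounded_linear_left]
       bounded_linear.has_derivative[OF matmul.bounded_linear_right] has_derivative_ident)

lemma SO_orthogonal: "a \<in> SO \<Longrightarrow> transpose a ** a = mat 1" "a \<in> SO \<Longrightarrow> a ** transpose a = mat 1"
  by (simp_all add: SO_def rotation_matrix_def orthogonal_matrix_def)

lemma inner_orthogonal_conj:
  fixes a :: "real^'n^'n" and b :: "real^'m^'m"
  assumes "transpose a ** a = mat 1" "transpose b ** b = mat 1"
  shows "(a ** X ** transpose b) \<bullet> (a ** Y ** transpose b) = X \<bullet> Y"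
proof -
  have "a ** Y ** transpose b ** b = a ** Y"
    using assms(2) by (simp flip: matrix_mul_assoc)
  then have "(a ** X ** transpose b) \<bullet> (a ** Y ** transpose b) = (a ** X) \<bullet> (a ** Y)"
    by (simp add: inner_matrix_mult_right)
  also have "\<dots> = X \<bullet> Y" using assms(1) by (simp add: inner_matrix_mult_left matrix_mul_assoc)
  finally show ?thesis .
qed

text \<open>A nonzero entry of \<open>b\<close> joins indices of the same block, and the weight
  depends on the blocks only, so it can be moved past \<open>b\<close>. Invariance under the right
  factor of the action rests on this.\<close>

lemma hadamard_block_commute:
  fixes b :: "real^('s::finite \<times> 'k::finite)^('s \<times> 'k)" and w :: "'s \<Rightarrow> 's \<Rightarrow> real"
  assumes "\<And>i j. fst i \<noteq> fst j \<Longrightarrow> b $ i $ j = 0"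
  shows "hadamard (\<lambda>i j. w (fst i) (fst j)) (b ** X ** transpose b)
    = b ** hadamard (\<lambda>i j. w (fst i) (fst j)) X ** transpose b"
proof -
  have left: "w (fst i) f * (b $ i $ r * x) = b $ i $ r * (w (fst r) f * x)" for i r f x
    using assms[of i r] by (cases "fst i = fst r") auto
  have right: "w f (fst j) * (x * b $ j $ r) = (w f (fst r) * x) * b $ j $ r" for j r f x
    using assms[of j r] by (cases "fst j = fst r") auto
  have mult_left: "hadamard (\<lambda>i j. w (fst i) (fst j)) (b ** Y) = b ** hadamard (\<lambda>i j. w (fst i) (fst j)) Y"
    for Y :: "real^('s \<times> 'k)^('s \<times> 'k)"
    by (simp add: vec_eq_iff hadamard_component matrix_mult_component sum_distrib_left left)
  have "hadamard (\<lambda>i j. w (fst i) (fst j)) (Y ** transpose b) = hadamard (\<lambda>i j. w (fst i) (fst j)) Y ** transpose b"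
    for Y :: "real^('s \<times> 'k)^('s \<times> 'k)"
    by (simp add: vec_eq_iff hadamard_component matrix_mult_component transpose_def sum_distrib_left right)
  then show ?thesis by (simp add: mult_left)
qed

lemma SO_blocksD:
  fixes b :: "real^('s::finite \<times> 'k::finite)^('s \<times> 'k)"
  assumes "b \<in> SO_blocks"
  shows "fst i \<noteq> fst j \<Longrightarrow> b $ i $ j = 0" "transpose b ** b = mat 1"
proof -
  obtain c :: "'s \<Rightarrow> real^'k^'k" where c: "\<And>i. c i \<in> SO"
    "b = (\<chi> p q. if fst p = fst q then c (fst p) $ snd p $ snd q else 0)"
    using assms by (auto simp: SO_blocks_def)
  show "fst i \<noteq> fst j \<Longrightarrow> b $ i $ j = 0" by (simp add: c)
  have "(transpose b ** b) $ i $ j = mat 1 $ i $ j" for i j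
  proof -
    have "(transpose b ** b) $ i $ j = (\<Sum>f\<in>UNIV. \<Sum>r\<in>UNIV. b $ (f, r) $ i * b $ (f, r) $ j)"
      by (simp add: matrix_mult_component transpose_def sum_UNIV_prod)
    also have "\<dots> = (\<Sum>f\<in>UNIV. if f = fst i then
        if fst i = fst j then \<Sum>r\<in>UNIV. c (fst i) $ r $ snd i * c (fst i) $ r $ snd j else 0 else 0)"
      by (rule sum.cong) (auto simp: c(2))
    also have "\<dots> = (if fst i = fst j then (transpose (c (fst i)) ** c (fst i)) $ snd i $ snd j else 0)"
      by (simp add: matrix_mult_component transpose_def)
    also have "\<dots> = mat 1 $ i $ j"
      using SO_orthogonal(1)[OF c(1)] by (auto simp: mat_def prod_eq_iff)
    finally show ?thesis .
  qed
  then show "transpose b ** b = mat 1" by (simp add: vec_eq_iff)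
qed

lemma mat_1_in_SO_blocks: "mat 1 \<in> SO_blocks"
  unfolding SO_blocks_def
  by (rule CollectI, rule exI[of _ "\<lambda>_. mat 1"], intro conjI allI mat_1_in_SO)
     (auto simp: vec_eq_iff mat_def prod_eq_iff)

lemma block_metric_invariant:
  assumes "\<alpha> > 0" "\<beta> > 0"
  shows "invariant_under stiefel {act a b |a b. a \<in> SO \<and> b \<in> SO_blocks}
    (block_metric \<alpha> \<beta> :: (real^('s::finite \<times> 'k::finite)^('s \<times> 'k + 'l::finite)) tensor2)"
  unfolding invariant_under_def
proof (intro ballI)
  interpret weights "block_weight \<alpha> \<beta> :: 's \<times> 'k \<Rightarrow> _" by (rule weights_block_weight[OF assms])
  fix \<Phi> :: "real^('s \<times> 'k)^('s \<times> 'k + 'l) \<Rightarrow> real^('s \<times> 'k)^('s \<times> 'k + 'l)"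
    and p u v :: "real^('s \<times> 'k)^('s \<times> 'k + 'l)"
  assume "\<Phi> \<in> {act a b |a b. a \<in> SO \<and> b \<in> SO_blocks}"
    and u: "u \<in> tangent stiefel p" and v: "v \<in> tangent stiefel p"
  then obtain a b where ab: "\<Phi> = act a b" "a \<in> SO" "b \<in> SO_blocks" by blast
  note b = SO_blocksD[OF ab(3)]
  have d: "(\<lambda>i j. block_weight \<alpha> \<beta> i j - 1)
      = (\<lambda>i j :: 's \<times> 'k. (\<lambda>f f'. (if f = f' then \<alpha> else \<beta>) - 1) (fst i) (fst j))"
    by (auto simp: block_weight_def fun_eq_iff)
  have D: "D (b ** X ** transpose b) = b ** D X ** transpose b" for X :: "real^('s \<times> 'k)^('s \<times> 'k)"
    unfolding d by (rule hadamard_block_commute) (rule b(1))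
  have "transpose (a ** p ** transpose b) ** (a ** x ** transpose b) = b ** (transpose p ** x) ** transpose b" for x
  proof -
    have "transpose (a ** p ** transpose b) ** (a ** x ** transpose b)
        = b ** transpose p ** (transpose a ** a) ** x ** transpose b"
      by (simp add: transpose_simps matrix_mul_assoc)
    then show ?thesis by (simp add: SO_orthogonal(1)[OF ab(2)] matrix_mul_assoc)
  qed
  then show "block_metric \<alpha> \<beta> (\<Phi> p) (diff stiefel \<Phi> p u) (diff stiefel \<Phi> p v) = block_metric \<alpha> \<beta> p u v"
    unfolding ab(1) diff_act[OF u] diff_act[OF v] act_def[of a b p] block_metric_def metric_def
    by (simp add: D inner_orthogonal_conj[OF SO_orthogonal(1)[OF ab(2)] b(2)] inner_orthogonal_conj[OF b(2) b(2)])
qed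

section \<open>Comparison of the metrics at the base frame\<close>

lemma base_frame_in_stiefel: "base_frame \<in> stiefel"
  unfolding stiefel_def using mat_1_in_SO by (metis image_eqI matrix_mul_lid)

lemma base_frame_orthonormal: "transpose base_frame ** base_frame = mat 1"
  by (rule stiefel_orthonormal[OF base_frame_in_stiefel])

lemma transpose_base_frame_mult:
  fixes X :: "real^'a^('m::finite + 'l::finite)"
  shows "(transpose (base_frame :: real^'m^('m + 'l)) ** X) $ i $ j = X $ Inl i $ j"
proof -
  have "(transpose base_frame ** X) = transpose (transpose X ** (base_frame :: real^'m^('m + 'l)))"
    by (simp add: transpose_simps)
  then show ?thesis
    by (simp add: transpose_def matrix_mult_component base_frame_def if_distrib[of "\<lambda>x. _ * x"] cong: if_cong)
qed

lemma base_frame_mult: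
  "((base_frame :: real^'m^('m::finite + 'l::finite)) ** X) $ i $ j = (case i of Inl a \<Rightarrow> X $ a $ j | Inr r \<Rightarrow> 0)"
  by (cases i)
     (simp_all add: matrix_mult_component base_frame_def if_distrib[of "\<lambda>x. x * _"] cong: if_cong)

lemma block_metric_base:
  fixes u v :: "(real^('s::finite \<times> 'k::finite)^('s \<times> 'k)) \<times> (real^('s \<times> 'k)^('s \<times> 'k + 'l::finite))"
  assumes "\<alpha> > 0" "\<beta> > 0" "u \<in> split_tangent base_frame" "v \<in> split_tangent base_frame"
  shows "block_metric \<alpha> \<beta> base_frame (join base_frame u) (join base_frame v)
    = fst u \<bullet> hadamard (block_weight \<alpha> \<beta>) (fst v) + snd u \<bullet> snd v"
proof -
  interpret weights "block_weight \<alpha> \<beta> :: 's \<times> 'k \<Rightarrow> _" by (rule weights_block_weight[OF assms(1,2)])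
  show ?thesis
    unfolding block_metric_def by (rule metric_join[OF base_frame_orthonormal assms(3,4)])
qed

lemma inner_hadamard_skew_unit:
  assumes "w i j = w j i" "i \<noteq> j"
  shows "skew_unit i j \<bullet> hadamard w (skew_unit i j) = w i j / 2"
proof -
  have "hadamard w (skew_unit i j) = w i j *\<^sub>R skew_unit i j"
    using assms by (auto simp: vec_eq_iff hadamard_component skew_unit_component)
  then show ?thesis using assms(2) by (simp add: inner_skew_unit skew_unit_component)
qed

lemma skew_unit_in_split_tangent: "(skew_unit i j, 0) \<in> split_tangent p"
  by (simp add: split_tangent_def skew_unit_in_so matmul.zero_right)

lemma distinct_block_indices:
  assumes "CARD('s::finite) > 1" "CARD('k::finite) > 1"
  obtains i j i' j' :: "'s::finite \<times> 'k::finite" where "i \<noteq> j" "fst i = fst j" "fst i' \<noteq> fst j'"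
proof -
  have "\<exists>x y :: 's. x \<noteq> y" "\<exists>x y :: 'k. x \<noteq> y"
    using assms card_le_Suc0_iff_eq[of "UNIV :: 's set"] card_le_Suc0_iff_eq[of "UNIV :: 'k set"] by auto
  then obtain s s' :: 's and k k' :: 'k where "s \<noteq> s'" "k \<noteq> k'" by blast
  then show ?thesis by (intro that[of "(s, k)" "(s, k')" "(s, k)" "(s', k)"]) auto
qed

lemma proportional_block_metric:
  fixes \<alpha> \<beta> :: real
  assumes "CARD('s::finite) > 1" "CARD('k::finite) > 1"
    and pos: "\<alpha> > 0" "\<beta> > 0" "\<alpha>' > 0" "\<beta>' > 0"
    and scaled: "proportional stiefel (block_metric \<alpha> \<beta> :: (real^('s \<times> 'k)^('s \<times> 'k + 'l::finite)) tensor2)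
      (block_metric \<alpha>' \<beta>')"
  shows "\<alpha> = \<alpha>' \<and> \<beta> = \<beta>'"
proof -
  let ?p = "base_frame :: real^('s \<times> 'k)^('s \<times> 'k + 'l)"
  obtain c where c: "\<And>p u v. p \<in> stiefel \<Longrightarrow> u \<in> tangent stiefel p \<Longrightarrow> v \<in> tangent stiefel p \<Longrightarrow>
      (block_metric \<alpha>' \<beta>' :: (real^('s \<times> 'k)^('s \<times> 'k + 'l)) tensor2) p u v = c * block_metric \<alpha> \<beta> p u v"
    using scaled unfolding proportional_def by blast
  have eq: "fst u \<bullet> hadamard (block_weight \<alpha>' \<beta>') (fst u) + snd u \<bullet> snd u
      = c * (fst u \<bullet> hadamard (block_weight \<alpha> \<beta>) (fst u) + snd u \<bullet> snd u)"
    if u: "u \<in> split_tangent ?p" for u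
    using c[OF base_frame_in_stiefel, of "join ?p u" "join ?p u"] u
    by (simp add: block_metric_base pos tangent_stiefel_join[OF base_frame_in_stiefel])
  obtain x :: 'l and y :: "'s \<times> 'k" where True by blast
  \<comment> \<open>All metrics of the family give this vector length 1, so the factor is 1; the
    skew units then read off both weights.\<close>
  let ?h = "unit_matrix (Inr x) y :: real^('s \<times> 'k)^('s \<times> 'k + 'l)"
  have "transpose ?p ** ?h = 0"
    by (simp add: vec_eq_iff transpose_base_frame_mult unit_matrix_def)
  then have "(0, ?h) \<in> split_tangent ?p"
    by (simp add: split_tangent_def subspace_0[OF subspace_so])
  moreover have "?h \<bullet> ?h = 1" by (subst inner_unit_matrix) (simp add: unit_matrix_def)
  ultimately have "c = 1" using eq[of "(0, ?h)"] by (simp add: hadamard_simps del: inner_eq_zero_iff)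
  then have "block_weight \<alpha>' \<beta>' i j = block_weight \<alpha> \<beta> i j" if "i \<noteq> j" for i j :: "'s \<times> 'k"
    using eq[OF skew_unit_in_split_tangent, of i j] that
    by (simp add: inner_hadamard_skew_unit block_weight_def)
  moreover obtain i j i' j' :: "'s \<times> 'k" where "i \<noteq> j" "fst i = fst j" "fst i' \<noteq> fst j'"
    using distinct_block_indices[OF assms(1,2)] by blast
  ultimately show ?thesis by (metis block_weight_def)
qed

lemma inner_block_diag:
  "(block_diag A 0 :: real^('m::finite + 'l::finite)^('m + 'l)) \<bullet> block_diag B 0 = A \<bullet> B"
  by (simp add: inner_matrix sum_UNIV_Plus block_diag_def)

lemma block_diag_in_so:
  assumes "A \<in> so" "B \<in> so"
  shows "(block_diag A B :: real^('m::finite + 'l::finite)^('m + 'l)) \<in> so"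
proof -
  have "transpose (block_diag A B :: real^('m + 'l)^('m + 'l)) = block_diag (transpose A) (transpose B)"
    by (simp add: vec_eq_iff transpose_def block_diag_def split: sum.splits)
  also have "\<dots> = - block_diag A B"
    using assms by (simp add: so_iff vec_eq_iff block_diag_def split: sum.splits)
  finally show ?thesis by (simp add: so_iff)
qed

text \<open>The Killing form is a nonzero multiple of the inner product, and testing against the
  diagonal blocks of \<open>C\<close> itself makes their squared norms vanish.\<close>

lemma p12D:
  fixes C :: "real^('m::finite + 'l::finite)^('m + 'l)"
  assumes C: "C \<in> p12" and n: "CARD('m) + CARD('l) > 2"
  shows "C \<in> so" "C $ Inl i $ Inl j = 0" "C $ Inr r $ Inr t = 0"
proof -
  show so: "C \<in> so" using C by (simp add: p12_def)
  have orth: "C \<bullet> block_diag A B = 0" if "A \<in> so" "B \<in> so" for A :: "real^'m^'m" and B :: "real^'l^'l"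
  proof -
    have "block_diag A B = block_diag A 0 + block_diag 0 B"
      by (simp add: vec_eq_iff block_diag_def split: sum.splits)
    moreover have "block_diag A 0 \<in> so_upper" "block_diag 0 B \<in> so_lower"
      using that by (auto simp: so_upper_def so_lower_def)
    then have "killing C (block_diag A 0 + block_diag 0 B) = 0" using C unfolding p12_def by blast
    ultimately have "killing C (block_diag A B) = 0" by simp
    then show ?thesis
      using n by (simp add: killing_eq[OF so block_diag_in_so[OF that]])
  qed
  define A :: "real^'m^'m" where "A = (\<chi> i j. C $ Inl i $ Inl j)"
  define B :: "real^'l^'l" where "B = (\<chi> i j. C $ Inr i $ Inr j)"
  have "transpose A $ i $ j = (- A) $ i $ j" for i j
    using so_component[OF so, of "Inl j" "Inl i"] by (simp add: A_def transpose_def)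
  moreover have "transpose B $ i $ j = (- B) $ i $ j" for i j
    using so_component[OF so, of "Inr j" "Inr i"] by (simp add: B_def transpose_def)
  ultimately have AB: "A \<in> so" "B \<in> so" unfolding so_iff vec_eq_iff by blast+
  have "C \<bullet> block_diag A B = A \<bullet> A + B \<bullet> B"
    by (simp add: inner_matrix sum_UNIV_Plus block_diag_def A_def B_def)
  then have "A = 0 \<and> B = 0"
    using orth[OF AB] by (metis add_nonneg_eq_0_iff inner_eq_zero_iff inner_ge_zero)
  then show "C $ Inl i $ Inl j = 0" "C $ Inr r $ Inr t = 0"
    by (auto simp: A_def B_def vec_eq_iff)
qed

text \<open>The factor 2 arises because \<open>C\<close> contains an off-diagonal block and minus
  its transpose, while \<open>C ** base_frame\<close> keeps only one of them.\<close>

lemma p12_inner: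
  fixes C C' :: "real^('m::finite + 'l::finite)^('m + 'l)"
  assumes "C \<in> p12" "C' \<in> p12" "CARD('m) + CARD('l) > 2"
  shows "C \<bullet> C' = 2 * ((C ** base_frame) \<bullet> (C' ** (base_frame :: real^'m^('m + 'l))))"
proof -
  note C = p12D[OF assms(1,3)] and C' = p12D[OF assms(2,3)]
  have "(\<Sum>i\<in>UNIV. \<Sum>j\<in>UNIV. C $ Inl i $ Inr j * C' $ Inl i $ Inr j)
      = (\<Sum>i\<in>UNIV. \<Sum>j\<in>UNIV. C $ Inr j $ Inl i * C' $ Inr j $ Inl i)"
  proof (intro sum.cong refl)
    fix i j show "C $ Inl i $ Inr j * C' $ Inl i $ Inr j = C $ Inr j $ Inl i * C' $ Inr j $ Inl i"
      using so_component[OF C(1), of "Inl i" "Inr j"] so_component[OF C'(1), of "Inl i" "Inr j"] by simp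
  qed
  also have "\<dots> = (\<Sum>j\<in>UNIV. \<Sum>i\<in>UNIV. C $ Inr j $ Inl i * C' $ Inr j $ Inl i)"
    by (rule sum.swap)
  finally show ?thesis
    by (simp add: inner_matrix sum_UNIV_Plus mult_base_frame C C')
qed

lemma jensen_vector:
  fixes A C :: "real^('m::finite + 'l::finite)^('m + 'l)"
  assumes "C \<in> p12" "CARD('m) + CARD('l) > 2" "W \<in> so" "A = block_diag W 0"
  shows "(A + C) ** base_frame = join base_frame (W, C ** base_frame)"
    and "(W, C ** base_frame) \<in> split_tangent (base_frame :: real^'m^('m + 'l))"
proof -
  have "A ** base_frame = base_frame ** W"
    unfolding vec_eq_iff mult_base_frame base_frame_mult assms(4)
    by (auto simp: block_diag_def split: sum.splits)
  then show "(A + C) ** base_frame = join base_frame (W, C ** base_frame)"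
    by (simp add: join_def matmul.add_left)
  have "transpose (base_frame :: real^'m^('m + 'l)) ** (C ** base_frame) = 0"
    by (simp add: vec_eq_iff transpose_base_frame_mult mult_base_frame p12D[OF assms(1,2)])
  then show "(W, C ** base_frame) \<in> split_tangent (base_frame :: real^'m^('m + 'l))"
    using assms(3) by (simp add: split_tangent_def)
qed

lemma hadamard_block_weight_const: "hadamard (block_weight c c) A = c *\<^sub>R A"
  by (simp add: vec_eq_iff hadamard_component block_weight_def)

lemma jensen_block_metric:
  fixes c :: real
  defines "m \<equiv> real CARD('s::finite \<times> 'k::finite)" and "n \<equiv> real CARD('s \<times> 'k) + real CARD('l::finite)"
  assumes c: "c > 0" and n: "n > 2"
    and quad: "(m - 2) / 4 - (n - 2) * c + (n - 1) * c\<^sup>2 = 0"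
  shows "jensen (block_metric c c :: (real^('s \<times> 'k)^('s \<times> 'k + 'l)) tensor2)"
  unfolding jensen_def
proof (intro conjI exI ballI)
  interpret weights "block_weight c c :: 's \<times> 'k \<Rightarrow> _" by (rule weights_block_weight[OF c c])
  show "riemannian_metric stiefel (block_metric c c :: (real^('s \<times> 'k)^('s \<times> 'k + 'l)) tensor2)"
    unfolding block_metric_def by (rule riemannian_metric_stiefel)
  show "invariant_under stiefel {act a (mat 1) |a. a \<in> SO} (block_metric c c :: (real^('s \<times> 'k)^('s \<times> 'k + 'l)) tensor2)"
    using block_metric_invariant[OF c c] mat_1_in_SO_blocks unfolding invariant_under_def by blast
  \<comment> \<open>The Killing form contributes n - 2, and \<open>p12\<close> a further factor 2,
    so these are the coefficients giving weight c on W and 1 on h.\<close>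
  show "c / (n - 2) > 0" "1 / (2 * (n - 2)) > 0" using c n by simp_all
  have scale: "(m - 2) * (1 / (2 * N))\<^sup>2 - 2 * N * (c / N) * (1 / (2 * N)) + (n - 1) * (c / N)\<^sup>2
      = ((m - 2) / 4 - N * c + (n - 1) * c\<^sup>2) / N\<^sup>2" if "N > 0" for N
    using that by (simp add: power2_eq_square field_simps)
  have "(m - 2) * (1 / (2 * (n - 2)))\<^sup>2 - 2 * (n - 2) * (c / (n - 2)) * (1 / (2 * (n - 2))) + (n - 1) * (c / (n - 2))\<^sup>2
      = ((m - 2) / 4 - (n - 2) * c + (n - 1) * c\<^sup>2) / (n - 2)\<^sup>2"
    by (rule scale) (use n in simp)
  also have "\<dots> = 0" unfolding quad by simp
  finally show "(real CARD('s \<times> 'k) - 2) * (1 / (2 * (n - 2)))\<^sup>2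
      - 2 * (real CARD('s \<times> 'k) + real CARD('l) - 2) * (c / (n - 2)) * (1 / (2 * (n - 2)))
      + (real CARD('s \<times> 'k) + real CARD('l) - 1) * (c / (n - 2))\<^sup>2 = 0"
    unfolding n_def[symmetric] unfolding m_def[symmetric] .
next
  fix A A' C C' :: "real^('s \<times> 'k + 'l)^('s \<times> 'k + 'l)"
  assume A: "A \<in> so_upper" "A' \<in> so_upper" and C: "C \<in> p12" "C' \<in> p12"
  obtain W W' where W: "W \<in> so" "A = block_diag W 0" "W' \<in> so" "A' = block_diag W' 0"
    using A by (auto simp: so_upper_def)
  have card: "CARD('s \<times> 'k) + CARD('l) > 2" using n unfolding n_def by linarith
  have card': "real CARD('s \<times> 'k + 'l) = n" by (simp add: n_def)
  have so0: "(0 :: real^'l^'l) \<in> so" by (rule subspace_0[OF subspace_so])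
  note v = jensen_vector[OF C(1) card W(1,2)] jensen_vector[OF C(2) card W(3,4)]
  have killing_A: "- killing A A' = (n - 2) * (W \<bullet> W')"
    unfolding W(2,4) killing_eq[OF block_diag_in_so[OF W(1) so0] block_diag_in_so[OF W(3) so0]] card'
      inner_block_diag by (simp add: left_diff_distrib)
  have killing_C: "- killing C C' = (n - 2) * (2 * ((C ** base_frame) \<bullet> (C' ** (base_frame :: real^('s \<times> 'k)^('s \<times> 'k + 'l)))))"
    unfolding killing_eq[OF p12D(1)[OF C(1) card] p12D(1)[OF C(2) card]] card' p12_inner[OF C card]
    by (simp add: left_diff_distrib)
  have cancel: "c / (n - 2) * ((n - 2) * x) = c * x" "1 / (2 * (n - 2)) * ((n - 2) * (2 * x)) = x" for x
    using n by (simp_all add: field_simps)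
  show "block_metric c c base_frame ((A + C) ** base_frame) ((A' + C') ** base_frame)
      = c / (n - 2) * (- killing A A') + 1 / (2 * (n - 2)) * (- killing C C')"
    unfolding v(1,3) block_metric_base[OF c c v(2,4)] killing_A killing_C cancel
    by (simp add: hadamard_block_weight_const)
qed

text \<open>Taking the \<open>p12\<close> components to be 0, Jensen's form makes the metric a
  single multiple of the Killing form on \<open>so_upper\<close>, which forces equal weights inside
  and between blocks.\<close>

lemma not_jensen_block_metric:
  assumes "CARD('s::finite) > 1" "CARD('k::finite) > 1" and pos: "\<alpha> > 0" "\<beta> > 0" and neq: "\<alpha> \<noteq> \<beta>"
  shows "\<not> jensen (block_metric \<alpha> \<beta> :: (real^('s \<times> 'k)^('s \<times> 'k + 'l::finite)) tensor2)"
proof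
  assume "jensen (block_metric \<alpha> \<beta> :: (real^('s \<times> 'k)^('s \<times> 'k + 'l)) tensor2)"
  then obtain x1 x12 where *: "\<And>A A' C C'. A \<in> so_upper \<Longrightarrow> A' \<in> so_upper \<Longrightarrow> C \<in> p12 \<Longrightarrow> C' \<in> p12 \<Longrightarrow>
      (block_metric \<alpha> \<beta> :: (real^('s \<times> 'k)^('s \<times> 'k + 'l)) tensor2) base_frame ((A + C) ** base_frame) ((A' + C') ** base_frame)
        = x1 * (- killing A A') + x12 * (- killing C C')"
    unfolding jensen_def by blast
  have so0: "(0 :: real^'n^'n) \<in> so" by (rule subspace_0[OF subspace_so])
  have card: "CARD('s \<times> 'k) + CARD('l) > 2"
  proof -
    have "2 * 2 \<le> CARD('s) * CARD('k)" using assms(1,2) by (intro mult_le_mono) auto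
    then show ?thesis by simp
  qed
  have k0: "killing 0 (B :: real^('s \<times> 'k + 'l)^('s \<times> 'k + 'l)) = 0" if "B \<in> so" for B
    by (simp add: killing_eq[OF so0 that])
  have p0: "(0 :: real^('s \<times> 'k + 'l)^('s \<times> 'k + 'l)) \<in> p12"
    by (auto simp: p12_def so0 so_upper_def so_lower_def intro!: k0 subspace_add[OF subspace_so] block_diag_in_so)
  have "block_weight \<alpha> \<beta> i j = x1 * (real CARD('s \<times> 'k + 'l) - 2)" if "i \<noteq> j" for i j :: "'s \<times> 'k"
  proof -
    let ?A = "block_diag (skew_unit i j) 0 :: real^('s \<times> 'k + 'l)^('s \<times> 'k + 'l)"
    have A: "?A \<in> so_upper" using skew_unit_in_so by (auto simp: so_upper_def)
    have "?A \<in> so" by (intro block_diag_in_so skew_unit_in_so so0)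
    note v = jensen_vector[OF p0 card skew_unit_in_so refl, of i j]
    have "skew_unit i j \<bullet> hadamard (block_weight \<alpha> \<beta>) (skew_unit i j)
        = x1 * ((real CARD('s \<times> 'k + 'l) - 2) * (skew_unit i j \<bullet> skew_unit i j))"
      using *[OF A A p0 p0] unfolding v(1) block_metric_base[OF pos v(2) v(2)]
      by (simp add: killing_eq[OF \<open>?A \<in> so\<close> \<open>?A \<in> so\<close>] k0[OF so0] inner_block_diag
          matmul.zero_left) (simp add: algebra_simps)
    then show ?thesis
      using that by (simp add: inner_hadamard_skew_unit block_weight_def inner_skew_unit skew_unit_component)
  qed
  moreover obtain i j i' j' :: "'s \<times> 'k" where "i \<noteq> j" "fst i = fst j" "fst i' \<noteq> fst j'"
    using distinct_block_indices[OF assms(1,2)] by blast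
  ultimately show False using neq by (metis block_weight_def)
qed

section \<open>Assembling the four metrics\<close>

theorem theorem1:
  fixes s k l :: nat
  assumes "CARD('s::finite) = s" "CARD('k::finite) = k" "CARD('l::finite) = l"
    and "s > 1" "k \<ge> 3" "l > k"
  shows "\<exists>\<G> :: (real^('s \<times> 'k)^('s \<times> 'k + 'l)) tensor2 set.
     card \<G> = 4 \<and>
     (\<forall>g\<in>\<G>. riemannian_metric stiefel g \<and>
        invariant_under stiefel {act a b |a b. a \<in> SO \<and> b \<in> SO_blocks} g \<and>
        einstein stiefel g) \<and>
     (\<forall>g\<in>\<G>. \<forall>h\<in>\<G>. g \<noteq> h \<longrightarrow> \<not> proportional stiefel g h) \<and>
     card {g \<in> \<G>. jensen g} = 2"
proof -
  let ?g = "\<lambda>(a, b). block_metric a b :: (real^('s \<times> 'k)^('s \<times> 'k + 'l)) tensor2"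
  let ?k = "real k" and ?l = "real l" and ?m = "real s * real k"
  have card: "CARD('s) > 1" "CARD('k) > 1" using assms by auto
  have m: "?m \<ge> 2 * ?k" using assms by (intro mult_right_mono) auto
  have k: "?k \<ge> 3" "?l > ?k" using assms by auto
  let ?P = "block_einstein ?k ?l ?m"
  have good: "riemannian_metric stiefel (?g (a, b)) \<and>
      invariant_under stiefel {act a b |a b. a \<in> SO \<and> b \<in> SO_blocks} (?g (a, b)) \<and> einstein stiefel (?g (a, b))"
    if "?P a b" for a b
  proof -
    have pos: "a > 0" "b > 0" using that by (auto simp: block_einstein_def)
    have ein: "einstein stiefel (?g (a, b))"
      using einstein_block_metric that unfolding assms(1-3)[symmetric] by simp
    then show ?thesis using block_metric_invariant[OF pos] by (simp add: einstein_def)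
  qed
  have "?m > 2" "?m + ?l > ?m + 1" using k m by linarith+
  from quadratic_two_roots[OF this] obtain c d where cd: "0 < c" "c < 1/2" "1/2 < d"
    "(?m - 2) / 4 - (?m + ?l - 2) * c + (?m + ?l - 1) * c\<^sup>2 = 0"
    "(?m - 2) / 4 - (?m + ?l - 2) * d + (?m + ?l - 1) * d\<^sup>2 = 0"
    by blast
  obtain a b a' b' where ab: "?P a b" "a < b" "?P a' b'" "a' < b'" "b < b'"
    using block_einstein_solutions[OF k m] by blast
  have ab_pos: "0 < a" "0 < a'" "0 < b" "0 < b'" using ab by (auto simp: block_einstein_def)
  \<comment> \<open>For equal weights both block equations reduce to Jensen's quadratic with n = m +
    l.\<close>
  have Pcd: "?P c c" "?P d d"
    using cd unfolding block_einstein_def by (simp_all add: power2_eq_square field_simps)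
  let ?S = "{(c, c), (d, d), (a, b), (a', b')}"
  have pos: "x > 0" "y > 0" if "(x, y) \<in> ?S" for x y using that cd ab_pos by auto
  have not_prop: "u = v" if "u \<in> ?S" "v \<in> ?S" "proportional stiefel (?g u) (?g v)" for u v
    using proportional_block_metric[OF card, of "fst u" "snd u" "fst v" "snd v"] that pos[of "fst u" "snd u"] pos[of "fst v" "snd v"]
    by (auto simp: case_prod_beta prod_eq_iff)
  have "inj_on ?g ?S"
  proof (rule inj_onI)
    fix u v assume uv: "u \<in> ?S" "v \<in> ?S" "?g u = ?g v"
    have "proportional stiefel (?g u) (?g u)" unfolding proportional_def by (intro exI[of _ 1]) simp
    then show "u = v" using not_prop[OF uv(1,2)] uv(3) by simp
  qed
  \<comment> \<open>The first two pairs have equal entries and are separated by 1/2; the last two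
    have a < b and a' < b' and are separated by b < b'.\<close>
  have card4: "card ?S = 4" using cd ab by auto
  have jensen: "jensen (?g u) \<longleftrightarrow> u \<in> {(c, c), (d, d)}" if "u \<in> ?S" for u
  proof -
    have "jensen (?g (c, c))" "jensen (?g (d, d))"
      using cd \<open>?m > 2\<close> k assms(1-3) by (auto intro!: jensen_block_metric)
    moreover have "\<not> jensen (?g (a, b))" "\<not> jensen (?g (a', b'))"
      using ab not_jensen_block_metric[OF card ab_pos(1,3)] not_jensen_block_metric[OF card ab_pos(2,4)] by auto
    ultimately show ?thesis using that by auto
  qed
  have "{g \<in> ?g ` ?S. jensen g} = ?g ` {(c, c), (d, d)}" using jensen by blast
  then have "card {g \<in> ?g ` ?S. jensen g} = card {(c, c), (d, d)}"
    using card_image[OF inj_on_subset[OF \<open>inj_on ?g ?S\<close>], of "{(c, c), (d, d)}"] by simp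
  also have "\<dots> = 2" using cd by auto
  finally have card2: "card {g \<in> ?g ` ?S. jensen g} = 2" .
  show ?thesis
  proof (intro exI[of _ "?g ` ?S"] conjI ballI impI)
    show "card (?g ` ?S) = 4" using card_image[OF \<open>inj_on ?g ?S\<close>] card4 by simp
    fix g assume "g \<in> ?g ` ?S"
    then obtain x y where "(x, y) \<in> ?S" "g = ?g (x, y)" by auto
    then have "?P x y" "g = ?g (x, y)" using Pcd ab by auto
    then show "riemannian_metric stiefel g"
      "invariant_under stiefel {act a b |a b. a \<in> SO \<and> b \<in> SO_blocks} g" "einstein stiefel g"
      using good by blast+
  next
    fix g h assume "g \<in> ?g ` ?S" "h \<in> ?g ` ?S" "g \<noteq> h"
    then show "\<not> proportional stiefel g h" using not_prop by blast
  qed (rule card2)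
qed

end
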